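(* Let $(W,S)$ be a crystallographic Coxeter system and let $u,w\in W$ with $u\le w$. Then for all $x$ with $u\le x<w$, \[[(q-1)^2]\Big(\sum_{x\le v\le w}R_{xv}\Big)-\binom{\ell(x,w)}{2}\ \ge\ 0.\quad( * )\] Moreover, $[u,w]$ is singular if and only if $( * )$ is strict for some $x$ with $u\le x<w$.
   Context: $(W,S)$ is a Coxeter system with length function $\ell$ and reflections $T=\bigcup_{w\in W}w^{-1}Sw$; it is crystallographic if all entries of its Coxeter matrix lie in $\{2,3,4,6,\infty\}$. Write $u\to v$ if $v=ut$ for some $t\in T$ and $\ell(u)<\ell(v)$; Bruhat order $u\le w$ means there is a chain $u\to v_1\to\cdots\to v_n=w$, and $[u,w]=\{v:u\le v\le w\}$. Set $\ell(u,w)=\ell(w)-\ell(u)$. The $R$-polynomials $R_{uw}(q)\in\mathbb{Z}[q]$ are the unique family with $R_{uw}=0$ if $u\not\le w$, $R_{ww}=1$, and, for $s\in S$ with $ws<w$: $R_{uw}=R_{us,ws}$ if $us<u$, and $R_{uw}=qR_{us,ws}+(q-1)R_{u,ws}$ if $u<us$. For a polynomial $f$, $[(q-1)^n](f):=f^{(n)}(1)/n!$. For $x\le w$ let $\overline{N}(x,w)=\{v\in W: x\to v\le w\}$, $\overline{\ell}(x,w)=|\overline{N}(x,w)|$ and $\mathrm{df}(x,w)=\overline{\ell}(x,w)-\ell(x,w)$. The interval $[u,w]$ is rationally smooth if $\mathrm{df}(x,w)=0$ for all $x$ with $u\le x<w$ (equivalently, $\sum_{x\le v\le w}R_{xv}(q)=q^{\ell(x,w)}$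 for all such $x$), and singular otherwise. *)

theory Defs
  imports "HOL-Algebra.Multiplicative_Group" "HOL-Computational_Algebra.Polynomial"
begin

text \<open>The entry of the Coxeter matrix at \<open>(s, t)\<close> is the order of \<open>st\<close>; since
  \<^const>\<open>group.ord\<close> is \<open>0\<close> on elements of infinite order, \<open>0\<close> encodes the entry \<open>\<infinity>\<close>.\<close>

definition coxeter_matrix :: "('a, 'b) monoid_scheme \<Rightarrow> 'a \<Rightarrow> 'a \<Rightarrow> nat" where
  "coxeter_matrix W s t = group.ord W (s \<otimes>\<^bsub>W\<^esub> t)"

definition word_prod :: "('a, 'b) monoid_scheme \<Rightarrow> 'a list \<Rightarrow> 'a" where
  "word_prod W ss = foldr (\<lambda>s x. s \<otimes>\<^bsub>W\<^esub> x) ss \<one>\<^bsub>W\<^esub>"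

text \<open>One application of a defining relation \<open>(st)\<^bsup>m(s,t)\<^esup> = 1\<close> inside a word over \<open>S\<close>.
  For \<open>s = t\<close> it is \<open>s\<^sup>2 = 1\<close>, and for \<open>m(s,t) = \<infinity>\<close> (encoded by \<open>0\<close>) it is vacuous.\<close>

inductive coxeter_step :: "('a, 'b) monoid_scheme \<Rightarrow> 'a set \<Rightarrow> 'a list \<Rightarrow> 'a list \<Rightarrow> bool"
  for W S where
  "\<lbrakk>s \<in> S; t \<in> S; set xs \<subseteq> S; set ys \<subseteq> S\<rbrakk> \<Longrightarrow>
     coxeter_step W S (xs @ concat (replicate (coxeter_matrix W s t) [s, t]) @ ys) (xs @ ys)"

text \<open>\<open>W\<close> is presented by the generators \<open>S\<close> and the relations \<open>(st)\<^bsup>m(s,t)\<^esup> = 1\<close>. Because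
  \<open>s\<^sup>2 = 1\<close> is among the relations, inverse letters are not needed, and the group presentation is
  the monoid presentation: words over \<open>S\<close> modulo the congruence generated by the relations.\<close>

locale coxeter_system = group W for W :: "('a, 'b) monoid_scheme" (structure) +
  fixes S :: "'a set"
  assumes S_subset: "S \<subseteq> carrier W"
    and S_generates: "generate W S = carrier W"
    and S_involutions: "s \<in> S \<Longrightarrow> s \<noteq> \<one> \<and> s \<otimes> s = \<one>"
    and presentation: "\<lbrakk>set xs \<subseteq> S; set ys \<subseteq> S; word_prod W xs = word_prod W ys\<rbrakk>
      \<Longrightarrow> equivclp (coxeter_step W S) xs ys"

definition crystallographic :: "('a, 'b) monoid_scheme \<Rightarrow> 'a set \<Rightarrow> bool" where
  "crystallographic W S \<longleftrightarrow>
     (\<forall>s\<in>S. \<forall>t\<in>S. s \<noteq> t \<longrightarrow> coxeter_matrix W s t \<in> {2, 3, 4, 6, 0})"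

definition cox_length :: "('a, 'b) monoid_scheme \<Rightarrow> 'a set \<Rightarrow> 'a \<Rightarrow> nat" where
  "cox_length W S w = (LEAST n. \<exists>ss. set ss \<subseteq> S \<and> length ss = n \<and> word_prod W ss = w)"

definition reflections :: "('a, 'b) monoid_scheme \<Rightarrow> 'a set \<Rightarrow> 'a set" where
  "reflections W S = (\<Union>w\<in>carrier W. {inv\<^bsub>W\<^esub> w \<otimes>\<^bsub>W\<^esub> s \<otimes>\<^bsub>W\<^esub> w | s. s \<in> S})"

definition bruhat_edge :: "('a, 'b) monoid_scheme \<Rightarrow> 'a set \<Rightarrow> 'a \<Rightarrow> 'a \<Rightarrow> bool" where
  "bruhat_edge W S u v \<longleftrightarrow> u \<in> carrier W \<and> v \<in> carrier W \<and>
     (\<exists>t\<in>reflections W S. v = u \<otimes>\<^bsub>W\<^esub> t) \<and> cox_length W S u < cox_length W S v"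

definition bruhat_le :: "('a, 'b) monoid_scheme \<Rightarrow> 'a set \<Rightarrow> 'a \<Rightarrow> 'a \<Rightarrow> bool" where
  "bruhat_le W S u w \<longleftrightarrow> u \<in> carrier W \<and> w \<in> carrier W \<and> (bruhat_edge W S)\<^sup>*\<^sup>* u w"

definition bruhat_less :: "('a, 'b) monoid_scheme \<Rightarrow> 'a set \<Rightarrow> 'a \<Rightarrow> 'a \<Rightarrow> bool" where
  "bruhat_less W S u w \<longleftrightarrow> bruhat_le W S u w \<and> u \<noteq> w"

definition bruhat_interval :: "('a, 'b) monoid_scheme \<Rightarrow> 'a set \<Rightarrow> 'a \<Rightarrow> 'a \<Rightarrow> 'a set" where
  "bruhat_interval W S u w = {v. bruhat_le W S u v \<and> bruhat_le W S v w}"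

text \<open>Only used for \<open>u \<le> w\<close> in Bruhat order, so that the subtraction does not truncate.\<close>

definition length_diff :: "('a, 'b) monoid_scheme \<Rightarrow> 'a set \<Rightarrow> 'a \<Rightarrow> 'a \<Rightarrow> nat" where
  "length_diff W S u w = cox_length W S w - cox_length W S u"

text \<open>The polynomial \<open>q\<close> is \<open>[:0, 1:]\<close>.\<close>

definition is_R_family ::
  "('a, 'b) monoid_scheme \<Rightarrow> 'a set \<Rightarrow> ('a \<Rightarrow> 'a \<Rightarrow> int poly) \<Rightarrow> bool" where
  "is_R_family W S R \<longleftrightarrow>
     (\<forall>u w. \<not> bruhat_le W S u w \<longrightarrow> R u w = 0) \<and>
     (\<forall>w\<in>carrier W. R w w = 1) \<and>
     (\<forall>u\<in>carrier W. \<forall>w\<in>carrier W. \<forall>s\<in>S. bruhat_less W S (w \<otimes>\<^bsub>W\<^esub> s) w \<longrightarrow>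
        (bruhat_less W S (u \<otimes>\<^bsub>W\<^esub> s) u \<longrightarrow> R u w = R (u \<otimes>\<^bsub>W\<^esub> s) (w \<otimes>\<^bsub>W\<^esub> s)) \<and>
        (bruhat_less W S u (u \<otimes>\<^bsub>W\<^esub> s) \<longrightarrow>
           R u w = [:0, 1:] * R (u \<otimes>\<^bsub>W\<^esub> s) (w \<otimes>\<^bsub>W\<^esub> s)
             + ([:0, 1:] - 1) * R u (w \<otimes>\<^bsub>W\<^esub> s)))"

text \<open>Pairs outside the carrier are not related by \<^const>\<open>bruhat_le\<close>, so the first clause above
  fixes the value \<open>0\<close> there and the family is unique as a total function.\<close>

definition R_poly :: "('a, 'b) monoid_scheme \<Rightarrow> 'a set \<Rightarrow> 'a \<Rightarrow> 'a \<Rightarrow> int poly" where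
  "R_poly W S = (THE R. is_R_family W S R)"

definition coeff_q_minus_1 :: "nat \<Rightarrow> int poly \<Rightarrow> rat" where
  "coeff_q_minus_1 n f = of_int (poly ((pderiv ^^ n) f) 1) / fact n"

definition upper_nbrs :: "('a, 'b) monoid_scheme \<Rightarrow> 'a set \<Rightarrow> 'a \<Rightarrow> 'a \<Rightarrow> 'a set" where
  "upper_nbrs W S x w = {v \<in> carrier W. bruhat_edge W S x v \<and> bruhat_le W S v w}"

definition defect :: "('a, 'b) monoid_scheme \<Rightarrow> 'a set \<Rightarrow> 'a \<Rightarrow> 'a \<Rightarrow> int" where
  "defect W S x w = int (card (upper_nbrs W S x w)) - int (length_diff W S x w)"

definition rationally_smooth :: "('a, 'b) monoid_scheme \<Rightarrow> 'a set \<Rightarrow> 'a \<Rightarrow> 'a \<Rightarrow> bool" where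
  "rationally_smooth W S u w \<longleftrightarrow>
     (\<forall>x. bruhat_le W S u x \<and> bruhat_less W S x w \<longrightarrow> defect W S x w = 0)"

definition singular_interval :: "('a, 'b) monoid_scheme \<Rightarrow> 'a set \<Rightarrow> 'a \<Rightarrow> 'a \<Rightarrow> bool" where
  "singular_interval W S u w \<longleftrightarrow> \<not> rationally_smooth W S u w"

end

theory Submission
  imports Defs Complex_Main "HOL-Library.Poly_Mapping" "HOL-Computational_Algebra.Fraction_Field"
begin

text \<open>The Taylor coefficient of \<open>(q - 1)\<^sup>2\<close> in \<open>R\<^bsub>xv\<^esub>\<close> at \<open>q = 1\<close> is half of \<open>N + e (\<ell>(x,v) - 1)\<close>, where \<open>N\<close> counts 
  the paths \<open>x \<rightarrow> y \<rightarrow> v\<close>, and \<open>e\<close> is \<open>1\<close> if \<open>x \<rightarrow> v\<close> and \<open>0\<close> otherwise. Summing over \<open>v\<close>, twice the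
  left-hand side of the inequality becomes \<open>df(x,w) (\<ell>(x,w) - 1) + \<Sum> df(v,w)\<close>, the sum being over \<open>x \<rightarrow> v \<le> w\<close>. So 
  everything follows from Deodhar's inequality \<open>df \<ge> 0\<close>, which holds for all Coxeter groups. Following 
  Dyer, write the nil Hecke element \<open>x\<^sub>w\<close> as \<open>\<Sum>\<^sub>v c(w,v) v\<close>. The rational function \<open>c(w,v)\<close> is homogeneous of 
  degree \<open>-\<ell>(w)\<close> and has at most simple poles, along the roots of the reflections \<open>t\<close> with \<open>tv \<le> w\<close>; hence 
  there are at least \<open>\<ell>(w)\<close> of these unless \<open>c(w,v) = 0\<close>. Chevalley's formula for \<open>x\<^sub>w \<lambda>\<close> with \<open>\<lambda>\<close> dominant regular 
  writes \<open>c(w,v)\<close>, up to sign, as a positive sum over saturated chains from \<open>v\<close> to \<open>w\<close>, so it is nonzero for 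
  \<open>v \<le> w\<close>. Instead of polynomials in many variables we use their restrictions to a generic line.\<close>

section \<open>Length function\<close>

text \<open>For the former it comes from the commutation of left and right Hecke operators, for the
  latter from Chevalley's formula. On a line homogeneity is no longer visible. Its substitute is
  that the degree of the numerator stays at least \<ell>(w) below that of the denominator;
  genericity keeps the zeros of the finitely many roots involved apart, so that counting poles
  counts reflections. Among the elements tv \<le> w, those below v number at most \<ell>(v) and the
  others are the upper neighbours of v, which turns the bound \<ell>(w) into
  \<open>df \<ge> 0\<close>. The factor \<ell>(x,w) - 1 vanishes for \<ell>(x,w) = 1. The defect is
  0 there as well, so a positive defect always makes the first summand positive. Conversely, every v
  in the sum lies in [u,w], so smoothness makes both summands vanish.\<close>

context coxeter_system
begin

abbreviation len :: "'a \<Rightarrow> nat" where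
  "len \<equiv> cox_length W S"

lemma S_carrier [simp, intro]: "s \<in> S \<Longrightarrow> s \<in> carrier W"
  using S_subset by blast

lemma S_square [simp]: "s \<in> S \<Longrightarrow> s \<otimes> s = \<one>"
  using S_involutions by blast

lemma S_inv [simp]: "s \<in> S \<Longrightarrow> inv s = s"
  by (simp add: inv_equality)

lemma S_cancel_right [simp]: "\<lbrakk>x \<in> carrier W; s \<in> S\<rbrakk> \<Longrightarrow> x \<otimes> s \<otimes> s = x"
  by (simp add: m_assoc)

lemma S_cancel_left [simp]: "\<lbrakk>x \<in> carrier W; s \<in> S\<rbrakk> \<Longrightarrow> s \<otimes> (s \<otimes> x) = x"
  by (simp flip: m_assoc)

lemma mult_S_eq_iff: "\<lbrakk>x \<in> carrier W; y \<in> carrier W; s \<in> S\<rbrakk> \<Longrightarrow> x \<otimes> s = y \<longleftrightarrow> x = y \<otimes> s"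
  by auto

lemma word_prod_Nil [simp]: "word_prod W [] = \<one>"
  by (simp add: word_prod_def)

lemma word_prod_Cons [simp]: "word_prod W (s # ss) = s \<otimes> word_prod W ss"
  by (simp add: word_prod_def)

lemma word_prod_closed [simp, intro]: "set ss \<subseteq> S \<Longrightarrow> word_prod W ss \<in> carrier W"
  by (induction ss) auto

lemma word_prod_append [simp]:
  "\<lbrakk>set xs \<subseteq> S; set ys \<subseteq> S\<rbrakk> \<Longrightarrow> word_prod W (xs @ ys) = word_prod W xs \<otimes> word_prod W ys"
  by (induction xs) (auto simp: m_assoc)

lemma word_prod_rev: "set ss \<subseteq> S \<Longrightarrow> word_prod W (rev ss) = inv (word_prod W ss)"
  by (induction ss) (auto simp: inv_mult_group)

lemma ex_word:
  assumes "w \<in> carrier W" obtains ss where "set ss \<subseteq> S" "word_prod W ss = w"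
proof -
  have "w \<in> generate W S" using assms S_generates by simp
  then have "\<exists>ss. set ss \<subseteq> S \<and> word_prod W ss = w"
  proof induction
    case one then show ?case by (intro exI[of _ "[]"]) auto
  next
    case (incl h) then show ?case by (intro exI[of _ "[h]"]) auto
  next
    case (inv h) then show ?case by (intro exI[of _ "[h]"]) auto
  next
    case (eng h1 h2)
    then obtain a b where "set a \<subseteq> S" "word_prod W a = h1" "set b \<subseteq> S" "word_prod W b = h2" by blast
    then show ?case by (intro exI[of _ "a @ b"]) auto
  qed
  then show ?thesis by (elim exE conjE) (rule that)
qed

lemma len_le_length: "set ss \<subseteq> S \<Longrightarrow> len (word_prod W ss) \<le> length ss"
  unfolding cox_length_def by (rule Least_le) blast

lemma ex_reduced_word:
  assumes "w \<in> carrier W"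
  obtains ss where "set ss \<subseteq> S" "word_prod W ss = w" "length ss = len w"
proof -
  obtain ss where ss: "set ss \<subseteq> S" "word_prod W ss = w"
    using ex_word[OF assms] .
  have "\<exists>ss. set ss \<subseteq> S \<and> length ss = len w \<and> word_prod W ss = w"
    unfolding cox_length_def 
    by (rule LeastI[where P = "\<lambda>n. \<exists>ss. set ss \<subseteq> S \<and> length ss = n \<and> word_prod W ss = w"])
      (use ss in auto)
  then show ?thesis by (elim exE conjE) (rule that)
qed

lemma len_one [simp]: "len \<one> = 0"
  using len_le_length[of "[]"] by simp

lemma len_eq_0_iff: 
  assumes "w \<in> carrier W" shows "len w = 0 \<longleftrightarrow> w = \<one>"
proof
  assume "len w = 0"
  moreover obtain a where "word_prod W a = w" "length a = len w"
    using ex_reduced_word[OF assms] .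
  ultimately show "w = \<one>" by auto
qed simp

lemma len_mult_le: 
  assumes "x \<in> carrier W" "y \<in> carrier W"
  shows "len (x \<otimes> y) \<le> len x + len y"
proof -
  obtain a where "set a \<subseteq> S" "word_prod W a = x" "length a = len x"
    using ex_reduced_word[OF assms(1)] .
  moreover obtain b where "set b \<subseteq> S" "word_prod W b = y" "length b = len y"
    using ex_reduced_word[OF assms(2)] .
  ultimately show ?thesis using len_le_length[of "a @ b"] by simp
qed

lemma len_S: "s \<in> S \<Longrightarrow> len s = 1"
  using len_le_length[of "[s]"] len_eq_0_iff[of s] S_involutions[of s] by (simp add: le_Suc_eq)

lemma len_inv [simp]: 
  assumes "x \<in> carrier W" shows "len (inv x) = len x"
proof -
  have le: "len (inv y) \<le> len y" if y: "y \<in> carrier W" for y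
  proof -
    obtain a where "set a \<subseteq> S" "word_prod W a = y" "length a = len y"
      using ex_reduced_word[OF y] .
    then show ?thesis using len_le_length[of "rev a"] word_prod_rev[of a] by simp
  qed
  from le[of x] le[of "inv x"] assms show ?thesis by simp
qed

text \<open>The way the presentation is exploited: a function of words that no relator changes is a
  function of the group element. It is applied to the parity of the length and to the action on
  vectors.\<close>

lemma equivclp_coxeter_step_invariant:
  assumes "equivclp (coxeter_step W S) xs ys" 
    and "\<And>xs ys. coxeter_step W S xs ys \<Longrightarrow> f xs = f ys"
  shows "f xs = f ys"
  using assms(1)
proof (induction rule: equivclp_induct)
  case base then show ?case by simp
next
  case (step y z) then show ?case using assms(2)[of y z] assms(2)[of z y] by metis
qed

text \<open>Relators have even length \<open>2 m(s,t)\<close>; the invariant is the sign character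
  of \<open>W\<close>.\<close>

lemma word_prod_parity:
  assumes "set xs \<subseteq> S" "set ys \<subseteq> S" "word_prod W xs = word_prod W ys"
  shows "even (length xs) \<longleftrightarrow> even (length ys)"
proof (rule equivclp_coxeter_step_invariant[OF presentation[OF assms]])
  fix xs ys assume "coxeter_step W S xs ys"
  then show "even (length xs) \<longleftrightarrow> even (length ys)"
    by cases (simp add: length_concat sum_list_replicate)
qed

text \<open>The triangle inequality allows a change by at most one, and parity excludes no
  change.\<close>

lemma len_mult_S_cases:
  assumes "x \<in> carrier W" "s \<in> S"
  obtains "len (x \<otimes> s) = Suc (len x)" | "len x = Suc (len (x \<otimes> s))"
proof -
  obtain a where a: "set a \<subseteq> S" "word_prod W a = x" "length a = len x"
    using ex_reduced_word[OF assms(1)] .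
  obtain b where b: "set b \<subseteq> S" "word_prod W b = x \<otimes> s" "length b = len (x \<otimes> s)"
    using ex_reduced_word[of "x \<otimes> s"] assms by auto
  have "even (length (a @ [s])) \<longleftrightarrow> even (length b)"
    using a b assms by (intro word_prod_parity) auto
  then have "len x \<noteq> len (x \<otimes> s)" using a b by auto
  moreover have "len (x \<otimes> s) \<le> len x + 1" using len_mult_le[of x s] len_S assms by simp
  moreover have "len x \<le> len (x \<otimes> s) + 1"
    using len_mult_le[of "x \<otimes> s" s] len_S[of s] assms by simp
  ultimately show ?thesis using that by linarith
qed

lemma ex_right_descent:
  assumes "w \<in> carrier W" "w \<noteq> \<one>"
  obtains s where "s \<in> S" "len w = Suc (len (w \<otimes> s))"
proof -
  obtain a where a: "set a \<subseteq> S" "word_prod W a = w" "length a = len w"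
    using ex_reduced_word[OF assms(1)] .
  with assms obtain b s where [simp]: "a = b @ [s]" by (cases a rule: rev_cases) auto
  have s: "s \<in> S" and b: "set b \<subseteq> S" using a by auto
  have "w \<otimes> s = word_prod W b" using a(2) b s by auto
  then have "len (w \<otimes> s) \<le> length b" using len_le_length[OF b] by simp
  then have "len w = Suc (len (w \<otimes> s))"
    using a(3) by (cases rule: len_mult_S_cases[OF assms(1) s]) auto
  with that s show ?thesis by blast
qed

lemma len_S_neq: "\<lbrakk>x \<in> carrier W; s \<in> S\<rbrakk> \<Longrightarrow> len (x \<otimes> s) \<noteq> len x"
  by (cases rule: len_mult_S_cases[of x s]) auto

end

section \<open>The geometric representation\<close>

type_synonym 'i vec = "'i \<Rightarrow>\<^sub>0 real"

definition smul :: "real \<Rightarrow> 'i vec \<Rightarrow> 'i vec" (infixr "\<cdot>" 75) where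
  "c \<cdot> x = Poly_Mapping.map ((*) c) x"

definition lin :: "('i \<Rightarrow> real) \<Rightarrow> 'i vec \<Rightarrow> real" where
  "lin f x = (\<Sum>i\<in>Poly_Mapping.keys x. f i * Poly_Mapping.lookup x i)"

lemma lookup_smul [simp]: "Poly_Mapping.lookup (c \<cdot> x) i = c * Poly_Mapping.lookup x i"
  by (simp add: smul_def Poly_Mapping.map.rep_eq when_def)

lemma smul_simps [simp]: "0 \<cdot> x = 0" "1 \<cdot> x = x" "c \<cdot> (0 :: 'i vec) = 0" "(-1) \<cdot> x = - x"
  by (auto intro!: poly_mapping_eqI)

lemma smul_smul [simp]: "a \<cdot> b \<cdot> x = (a * b) \<cdot> x"
  by (auto intro!: poly_mapping_eqI)

lemma smul_add_left: "(a + b) \<cdot> x = a \<cdot> x + b \<cdot> x"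
  by (auto intro!: poly_mapping_eqI simp: lookup_add algebra_simps)

lemma smul_diff_left: "(a - b) \<cdot> x = a \<cdot> x - b \<cdot> x"
  by (rule poly_mapping_eqI) (simp add: lookup_minus left_diff_distrib)

lemma smul_diff_right: "a \<cdot> (x - y) = a \<cdot> x - a \<cdot> y"
  by (rule poly_mapping_eqI) (simp add: lookup_minus right_diff_distrib)

lemma smul_minus_left [simp]: "(- a) \<cdot> x = - (a \<cdot> x)"
  by (auto intro!: poly_mapping_eqI)

lemma smul_minus_right [simp]: "a \<cdot> (- x) = - (a \<cdot> x)"
  by (auto intro!: poly_mapping_eqI)

lemma lin_superset:
  "\<lbrakk>finite A; Poly_Mapping.keys x \<subseteq> A\<rbrakk> \<Longrightarrow> lin f x = (\<Sum>i\<in>A. f i * Poly_Mapping.lookup x i)"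
  unfolding lin_def by (rule sum.mono_neutral_left) (auto simp: in_keys_iff)

lemma lin_add [simp]: "lin f (x + y) = lin f x + lin f y"
proof -
  have "Poly_Mapping.keys (x + y) \<subseteq> Poly_Mapping.keys x \<union> Poly_Mapping.keys y" by (rule keys_add)
  then show ?thesis
    by (simp add: lin_superset[of "Poly_Mapping.keys x \<union> Poly_Mapping.keys y"] lookup_add algebra_simps sum.distrib)
qed

lemma lin_smul [simp]: "lin f (c \<cdot> x) = c * lin f x"
proof -
  have "Poly_Mapping.keys (c \<cdot> x) \<subseteq> Poly_Mapping.keys x" by (auto simp: in_keys_iff)
  then show ?thesis
    by (simp add: lin_superset[of "Poly_Mapping.keys x"] sum_distrib_left algebra_simps)
qed

lemma lin_uminus [simp]: "lin f (- x) = - lin f x"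
  using lin_smul[of f "-1" x] by (simp del: lin_smul)

lemma lin_diff [simp]: "lin f (x - y) = lin f x - lin f y"
  using lin_add[of f x "- y"] by (simp del: lin_add)

lemma lin_zero [simp]: "lin f 0 = 0"
  by (simp add: lin_def)

lemma lin_single [simp]: "lin f (Poly_Mapping.single i c) = f i * c"
  by (simp add: lin_def)

definition nonneg :: "'i vec \<Rightarrow> bool" where
  "nonneg x \<longleftrightarrow> (\<forall>i. 0 \<le> Poly_Mapping.lookup x i)"

lemma nonneg_add: "\<lbrakk>nonneg x; nonneg y\<rbrakk> \<Longrightarrow> nonneg (x + y)"
  by (simp add: nonneg_def lookup_add)

lemma nonneg_smul: "\<lbrakk>nonneg x; 0 \<le> c\<rbrakk> \<Longrightarrow> nonneg (c \<cdot> x)"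
  by (simp add: nonneg_def)

lemma nonneg_antisym:
  assumes "nonneg x" "nonneg (- x)" shows "x = 0"
proof (rule poly_mapping_eqI)
  fix k from assms show "Poly_Mapping.lookup x k = Poly_Mapping.lookup 0 k"
    unfolding nonneg_def by (metis lookup_uminus lookup_zero neg_0_le_iff_le order_antisym)
qed

text \<open>The Chebyshev polynomial of the second kind of degree \<open>n - 1\<close>. It supplies
  the coordinates of roots in the plane of two simple roots; \<open>c = 1\<close> is the case of an
  infinite matrix entry.\<close>

fun cheb :: "real \<Rightarrow> nat \<Rightarrow> real" where
  "cheb c 0 = 0"
| "cheb c (Suc 0) = 1"
| "cheb c (Suc (Suc n)) = 2 * c * cheb c (Suc n) - cheb c n"

lemma cheb_cos: "cheb (cos \<theta>) n * sin \<theta> = sin (real n * \<theta>)"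
proof (induction "cos \<theta>" n rule: cheb.induct)
  case (3 n)
  have "sin (\<theta> + real (Suc n) * \<theta>) - sin (\<theta> - real (Suc n) * \<theta>) = 2 * cos \<theta> * sin (real (Suc n) * \<theta>)"
    by (simp only: sin_add sin_diff)
  moreover have "\<theta> + real (Suc n) * \<theta> = real (Suc (Suc n)) * \<theta>" "\<theta> - real (Suc n) * \<theta> = - (real n * \<theta>)"
    by (simp_all add: algebra_simps)
  ultimately have "sin (real (Suc (Suc n)) * \<theta>) + sin (real n * \<theta>) = 2 * cos \<theta> * sin (real (Suc n) * \<theta>)"
    by simp
  with 3 show ?case by (simp add: algebra_simps)
qed auto

lemma cheb_one: "cheb 1 n = real n"
  by (induction "1::real" n rule: cheb.induct) auto

text \<open>The alternating word of length \<open>k\<close> ending in \<open>t\<close>. Letters are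
  prepended because the rightmost letter acts before the others.\<close>

fun alt_word :: "'a \<Rightarrow> 'a \<Rightarrow> nat \<Rightarrow> 'a list" where
  "alt_word s t 0 = []"
| "alt_word s t (Suc k) = (if even k then t else s) # alt_word s t k"

lemma length_alt_word [simp]: "length (alt_word s t k) = k"
  by (induction k) auto

lemma set_alt_word: "set (alt_word s t k) \<subseteq> {s, t}"
  by (induction k) auto

lemma alt_word_snoc: "alt_word s t k @ [s] = alt_word t s (Suc k)"
  by (induction k) auto

lemma drop_alt_word: "drop j (alt_word s t k) = alt_word s t (k - j)"
proof (induction k arbitrary: j)
  case (Suc k) then show ?case by (cases j) auto
qed auto

lemma concat_replicate_alt: "concat (replicate m [s, t]) = alt_word s t (2 * m)"
  by (induction m) auto

lemma rev_concat_replicate: "rev (concat (replicate m [s, t])) = concat (replicate m [t, s])"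
proof (induction m)
  case (Suc m)
  have "concat (replicate m [t, s]) @ [t, s] = [t, s] @ concat (replicate m [t, s])" for m
    by (induction m) auto
  with Suc show ?case by simp
qed simp

section \<open>The invariant form and the action of the group\<close>

context coxeter_system
begin

text \<open>Besides the simple roots, the geometric representation contains a vector \<open>\<rho>\<close> (the
  coordinate \<^const>\<open>None\<close>) pairing to \<open>1\<close> with every simple coroot; such a vector need not exist in
  the span of the simple roots. The form is twice the usual one.\<close>

definition gram :: "'a option \<Rightarrow> 'a option \<Rightarrow> real" where
  "gram i j = (case (i, j) of
      (Some s, Some t) \<Rightarrow> 
         if s = t then 2
         else if s \<in> S \<and> t \<in> S 
         then (if coxeter_matrix W s t = 0 then - 2 else - 2 * cos (pi / coxeter_matrix W s t))
         else 0
    | (None, None) \<Rightarrow> 0 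
    | _ \<Rightarrow> 1)"

definition form :: "'a option vec \<Rightarrow> 'a option vec \<Rightarrow> real" where
  "form x y = lin (\<lambda>i. lin (gram i) y) x"

definition simple_root :: "'a \<Rightarrow> 'a option vec" where
  "simple_root s = Poly_Mapping.single (Some s) 1"

definition rho :: "'a option vec" where
  "rho = Poly_Mapping.single None 1"

definition reflect :: "'a option vec \<Rightarrow> 'a option vec \<Rightarrow> 'a option vec" where
  "reflect b x = x - form x b \<cdot> b"

definition word_act :: "'a list \<Rightarrow> 'a option vec \<Rightarrow> 'a option vec" where
  "word_act = foldr (\<lambda>s. reflect (simple_root s))"

text \<open>The chosen word is immaterial by \<open>word_act_cong\<close>.\<close>

definition act :: "'a \<Rightarrow> 'a option vec \<Rightarrow> 'a option vec" where
  "act w = word_act (SOME ss. set ss \<subseteq> S \<and> word_prod W ss = w)"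

lemma coxeter_matrix_commute:
  assumes "s \<in> S" "t \<in> S" shows "coxeter_matrix W s t = coxeter_matrix W t s"
proof -
  have "t \<otimes> s = inv (s \<otimes> t)" using assms by (simp add: inv_mult_group)
  then show ?thesis using assms unfolding coxeter_matrix_def by simp
qed

lemma gram_commute: "gram i j = gram j i"
  unfolding gram_def by (auto split: option.splits simp: coxeter_matrix_commute)

lemma form_linear [simp]:
  "form (x + x') y = form x y + form x' y" "form (x - x') y = form x y - form x' y"
  "form (- x) y = - form x y" "form (c \<cdot> x) y = c * form x y" "form 0 y = 0"
  by (simp_all add: form_def)

lemma form_commute: "form x y = form y x"
proof -
  have "(\<Sum>i\<in>Poly_Mapping.keys x. (\<Sum>j\<in>Poly_Mapping.keys y. gram i j * Poly_Mapping.lookup y j) * Poly_Mapping.lookup x i)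
      = (\<Sum>i\<in>Poly_Mapping.keys x. \<Sum>j\<in>Poly_Mapping.keys y. gram j i * Poly_Mapping.lookup x i * Poly_Mapping.lookup y j)"
    unfolding sum_distrib_right by (simp add: gram_commute mult_ac)
  also have "\<dots> = (\<Sum>j\<in>Poly_Mapping.keys y. (\<Sum>i\<in>Poly_Mapping.keys x. gram j i * Poly_Mapping.lookup x i) * Poly_Mapping.lookup y j)"
    unfolding sum_distrib_right by (rule sum.swap)
  finally show ?thesis unfolding form_def lin_def .
qed

lemma form_linear_right [simp]:
  "form y (x + x') = form y x + form y x'" "form y (x - x') = form y x - form y x'"
  "form y (- x) = - form y x" "form y (c \<cdot> x) = c * form y x" "form y 0 = 0"
  by (simp_all add: form_commute[of y])

lemma form_simple_root: "form (simple_root s) (simple_root t) = gram (Some s) (Some t)"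
  by (simp add: form_def simple_root_def)

lemma form_simple_root_self [simp]: "form (simple_root s) (simple_root s) = 2"
  by (simp add: form_simple_root gram_def)

lemma reflect_linear [simp]:
  "reflect b (x + y) = reflect b x + reflect b y" "reflect b (x - y) = reflect b x - reflect b y"
  "reflect b (- x) = - reflect b x" "reflect b (c \<cdot> x) = c \<cdot> reflect b x" "reflect b 0 = 0"
  by (auto simp: reflect_def smul_add_left smul_diff_left smul_diff_right)

lemma reflect_reflect: "form b b = 2 \<Longrightarrow> reflect b (reflect b x) = x"
  by (simp add: reflect_def)

lemma reflect_self: "form b b = 2 \<Longrightarrow> reflect b b = - b"
  by (rule poly_mapping_eqI) (simp add: reflect_def lookup_minus)

lemma form_reflect: "form b b = 2 \<Longrightarrow> form (reflect b x) (reflect b y) = form x y"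
  by (simp add: reflect_def form_commute algebra_simps)

lemma word_act_simps [simp]:
  "word_act [] x = x" "word_act (s # ss) x = reflect (simple_root s) (word_act ss x)"
  by (simp_all add: word_act_def)

lemma word_act_append: "word_act (xs @ ys) x = word_act xs (word_act ys x)"
  by (induction xs) auto

lemma word_act_linear [simp]:
  "word_act ss (x + y) = word_act ss x + word_act ss y" 
  "word_act ss (x - y) = word_act ss x - word_act ss y"
  "word_act ss (- x) = - word_act ss x" "word_act ss (c \<cdot> x) = c \<cdot> word_act ss x" 
  "word_act ss 0 = 0"
  by (induction ss) auto

lemma word_act_rev: "word_act ss (word_act (rev ss) x) = x"
  by (induction ss arbitrary: x) (auto simp: word_act_append reflect_reflect)

lemma form_word_act [simp]: "form (word_act ss x) (word_act ss y) = form x y"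
  by (induction ss) (auto simp: form_reflect)

text \<open>Each further letter changes only one of the two coordinates, and the change is the
  three-term recursion of \<open>cheb\<close>.\<close>

lemma word_act_alt:
  assumes "gram (Some s) (Some t) = - 2 * c"
  shows "word_act (alt_word s t k) (simple_root s) =
    (if even k then cheb c (Suc k) \<cdot> simple_root s + cheb c k \<cdot> simple_root t
     else cheb c k \<cdot> simple_root s + cheb c (Suc k) \<cdot> simple_root t)"
proof (induction k)
  case (Suc k)
  have "form (simple_root s) (simple_root t) = - 2 * c" "form (simple_root t) (simple_root s) = - 2 * c"
    using assms form_commute by (simp_all add: form_simple_root gram_commute)
  with Suc show ?case
    by (auto simp: reflect_def intro!: poly_mapping_eqI) (auto simp: lookup_add lookup_minus algebra_simps)
qed simp

lemma coxeter_matrix_ge_2: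
  assumes "s \<in> S" "t \<in> S" "s \<noteq> t" "coxeter_matrix W s t \<noteq> 0"
  shows "2 \<le> coxeter_matrix W s t"
proof -
  have "coxeter_matrix W s t \<noteq> 1"
  proof
    assume "coxeter_matrix W s t = 1"
    then have "s \<otimes> t = \<one>" using assms ord_eq_1[of "s \<otimes> t"] unfolding coxeter_matrix_def by simp
    then have "s \<otimes> t \<otimes> t = t" using assms by simp
    with assms show False by simp
  qed
  with assms show ?thesis by linarith
qed

text \<open>For finite \<open>m\<close> and distinct letters, \<open>s t\<close> rotates the plane
  of the two simple roots by \<open>2 pi / m\<close>, so its \<open>m\<close>-th power fixes this
  plane. It also fixes the orthogonal complement, which together with the plane spans everything
  because the form is nondegenerate on the plane.\<close>

lemma word_act_relation:
  assumes s: "s \<in> S" and t: "t \<in> S"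
  shows "word_act (concat (replicate (coxeter_matrix W s t) [s, t])) x = x"
proof -
  define m where "m = coxeter_matrix W s t"
  define P where "P = word_act (concat (replicate m [s, t]))"
  consider "m = 0" | "s = t" "m \<noteq> 0" | "s \<noteq> t" "m \<noteq> 0" by blast
  then have "P x = x"
  proof cases
    case 1 then show ?thesis by (simp add: P_def)
  next
    case 2
    have "m = 1" using 2 s by (simp add: m_def coxeter_matrix_def ord_eq_1)
    then show ?thesis using 2 by (simp add: P_def reflect_reflect)
  next
    case 3
    define \<theta> where "\<theta> = pi / m"
    have m: "2 \<le> m" using coxeter_matrix_ge_2 s t 3 by (simp add: m_def)
    have g: "gram (Some s) (Some t) = - 2 * cos \<theta>" "gram (Some t) (Some s) = - 2 * cos \<theta>"
      using 3 s t unfolding gram_def \<theta>_def m_def by (auto simp: coxeter_matrix_commute)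
    have "0 < \<theta>" "\<theta> < pi" using m by (auto simp: \<theta>_def field_simps)
    then have sn: "0 < sin \<theta>" by (rule sin_gt_zero)
    have m\<theta>: "real m * \<theta> = pi" using m by (simp add: \<theta>_def)
    have "cheb (cos \<theta>) (2 * m) * sin \<theta> = 0" 
      unfolding cheb_cos using m\<theta> by (simp add: mult.assoc)
    then have c0: "cheb (cos \<theta>) (2 * m) = 0" using sn by simp
    have "cheb (cos \<theta>) (Suc (2 * m)) * sin \<theta> = sin (\<theta> + 2 * pi)"
      unfolding cheb_cos by (rule arg_cong[where f = sin]) (use m\<theta> in \<open>simp add: algebra_simps\<close>)
    then have c1: "cheb (cos \<theta>) (Suc (2 * m)) = 1" using sn by simp
    have "P (simple_root s) = simple_root s"
      unfolding P_def concat_replicate_alt word_act_alt[OF g(1)] by (simp del: cheb.simps add: c0 c1)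
    moreover have "word_act (concat (replicate m [t, s])) (simple_root t) = simple_root t"
      unfolding concat_replicate_alt word_act_alt[OF g(2)] by (simp del: cheb.simps add: c0 c1)
    \<comment> \<open>The reversed relator acts as the inverse of \<open>P\<close>, so both have the
      same fixed vectors.\<close>
    then have "P (simple_root t) = simple_root t"
      using word_act_rev[of "concat (replicate m [s, t])" "simple_root t"]
      by (simp add: P_def rev_concat_replicate)
    moreover 
    define p q where "p = form x (simple_root s)" and "q = form x (simple_root t)"
    \<comment> \<open>The solution of the Gram system of the two simple roots, whose determinant is
      a multiple of \<open>sin \<theta> ^ 2\<close>; it makes \<open>y\<close> orthogonal to
      both.\<close>
    define u v where "u = (p + cos \<theta> * q) / (2 * sin \<theta> ^ 2)" and "v = (q + cos \<theta> * p) / (2 * sin \<theta> ^ 2)"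
    define y where "y = x - u \<cdot> simple_root s - v \<cdot> simple_root t"
    have uv: "2 * u - 2 * cos \<theta> * v = p" "2 * v - 2 * cos \<theta> * u = q"
    proof -
      have uv: "2 * sin \<theta> ^ 2 * u = p + cos \<theta> * q" "2 * sin \<theta> ^ 2 * v = q + cos \<theta> * p"
        using sn by (simp_all add: u_def v_def)
      have "2 * sin \<theta> ^ 2 * (2 * u - 2 * cos \<theta> * v) = 2 * (2 * sin \<theta> ^ 2 * u) - 2 * cos \<theta> * (2 * sin \<theta> ^ 2 * v)"
           "2 * sin \<theta> ^ 2 * (2 * v - 2 * cos \<theta> * u) = 2 * (2 * sin \<theta> ^ 2 * v) - 2 * cos \<theta> * (2 * sin \<theta> ^ 2 * u)"
        by (simp_all add: algebra_simps)
      then have "2 * sin \<theta> ^ 2 * (2 * u - 2 * cos \<theta> * v) = 2 * sin \<theta> ^ 2 * p"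
         "2 * sin \<theta> ^ 2 * (2 * v - 2 * cos \<theta> * u) = 2 * sin \<theta> ^ 2 * q"
        unfolding uv unfolding sin_squared_eq by (simp_all add: algebra_simps power2_eq_square)
      then show "2 * u - 2 * cos \<theta> * v = p" "2 * v - 2 * cos \<theta> * u = q" using sn by auto
    qed
    have "form y (simple_root s) = 0" "form y (simple_root t) = 0"
      using uv by (simp_all add: y_def form_simple_root g flip: p_def q_def) (simp_all add: gram_def algebra_simps)
    then have y: "word_act ss y = y" if "set ss \<subseteq> {s, t}" for ss
      using that by (induction ss) (auto simp: reflect_def)
    have "P y = y" unfolding P_def by (rule y) (simp add: concat_replicate_alt set_alt_word)
    moreover have "x = y + u \<cdot> simple_root s + v \<cdot> simple_root t"
      by (simp add: y_def)
    moreover have "P (a + b) = P a + P b" "P (c \<cdot> a) = c \<cdot> P a" for a b c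
      by (simp_all add: P_def)
    ultimately show ?thesis by metis
  qed
  then show ?thesis by (simp add: P_def m_def)
qed

text \<open>Relators act trivially, so by the presentation the action of words descends to
  \<open>W\<close>.\<close>

lemma word_act_cong:
  assumes "set xs \<subseteq> S" "set ys \<subseteq> S" "word_prod W xs = word_prod W ys"
  shows "word_act xs = word_act ys"
proof (rule equivclp_coxeter_step_invariant[OF presentation[OF assms]])
  fix xs ys assume "coxeter_step W S xs ys"
  then show "word_act xs = word_act ys"
    by cases (auto simp: word_act_append word_act_relation fun_eq_iff)
qed

lemma act_word_prod:
  assumes "set ss \<subseteq> S" shows "act (word_prod W ss) = word_act ss"
proof -
  have "\<exists>xs. set xs \<subseteq> S \<and> word_prod W xs = word_prod W ss" using assms by blast
  then have "set (SOME xs. set xs \<subseteq> S \<and> word_prod W xs = word_prod W ss) \<subseteq> S \<and>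
    word_prod W (SOME xs. set xs \<subseteq> S \<and> word_prod W xs = word_prod W ss) = word_prod W ss"
    by (rule someI_ex)
  then show ?thesis unfolding act_def by (intro word_act_cong assms) auto
qed

lemma act_one [simp]: "act \<one> x = x"
  using act_word_prod[of "[]"] by simp

lemma act_S: "s \<in> S \<Longrightarrow> act s = reflect (simple_root s)"
  using act_word_prod[of "[s]"] by auto

lemma act_mult:
  assumes "x \<in> carrier W" "y \<in> carrier W" shows "act (x \<otimes> y) v = act x (act y v)"
proof -
  obtain a where a: "set a \<subseteq> S" "word_prod W a = x" using ex_word[OF assms(1)] .
  obtain b where b: "set b \<subseteq> S" "word_prod W b = y" using ex_word[OF assms(2)] .
  have "act (word_prod W (a @ b)) = word_act (a @ b)" using a b by (intro act_word_prod) auto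
  with a b show ?thesis using act_word_prod[of a] act_word_prod[of b] by (auto simp: word_act_append)
qed

lemma act_linear [simp]:
  "act w (x + y) = act w x + act w y" "act w (x - y) = act w x - act w y"
  "act w (- x) = - act w x" "act w (c \<cdot> x) = c \<cdot> act w x" "act w 0 = 0"
  by (simp_all add: act_def)

lemma form_act [simp]: "form (act w x) (act w y) = form x y"
  by (simp add: act_def)

lemma act_inv [simp]: 
  "w \<in> carrier W \<Longrightarrow> act w (act (inv w) x) = x" "w \<in> carrier W \<Longrightarrow> act (inv w) (act w x) = x"
  by (simp_all flip: act_mult)

text \<open>Simple reflections only subtract multiples of simple roots. Hence roots, as images of
  simple roots, have no \<rho>-coordinate.\<close>

lemma lookup_act_None [simp]: "Poly_Mapping.lookup (act w x) None = Poly_Mapping.lookup x None"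
proof -
  have "Poly_Mapping.lookup (word_act ss x) None = Poly_Mapping.lookup x None" for ss
    by (induction ss) (auto simp: reflect_def lookup_minus simple_root_def lookup_single)
  then show ?thesis by (simp add: act_def)
qed

lemma act_conj:
  assumes "w \<in> carrier W" "t \<in> carrier W" "act t = reflect b"
  shows "act (w \<otimes> t \<otimes> inv w) = reflect (act w b)"
proof
  fix x
  have "form (act (inv w) x) b = form x (act w b)"
    using form_act[of w "act (inv w) x" b] assms by simp
  then show "act (w \<otimes> t \<otimes> inv w) x = reflect (act w b) x"
    using assms by (simp add: act_mult reflect_def)
qed

section \<open>Roots and the exchange condition\<close>

lemma reduced_suffix:
  assumes "set (xs @ ys) \<subseteq> S" "len (word_prod W (xs @ ys)) = length (xs @ ys)"
  shows "len (word_prod W ys) = length ys"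
proof -
  have "len (word_prod W (xs @ ys)) \<le> len (word_prod W xs) + len (word_prod W ys)"
    using assms(1) len_mult_le[of "word_prod W xs" "word_prod W ys"] by auto
  with assms len_le_length[of xs] len_le_length[of ys] show ?thesis by auto
qed

lemma not_reduced_square:
  assumes "s \<in> S" "set ys \<subseteq> S" 
  shows "len (word_prod W (s # s # ys)) \<noteq> length (s # s # ys)"
  using len_le_length[of ys] assms by auto

text \<open>Equal neighbours cancel, so a reduced word over two letters alternates and is determined
  by its length and last letter.\<close>

lemma reduced_dihedral_word:
  assumes "s \<in> S" "t \<in> S" "set ss \<subseteq> {s, t}" "len (word_prod W (ss @ [s])) = length (ss @ [s])"
  shows "ss = alt_word s t (length ss)"
  using assms(3-4)
proof (induction ss)
  case (Cons a ss)
  have S: "set (ss @ [s]) \<subseteq> S" "a \<in> S" using Cons.prems(1) assms(1,2) by auto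
  then have "len (word_prod W (ss @ [s])) = length (ss @ [s])"
    using reduced_suffix[of "[a]" "ss @ [s]"] Cons.prems by simp
  then have ss: "ss = alt_word s t (length ss)" using Cons by auto
  have hd: "ss @ [s] = (if even (length ss) then s else t) # tl (ss @ [s])"
    by (subst ss, subst (2) ss) (cases "length ss"; auto)
  have "a \<noteq> (if even (length ss) then s else t)"
  proof
    assume a: "a = (if even (length ss) then s else t)"
    have "set (tl (ss @ [s])) \<subseteq> S" using S(1) by (cases ss) auto
    with not_reduced_square[OF S(2) this] show False
      using hd Cons.prems(2) unfolding a[symmetric] by simp
  qed
  then have "a = (if even (length ss) then t else s)" using Cons.prems(1) by auto
  with ss show ?case by simp
qed simp

text \<open>In the relator of length \<open>2 m\<close>, a suffix of length \<open>m + 1\<close> is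
  inverse to the remaining prefix of length \<open>m - 1\<close>, so it cannot be reduced.\<close>

lemma reduced_alt_word_length:
  assumes s: "s \<in> S" and t: "t \<in> S" and m: "coxeter_matrix W s t \<noteq> 0"
    and red: "len (word_prod W (alt_word t s k)) = k"
  shows "k \<le> coxeter_matrix W s t"
proof (rule ccontr)
  define m where "m = coxeter_matrix W s t"
  assume "\<not> k \<le> coxeter_matrix W s t"
  then have k: "m < k" by (simp add: m_def)
  have S: "set (alt_word t s j) \<subseteq> S" for j using set_alt_word[of t s j] s t by auto
  have "alt_word t s k = take (k - Suc m) (alt_word t s k) @ alt_word t s (Suc m)"
    using k drop_alt_word[of "k - Suc m" t s k] append_take_drop_id[of "k - Suc m" "alt_word t s k"] by simp
  then have red': "len (word_prod W (alt_word t s (Suc m))) = Suc m"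
    using reduced_suffix[of "take (k - Suc m) (alt_word t s k)" "alt_word t s (Suc m)"] red S 
    by simp
  have m0: "m > 0" using m m_def by simp
  define X where "X = take (m - 1) (alt_word t s (2 * m))"
  have X: "set X \<subseteq> S" "length X = m - 1" 
    using S[of "2 * m"] unfolding X_def by (auto dest: in_set_takeD)
  have eq: "alt_word t s (2 * m) = X @ alt_word t s (Suc m)"
    using m0 drop_alt_word[of "m - 1" t s "2 * m"] append_take_drop_id[of "m - 1" "alt_word t s (2 * m)"] 
    by (simp add: X_def Suc_diff_le mult_2)
  have "word_prod W (alt_word t s (2 * m)) = (t \<otimes> s) [^] m"
    unfolding concat_replicate_alt[symmetric]
  proof (induction m)
    case (Suc m)
    then show ?case using s t nat_pow_Suc2[of "t \<otimes> s" m] by (simp add: m_assoc)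
  qed simp
  also have "\<dots> = \<one>"
    using pow_ord_eq_1[of "t \<otimes> s"] s t unfolding m_def coxeter_matrix_commute[OF s t]
    by (simp add: coxeter_matrix_def)
  finally have "word_prod W X \<otimes> word_prod W (alt_word t s (Suc m)) = \<one>"
    unfolding eq using X S by (simp del: alt_word.simps)
  then have "word_prod W (alt_word t s (Suc m)) = inv (word_prod W X)"
    using X(1) S by (metis inv_equality inv_inv word_prod_closed)
  then have "len (word_prod W (alt_word t s (Suc m))) \<le> m - 1"
    using len_le_length[OF X(1)] X by simp
  with red' show False by simp
qed

text \<open>With \<theta> = pi / m, the sign is that of \<open>sin (k \<theta>)\<close>, and
  \<open>k \<theta>\<close> stays within [0, pi] as long as \<open>k \<le> m\<close>.\<close>

lemma cheb_nonneg:
  assumes "s \<in> S" "t \<in> S" "s \<noteq> t" "coxeter_matrix W s t \<noteq> 0 \<Longrightarrow> k \<le> coxeter_matrix W s t"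
  shows "0 \<le> cheb (- gram (Some s) (Some t) / 2) k"
proof (cases "coxeter_matrix W s t = 0")
  case True
  then show ?thesis using assms by (simp add: gram_def cheb_one)
next
  case False
  define \<theta> where "\<theta> = pi / coxeter_matrix W s t"
  have m: "2 \<le> coxeter_matrix W s t" using coxeter_matrix_ge_2 assms False by simp
  then have "0 < \<theta>" "\<theta> < pi" by (auto simp: \<theta>_def field_simps)
  then have sn: "0 < sin \<theta>" by (rule sin_gt_zero)
  have "real k * \<theta> \<le> pi" using assms(4)[OF False] m by (simp add: \<theta>_def field_simps)
  then have "0 \<le> cheb (cos \<theta>) k * sin \<theta>"
    unfolding cheb_cos using \<open>0 < \<theta>\<close> by (intro sin_ge_zero) auto
  then show ?thesis using sn assms False by (simp add: gram_def \<theta>_def zero_le_mult_iff)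
qed

text \<open>Peel a maximal suffix over \<open>{s, t}\<close> off \<open>w\<close>; the suffix acts on \<open>\<alpha>\<^sub>s\<close> inside the dihedral
  plane, and the induction hypothesis applies to the remaining prefix.\<close>

lemma root_nonneg:
  assumes "w \<in> carrier W" "s \<in> S" "len w < len (w \<otimes> s)"
  shows "nonneg (act w (simple_root s))"
  using assms
proof (induction "len w" arbitrary: w s rule: less_induct)
  case less
  show ?case
  proof (cases "w = \<one>")
    case True
    then show ?thesis by (simp add: nonneg_def simple_root_def lookup_single when_def)
  next
    case False
    obtain t where t: "t \<in> S" "len w = Suc (len (w \<otimes> t))"
      using ex_right_descent[OF less.prems(1) False] .
    then have "s \<noteq> t" using less.prems by auto
    \<comment> \<open>\<open>Q n\<close>: a suffix of length \<open>n\<close> over the two letters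
      splits off with lengths adding up. Since \<open>t\<close> is a descent, \<open>Q 1\<close>
      holds, which makes the prefix strictly shorter than \<open>w\<close>.\<close>
    define Q where "Q n \<longleftrightarrow> (\<exists>v ss. v \<in> carrier W \<and> set ss \<subseteq> {s, t} \<and> w = v \<otimes> word_prod W ss \<and>
       len w = len v + length ss \<and> length ss = n)" for n
    have "Q 1" unfolding Q_def
      by (rule exI[of _ "w \<otimes> t"], rule exI[of _ "[t]"]) (use t less.prems in auto)
    moreover have bound: "\<forall>n. Q n \<longrightarrow> n \<le> len w" unfolding Q_def by auto
    ultimately obtain n where n: "Q n" "\<forall>k. Q k \<longrightarrow> k \<le> n" 
      using Nat.ex_has_greatest_nat[of Q 1 "len w"] by blast
    then obtain v ss where v: "v \<in> carrier W" and ss: "set ss \<subseteq> {s, t}" 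
      and w: "w = v \<otimes> word_prod W ss" and l: "len w = len v + length ss" and n_eq: "length ss = n"
      unfolding Q_def by blast
    have "n \<ge> 1" using n(2) \<open>Q 1\<close> by blast
    have ssS: "set ss \<subseteq> S" using ss t less.prems by auto
    \<comment> \<open>If \<open>r\<close> were a descent of \<open>v\<close>, it could be moved into
      the suffix, against the maximality of \<open>n\<close>.\<close>
    have v_root: "nonneg (act v (simple_root r))" if r: "r \<in> {s, t}" for r
    proof -
      have rS: "r \<in> S" using r t less.prems by auto
      have "len v < len (v \<otimes> r)"
      proof (rule ccontr)
        assume "\<not> ?thesis"
        then have "len v = Suc (len (v \<otimes> r))" by (cases rule: len_mult_S_cases[OF v rS]) auto
        then have "Q (Suc n)" unfolding Q_def
          by (intro exI[of _ "v \<otimes> r"] exI[of _ "r # ss"])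
            (use v rS ssS r ss l n_eq w in \<open>simp add: m_assoc\<close>)
        with n(2) show False by fastforce
      qed
      moreover have "len v < len w" using l n_eq \<open>n \<ge> 1\<close> by simp
      ultimately show ?thesis using less.hyps v rS by blast
    qed
    have sS: "s \<in> S" by fact
    have "len (w \<otimes> s) = Suc (len w)"
      using less.prems by (cases rule: len_mult_S_cases[of w s]) auto
    moreover have "w \<otimes> s = v \<otimes> word_prod W (ss @ [s])"
      using w v ssS sS by (simp add: m_assoc)
    then have "len (w \<otimes> s) \<le> len v + len (word_prod W (ss @ [s]))"
      using len_mult_le[of v "word_prod W (ss @ [s])"] v ssS sS by simp
    ultimately have red: "len (word_prod W (ss @ [s])) = length (ss @ [s])"
      using l len_le_length[of "ss @ [s]"] ssS sS by simp
    have ss_alt: "ss = alt_word s t n"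
      using reduced_dihedral_word[OF sS t(1) ss red] n_eq by simp
    define c where "c = - gram (Some s) (Some t) / 2"
    have c: "gram (Some s) (Some t) = - 2 * c" by (simp add: c_def)
    \<comment> \<open>The bound is needed for \<open>n + 1\<close> because the coefficients are
      \<open>cheb c n\<close> and \<open>cheb c (Suc n)\<close>; it comes from the word with the
      ascent \<open>s\<close> appended.\<close>
    have "Suc n \<le> coxeter_matrix W s t" if "coxeter_matrix W s t \<noteq> 0"
    proof (rule reduced_alt_word_length[OF sS t(1) that])
      show "len (word_prod W (alt_word t s (Suc n))) = Suc n"
        using red n_eq unfolding ss_alt alt_word_snoc by simp
    qed
    then have nn: "0 \<le> cheb c (Suc n)" "0 \<le> cheb c n"
      unfolding c_def by (intro cheb_nonneg[OF sS t(1) \<open>s \<noteq> t\<close>]; fastforce)+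
    have "act w (simple_root s) = act v (word_act ss (simple_root s))"
      using w v ssS by (simp add: act_mult act_word_prod)
    also have "nonneg \<dots>"
      using word_act_alt[OF c, of n] v_root nn unfolding ss_alt
      by (simp add: nonneg_add nonneg_smul)
    finally show ?thesis .
  qed
qed

lemma root_nonpos:
  assumes "w \<in> carrier W" "s \<in> S" "len (w \<otimes> s) < len w"
  shows "nonneg (- act w (simple_root s))"
proof -
  have "nonneg (act (w \<otimes> s) (simple_root s))" using root_nonneg[of "w \<otimes> s" s] assms by simp
  moreover have "act (w \<otimes> s) (simple_root s) = - act w (simple_root s)"
    using assms by (simp add: act_mult act_S reflect_self)
  ultimately show ?thesis by simp
qed

lemma simple_root_neq_0: "simple_root s \<noteq> 0"
  using form_simple_root_self[of s] by (metis form_linear(5) zero_neq_numeral)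

text \<open>A nontrivial element has a right descent and makes that simple root negative, so it does
  not act trivially.\<close>

lemma act_faithful:
  assumes "w \<in> carrier W" "\<And>x. act w x = x" shows "w = \<one>"
proof (rule ccontr)
  assume "w \<noteq> \<one>"
  with assms(1) obtain s where s: "s \<in> S" "len w = Suc (len (w \<otimes> s))" by (rule ex_right_descent)
  then have "nonneg (- simple_root s)" using root_nonpos[of w s] assms by simp
  moreover have "nonneg (simple_root s)" using root_nonneg[of \<one> s] s by (simp add: len_S)
  ultimately show False using nonneg_antisym simple_root_neq_0 by blast
qed

lemma act_inject:
  assumes "x \<in> carrier W" "y \<in> carrier W" "act x = act y" shows "x = y"
proof -
  have "inv x \<otimes> y = \<one>" by (rule act_faithful) (use assms in \<open>auto simp: act_mult simp flip: assms(3)\<close>)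
  with assms show ?thesis by (metis inv_equality inv_inv inv_closed)
qed

section \<open>Reflections and their positive roots\<close>

abbreviation refls :: "'a set" where "refls \<equiv> reflections W S"

lemma reflsE:
  assumes "t \<in> refls" obtains w s where "w \<in> carrier W" "s \<in> S" "t = w \<otimes> s \<otimes> inv w"
proof -
  from assms obtain w s where "w \<in> carrier W" "s \<in> S" "t = inv w \<otimes> s \<otimes> w"
    unfolding reflections_def by blast
  with that[of "inv w" s] show ?thesis by simp
qed

lemma reflsI: "\<lbrakk>w \<in> carrier W; s \<in> S\<rbrakk> \<Longrightarrow> w \<otimes> s \<otimes> inv w \<in> refls"
  unfolding reflections_def by (rule UN_I[of "inv w"]) auto

lemma refls_closed [simp, intro]: "t \<in> refls \<Longrightarrow> t \<in> carrier W"
  by (erule reflsE) simp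

lemma S_refls [simp, intro]: "s \<in> S \<Longrightarrow> s \<in> refls"
  using reflsI[of \<one> s] by simp

lemma refls_conj: 
  assumes "t \<in> refls" "x \<in> carrier W" shows "x \<otimes> t \<otimes> inv x \<in> refls"
proof -
  obtain w s where w: "w \<in> carrier W" "s \<in> S" "t = w \<otimes> s \<otimes> inv w" using reflsE[OF assms(1)] .
  have "x \<otimes> t \<otimes> inv x = (x \<otimes> w) \<otimes> s \<otimes> inv (x \<otimes> w)"
    using w assms by (simp add: m_assoc inv_mult_group)
  also have "\<dots> \<in> refls" using w assms by (intro reflsI) auto
  finally show ?thesis .
qed

lemma refls_square [simp]: "t \<in> refls \<Longrightarrow> t \<otimes> t = \<one>"
proof (erule reflsE)
  fix w s assume w: "w \<in> carrier W" "s \<in> S" "t = w \<otimes> s \<otimes> inv w"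
  have "w \<otimes> s \<otimes> inv w \<otimes> (w \<otimes> s \<otimes> inv w) = w \<otimes> s \<otimes> (inv w \<otimes> w) \<otimes> s \<otimes> inv w"
    using w(1,2) by (simp only: m_assoc m_closed S_carrier inv_closed)
  then show "t \<otimes> t = \<one>" using w by simp
qed

lemma refls_inv [simp]: "t \<in> refls \<Longrightarrow> inv t = t"
  by (simp add: inv_equality)

text \<open>Positivity, norm and reflection determine the root uniquely, see
  \<open>root_of_eqI\<close>. The last conjunct records that it lies in the orbit of a simple root,
  whence its images under \<open>W\<close> are positive or negative.\<close>

definition root_of :: "'a \<Rightarrow> 'a option vec" where
  "root_of t = (SOME b. nonneg b \<and> form b b = 2 \<and> act t = reflect b \<and> 
      (\<exists>w\<in>carrier W. \<exists>s\<in>S. b = act w (simple_root s)))"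

lemma root_sign:
  assumes "w \<in> carrier W" "s \<in> S" 
  shows "nonneg (act w (simple_root s)) \<or> nonneg (- act w (simple_root s))"
  using assms root_nonneg root_nonpos len_S_neq by (metis linorder_neqE_nat)

lemma root_of:
  assumes "t \<in> refls"
  shows root_of_nonneg: "nonneg (root_of t)" and root_of_norm: "form (root_of t) (root_of t) = 2"
    and act_refls: "act t = reflect (root_of t)"
    and root_ofE: "\<And>P. (\<And>w s. \<lbrakk>w \<in> carrier W; s \<in> S; root_of t = act w (simple_root s)\<rbrakk> \<Longrightarrow> P) \<Longrightarrow> P"
proof -
  obtain w s where w: "w \<in> carrier W" "s \<in> S" "t = w \<otimes> s \<otimes> inv w" using reflsE[OF assms] .
  have "\<exists>b. nonneg b \<and> form b b = 2 \<and> act t = reflect b \<and> (\<exists>w\<in>carrier W. \<exists>s\<in>S. b = act w (simple_root s))"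
  proof (cases "nonneg (act w (simple_root s))")
    case True
    then show ?thesis using w act_conj[of w s "simple_root s"]
      by (intro exI[of _ "act w (simple_root s)"]) (auto simp: act_S)
  next
    case False
    have "reflect (- b) = reflect b" for b by (auto simp: reflect_def)
    then have "act t = reflect (- act w (simple_root s))" using w act_conj[of w s "simple_root s"] by (simp add: act_S)
    \<comment> \<open>Passing from \<open>w\<close> to \<open>w s\<close> reverses the sign without
      leaving the orbit.\<close>
    moreover have "- act w (simple_root s) = act (w \<otimes> s) (simple_root s)"
      using w by (simp add: act_mult act_S reflect_self)
    then have "\<exists>v\<in>carrier W. \<exists>r\<in>S. - act w (simple_root s) = act v (simple_root r)"
      using w by (intro bexI[of _ "w \<otimes> s"] bexI[of _ s]) auto
    moreover have "nonneg (- act w (simple_root s))" using False root_sign[of w s] w by simp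
    ultimately show ?thesis by (intro exI[of _ "- act w (simple_root s)"]) simp
  qed
  from someI_ex[OF this, folded root_of_def]
  have root: "nonneg (root_of t)" "form (root_of t) (root_of t) = 2" "act t = reflect (root_of t)"
    "\<exists>w\<in>carrier W. \<exists>s\<in>S. root_of t = act w (simple_root s)"
    by simp_all
  then show "nonneg (root_of t)" "form (root_of t) (root_of t) = 2" "act t = reflect (root_of t)"
    by simp_all
  fix P
  assume "\<And>w s. \<lbrakk>w \<in> carrier W; s \<in> S; root_of t = act w (simple_root s)\<rbrakk> \<Longrightarrow> P"
  with root(4) show P by auto
qed

lemma reflect_eqD:
  assumes "reflect b = reflect b'" "form b b = 2" "form b' b' = 2" shows "b = b' \<or> b = - b'"
proof -
  define c where "c = form b b' / 2"
  have "2 \<cdot> b = b - reflect b b" using assms(2) by (simp add: reflect_def)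
  also have "\<dots> = form b b' \<cdot> b'" by (simp add: assms(1)) (simp add: reflect_def)
  finally have "(1/2) \<cdot> 2 \<cdot> b = (1/2) \<cdot> form b b' \<cdot> b'" by simp
  then have b: "b = c \<cdot> b'" by (simp add: c_def)
  with assms have "c * c = 1" by simp
  then have "c = 1 \<or> c = - 1" by (simp add: square_eq_1_iff)
  with b show ?thesis by auto
qed

lemma root_of_eqI:
  assumes "t \<in> refls" "nonneg b" "form b b = 2" "act t = reflect b" shows "root_of t = b"
proof -
  have "root_of t = b \<or> root_of t = - b"
    using reflect_eqD[of "root_of t" b] assms root_of_norm act_refls by simp
  moreover have False if "root_of t = - b"
    using nonneg_antisym[of b] root_of_nonneg[OF assms(1)] that assms by auto
  ultimately show ?thesis by blast
qed

lemma root_of_S [simp]: "s \<in> S \<Longrightarrow> root_of s = simple_root s"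
  by (rule root_of_eqI) (use root_nonneg[of \<one> s] in \<open>auto simp: act_S len_S\<close>)

text \<open>All roots have norm 2, so proportional ones differ by a sign and define the same
  reflection. Proportionality, rather than equality, is what \<open>ex_generic\<close> has to
  exclude.\<close>

lemma root_of_inject:
  assumes "t \<in> refls" "t' \<in> refls" "root_of t = c \<cdot> root_of t'" shows "t = t'"
proof -
  have "c * c = 1" using root_of_norm[OF assms(1)] root_of_norm[OF assms(2)] assms(3) by simp
  then have "c = 1 \<or> c = - 1" by (simp add: square_eq_1_iff)
  then have "reflect (root_of t) = reflect (root_of t')" using assms(3) by (auto simp: reflect_def)
  then show ?thesis using assms act_inject act_refls by simp
qed

lemma act_root_of:
  assumes "t \<in> refls" "w \<in> carrier W"
  shows act_root_of_nonneg: "nonneg (act w (root_of t)) \<Longrightarrow> act w (root_of t) = root_of (w \<otimes> t \<otimes> inv w)"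
    and act_root_of_nonpos: "nonneg (- act w (root_of t)) \<Longrightarrow> act w (root_of t) = - root_of (w \<otimes> t \<otimes> inv w)"
    and act_root_of_sign: "nonneg (act w (root_of t)) \<or> nonneg (- act w (root_of t))"
proof -
  have conj: "act (w \<otimes> t \<otimes> inv w) = reflect (act w (root_of t))"
    using assms act_conj act_refls by simp
  have minus: "reflect (- b) = reflect b" for b by (auto simp: reflect_def)
  show "act w (root_of t) = root_of (w \<otimes> t \<otimes> inv w)" if "nonneg (act w (root_of t))"
    using root_of_eqI[OF refls_conj[OF assms] that] conj assms root_of_norm by simp
  show "act w (root_of t) = - root_of (w \<otimes> t \<otimes> inv w)" if "nonneg (- act w (root_of t))"
    using root_of_eqI[OF refls_conj[OF assms] that] conj assms root_of_norm minus by simp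
  obtain v s where "v \<in> carrier W" "s \<in> S" "root_of t = act v (simple_root s)"
    using root_ofE[OF assms(1)] .
  then show "nonneg (act w (root_of t)) \<or> nonneg (- act w (root_of t))"
    using root_sign[of "w \<otimes> v" s] assms by (simp add: act_mult)
qed

lemma root_of_neq_0: "t \<in> refls \<Longrightarrow> root_of t \<noteq> 0"
  using root_of_norm by fastforce

lemma lookup_root_of_None [simp]: "t \<in> refls \<Longrightarrow> Poly_Mapping.lookup (root_of t) None = 0"
  by (erule root_ofE) (simp add: simple_root_def lookup_single)

text \<open>The reflection in \<open>a\<close> changes only the \<open>a\<close>-coordinate, so a
  positive root that it makes negative has no other coordinate.\<close>

lemma simple_refl_root_of:
  assumes "a \<in> S" "t \<in> refls" "nonneg (- act a (root_of t))" shows "t = a"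
proof -
  have "Poly_Mapping.lookup (root_of t) i = 0" if "i \<noteq> Some a" for i
  proof -
    have "Poly_Mapping.lookup (act a (root_of t)) i = Poly_Mapping.lookup (root_of t) i"
      using that assms by (simp add: act_S reflect_def lookup_minus simple_root_def lookup_single when_def)
    then show ?thesis
      using assms(3) root_of_nonneg[OF assms(2)] unfolding nonneg_def
      by (metis lookup_uminus neg_0_le_iff_le order_antisym)
  qed
  then have "root_of t = Poly_Mapping.lookup (root_of t) (Some a) \<cdot> root_of a"
    using assms by (intro poly_mapping_eqI) (auto simp: simple_root_def lookup_single when_def)
  with assms show ?thesis using root_of_inject[of t a] by blast
qed

text \<open>Apply the letters from the right and stop where the root of \<open>t\<close> turns
  negative. There the conjugate of \<open>t\<close> by the suffix is the letter itself, so
  multiplying by \<open>t\<close> deletes this letter.\<close>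

lemma exchange_word:
  assumes "set ss \<subseteq> S" "t \<in> refls" "nonneg (- act (word_prod W ss) (root_of t))"
  shows "\<exists>ss'. set ss' \<subseteq> S \<and> length ss' < length ss \<and> word_prod W ss' = word_prod W ss \<otimes> t"
  using assms(1,3)
proof (induction ss)
  case Nil
  then show ?case using root_of_nonneg nonneg_antisym root_of_neq_0 assms(2) by fastforce
next
  case (Cons a ss)
  let ?v = "word_prod W ss"
  have S: "a \<in> S" "set ss \<subseteq> S" "?v \<in> carrier W" using Cons.prems by auto
  show ?case
  proof (cases "nonneg (- act ?v (root_of t))")
    case True
    then obtain ss' where "set ss' \<subseteq> S" "length ss' < length ss" "word_prod W ss' = ?v \<otimes> t"
      using Cons S by blast
    then show ?thesis using S assms by (intro exI[of _ "a # ss'"]) (auto simp: m_assoc)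
  next
    case False
    then have "nonneg (act ?v (root_of t))" using act_root_of_sign assms S by blast
    then have "act ?v (root_of t) = root_of (?v \<otimes> t \<otimes> inv ?v)"
      using act_root_of_nonneg assms S by blast
    then have "nonneg (- act a (root_of (?v \<otimes> t \<otimes> inv ?v)))"
      using Cons.prems S by (simp add: act_mult)
    then have "?v \<otimes> t \<otimes> inv ?v = a"
      by (intro simple_refl_root_of refls_conj S assms)
    then have "a \<otimes> ?v \<otimes> t = a \<otimes> a \<otimes> ?v"
      using S assms by (metis inv_solve_right m_assoc m_closed S_carrier refls_closed)
    then show ?thesis using S by (intro exI[of _ ss]) simp
  qed
qed

lemma len_refl_less:
  assumes "w \<in> carrier W" "t \<in> refls" "nonneg (- act w (root_of t))" shows "len (w \<otimes> t) < len w"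
proof -
  obtain ss where ss: "set ss \<subseteq> S" "word_prod W ss = w" "length ss = len w" 
    using ex_reduced_word[OF assms(1)] .
  obtain ss' where ss': "set ss' \<subseteq> S" "length ss' < length ss" "word_prod W ss' = w \<otimes> t"
    using exchange_word[OF ss(1) assms(2)] assms ss by auto
  then show ?thesis using len_le_length[of ss'] ss by simp
qed

lemma len_refl_greater:
  assumes "w \<in> carrier W" "t \<in> refls" "nonneg (act w (root_of t))" shows "len w < len (w \<otimes> t)"
proof -
  have "act (w \<otimes> t) (root_of t) = - act w (root_of t)"
    using assms root_of_norm by (simp add: act_mult act_refls reflect_self)
  then have "len (w \<otimes> t \<otimes> t) < len (w \<otimes> t)" using assms by (intro len_refl_less) auto
  then show ?thesis using assms by (simp add: m_assoc)
qed

lemma len_refl_less_iff: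
  assumes "w \<in> carrier W" "t \<in> refls" shows "len w < len (w \<otimes> t) \<longleftrightarrow> nonneg (act w (root_of t))"
  using len_refl_less[OF assms] len_refl_greater[OF assms] act_root_of_sign[OF assms(2,1)] by force

lemma len_refl_neq: "\<lbrakk>w \<in> carrier W; t \<in> refls\<rbrakk> \<Longrightarrow> len (w \<otimes> t) \<noteq> len w"
  using len_refl_less len_refl_greater act_root_of_sign by (metis less_irrefl)

lemma act_S_root_of:
  assumes "s \<in> S" "t \<in> refls" "t \<noteq> s"
  shows "act s (root_of t) = root_of (s \<otimes> t \<otimes> s)"
  using act_root_of_nonneg[of t s] act_root_of_sign[of t s] simple_refl_root_of[of s t] assms by auto

section \<open>Bruhat order\<close>

abbreviation edge :: "'a \<Rightarrow> 'a \<Rightarrow> bool" (infix "\<rightarrow>\<^sub>B" 50) where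
  "x \<rightarrow>\<^sub>B y \<equiv> bruhat_edge W S x y"

abbreviation ble :: "'a \<Rightarrow> 'a \<Rightarrow> bool" (infix "\<le>\<^sub>B" 50) where
  "x \<le>\<^sub>B y \<equiv> bruhat_le W S x y"

lemma edgeE:
  assumes "x \<rightarrow>\<^sub>B y"
  obtains t where "x \<in> carrier W" "t \<in> refls" "y = x \<otimes> t" "len x < len (x \<otimes> t)"
  using assms unfolding bruhat_edge_def by auto

lemma edgeI: "\<lbrakk>x \<in> carrier W; t \<in> refls; len x < len (x \<otimes> t)\<rbrakk> \<Longrightarrow> x \<rightarrow>\<^sub>B x \<otimes> t"
  unfolding bruhat_edge_def by auto

lemma edge_carrier: "x \<rightarrow>\<^sub>B y \<Longrightarrow> x \<in> carrier W" "x \<rightarrow>\<^sub>B y \<Longrightarrow> y \<in> carrier W"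
  and edge_len: "x \<rightarrow>\<^sub>B y \<Longrightarrow> len x < len y"
  by (simp_all add: bruhat_edge_def)

lemma edge_neq: "x \<rightarrow>\<^sub>B y \<Longrightarrow> x \<noteq> y"
  using edge_len by blast

lemma edge_asym: "x \<rightarrow>\<^sub>B y \<Longrightarrow> \<not> y \<rightarrow>\<^sub>B x"
  using edge_len by (meson less_asym)

lemma edge_S_iff: "\<lbrakk>x \<in> carrier W; s \<in> S\<rbrakk> \<Longrightarrow> x \<rightarrow>\<^sub>B x \<otimes> s \<longleftrightarrow> len x < len (x \<otimes> s)"
  using edgeI edge_len by blast

lemma edge_S_down_iff: "\<lbrakk>x \<in> carrier W; s \<in> S\<rbrakk> \<Longrightarrow> x \<otimes> s \<rightarrow>\<^sub>B x \<longleftrightarrow> len (x \<otimes> s) < len x"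
  using edge_S_iff[of "x \<otimes> s" s] by simp

text \<open>The direction of the edge \<open>x \<rightarrow> x t\<close> is the sign of
  \<open>x\<close> applied to the root of \<open>t\<close>. Since \<open>s\<close> permutes the
  positive roots other than its own, \<open>x s\<close> takes the root of \<open>s t s\<close> to
  the same vector.\<close>

lemma edge_shift:
  assumes e: "x \<rightarrow>\<^sub>B y" and s: "s \<in> S" and "y \<noteq> x \<otimes> s" shows "x \<otimes> s \<rightarrow>\<^sub>B y \<otimes> s"
proof -
  from e obtain t where t: "x \<in> carrier W" "t \<in> refls" "y = x \<otimes> t" "len x < len (x \<otimes> t)"
    by (rule edgeE)
  with assms have "t \<noteq> s" by auto
  have c: "s \<otimes> t \<otimes> s \<in> refls" using refls_conj[OF t(2), of s] s by simp
  have "act (x \<otimes> s) (root_of (s \<otimes> t \<otimes> s)) = act (x \<otimes> s) (act s (root_of t))"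
    using act_S_root_of[OF s t(2) \<open>t \<noteq> s\<close>] by simp
  also have "\<dots> = act x (root_of t)"
    using t s by (simp flip: act_mult)
  finally have "len (x \<otimes> s) < len (x \<otimes> s \<otimes> (s \<otimes> t \<otimes> s))"
    using t s c by (simp only: len_refl_less_iff m_closed S_carrier)
  from edgeI[OF _ c this] s t have "x \<otimes> s \<rightarrow>\<^sub>B x \<otimes> s \<otimes> (s \<otimes> t \<otimes> s)" by simp
  also have "x \<otimes> s \<otimes> (s \<otimes> t \<otimes> s) = y \<otimes> s" using s t by (simp add: m_assoc)
  finally show ?thesis .
qed

lemma edge_shift_iff:
  assumes "x \<in> carrier W" "y \<in> carrier W" "s \<in> S" "y \<noteq> x \<otimes> s" 
  shows "x \<otimes> s \<rightarrow>\<^sub>B y \<otimes> s \<longleftrightarrow> x \<rightarrow>\<^sub>B y"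
  using edge_shift[of x y s] edge_shift[of "x \<otimes> s" "y \<otimes> s" s] assms by (auto simp: mult_S_eq_iff)

lemma edge_shift_down_iff:
  assumes "x \<in> carrier W" "y \<in> carrier W" "s \<in> S" "x \<noteq> y" 
  shows "x \<otimes> s \<rightarrow>\<^sub>B y \<longleftrightarrow> x \<rightarrow>\<^sub>B y \<otimes> s"
  using edge_shift_iff[of x "y \<otimes> s" s] assms by (auto simp: mult_S_eq_iff)

text \<open>Inversion turns left multiplication by \<open>t\<close> into right multiplication and
  the pair \<open>x\<close>, \<open>x s\<close> into an edge in one direction or the other, to which
  \<open>edge_shift_iff\<close> applies.\<close>

lemma len_shift_left_iff:
  assumes "x \<in> carrier W" "s \<in> S" "t \<in> S" "x \<otimes> s \<noteq> t \<otimes> x"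
  shows "len (t \<otimes> x) < len (t \<otimes> x \<otimes> s) \<longleftrightarrow> len x < len (x \<otimes> s)"
proof -
  let ?y = "inv x" and ?z = "inv (x \<otimes> s)"
  have z: "?z = ?y \<otimes> (x \<otimes> s \<otimes> inv x)"
    using assms by (simp add: inv_mult_group flip: m_assoc)
  have edge: "?y \<rightarrow>\<^sub>B ?z \<longleftrightarrow> len x < len (x \<otimes> s)"
    using edgeI[of ?y "x \<otimes> s \<otimes> inv x"] edge_len[of ?y ?z] z assms reflsI 
    by (metis inv_closed len_inv m_closed S_carrier)
  have z': "?z \<otimes> t = ?y \<otimes> t \<otimes> ((t \<otimes> x) \<otimes> s \<otimes> inv (t \<otimes> x))"
    using assms by (simp add: inv_mult_group flip: m_assoc)
  have len: "len (?y \<otimes> t) = len (t \<otimes> x)" "len (?z \<otimes> t) = len (t \<otimes> x \<otimes> s)"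
    using assms len_inv[of "t \<otimes> x"] len_inv[of "t \<otimes> x \<otimes> s"] by (simp_all add: inv_mult_group m_assoc)
  have edge': "?y \<otimes> t \<rightarrow>\<^sub>B ?z \<otimes> t \<longleftrightarrow> len (t \<otimes> x) < len (t \<otimes> x \<otimes> s)"
    using edgeI[of "?y \<otimes> t" "(t \<otimes> x) \<otimes> s \<otimes> inv (t \<otimes> x)"] edge_len[of "?y \<otimes> t" "?z \<otimes> t"] 
      z' len assms reflsI[of "t \<otimes> x" s] by auto
  have "?z \<noteq> ?y \<otimes> t"
  proof
    assume "?z = ?y \<otimes> t"
    then have "inv ?z = inv (?y \<otimes> t)" by simp
    with assms show False by (simp add: inv_mult_group)
  qed
  with edge_shift_iff[of ?y ?z t] edge edge' assms show ?thesis by simp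
qed

section \<open>The order relation and the lifting property\<close>

lemma ble_carrier: "x \<le>\<^sub>B y \<Longrightarrow> x \<in> carrier W" "x \<le>\<^sub>B y \<Longrightarrow> y \<in> carrier W"
  by (simp_all add: bruhat_le_def)

lemma ble_refl [simp]: "x \<le>\<^sub>B x \<longleftrightarrow> x \<in> carrier W"
  by (auto simp: bruhat_le_def)

lemma ble_trans: "\<lbrakk>x \<le>\<^sub>B y; y \<le>\<^sub>B z\<rbrakk> \<Longrightarrow> x \<le>\<^sub>B z"
  by (auto simp: bruhat_le_def)

lemma edge_ble: "x \<rightarrow>\<^sub>B y \<Longrightarrow> x \<le>\<^sub>B y"
  using edge_carrier by (auto simp: bruhat_le_def)

lemma ble_induct [consumes 1, case_names refl step]:
  assumes "x \<le>\<^sub>B y" "x \<in> carrier W \<Longrightarrow> P x" "\<And>y z. \<lbrakk>x \<le>\<^sub>B y; y \<rightarrow>\<^sub>B z; P y\<rbrakk> \<Longrightarrow> P z"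
  shows "P y"
proof -
  have x: "x \<in> carrier W" and "(edge)\<^sup>*\<^sup>* x y" using assms(1) by (auto simp: bruhat_le_def)
  from this(2) have "P y \<and> x \<le>\<^sub>B y"
  proof induction
    case base then show ?case using x assms(2) by simp
  next
    case (step y z)
    then show ?case using assms(3)[of y z] edge_ble ble_trans by blast
  qed
  then show ?thesis ..
qed

lemma ble_len: "x \<le>\<^sub>B y \<Longrightarrow> x = y \<or> len x < len y"
  by (induction rule: ble_induct) (use edge_len less_trans in blast)+

lemma ble_len_le: "x \<le>\<^sub>B y \<Longrightarrow> len x \<le> len y"
  using ble_len by fastforce

lemma ble_one_iff: "x \<le>\<^sub>B \<one> \<longleftrightarrow> x = \<one>"
  using ble_len[of x \<one>] by auto

text \<open>The factor \<open>s\<close> is pushed along a chain: edges survive by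
  \<open>edge_shift\<close>, except one whose ends differ by \<open>s\<close>, and that one turns
  the second alternative into the first.\<close>

lemma ble_shift_left: "\<lbrakk>x \<le>\<^sub>B y; s \<in> S\<rbrakk> \<Longrightarrow> x \<otimes> s \<le>\<^sub>B y \<or> x \<otimes> s \<le>\<^sub>B y \<otimes> s"
proof (induction rule: ble_induct)
  case refl then show ?case by auto
next
  case (step y z)
  have "y \<le>\<^sub>B z" using step edge_ble by blast
  then consider "x \<otimes> s \<le>\<^sub>B z" | "x \<otimes> s \<le>\<^sub>B y \<otimes> s" using step ble_trans by blast
  then show ?case
  proof cases
    case 2
    show ?thesis
    proof (cases "z = y \<otimes> s")
      case False
      then have "y \<otimes> s \<le>\<^sub>B z \<otimes> s" using edge_shift edge_ble step by blast
      with 2 ble_trans show ?thesis by blast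
    qed (use 2 in simp)
  qed simp
qed

lemma ble_shift_right: "\<lbrakk>x \<le>\<^sub>B y; s \<in> S\<rbrakk> \<Longrightarrow> x \<le>\<^sub>B y \<otimes> s \<or> x \<otimes> s \<le>\<^sub>B y \<otimes> s"
proof (induction rule: ble_induct)
  case refl then show ?case by auto
next
  case (step y z)
  show ?case
  proof (cases "z = y \<otimes> s")
    case True
    then show ?thesis using step edge_carrier by simp
  next
    case False
    then have "y \<otimes> s \<le>\<^sub>B z \<otimes> s" using edge_shift edge_ble step by blast
    with step ble_trans show ?thesis by blast
  qed
qed

lemma ble_mult_S: "\<lbrakk>x \<in> carrier W; s \<in> S; len x < len (x \<otimes> s)\<rbrakk> \<Longrightarrow> x \<le>\<^sub>B x \<otimes> s"
  using edge_S_iff edge_ble by blast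

lemma lifting_left: "\<lbrakk>x \<le>\<^sub>B y; s \<in> S; len (y \<otimes> s) < len y\<rbrakk> \<Longrightarrow> x \<otimes> s \<le>\<^sub>B y"
  using ble_shift_left[of x y s] ble_mult_S[of "y \<otimes> s" s] ble_carrier[of x y] ble_trans by auto

lemma lifting_up: 
  assumes "x \<le>\<^sub>B y" "s \<in> S" "len y < len (y \<otimes> s)" shows "x \<otimes> s \<le>\<^sub>B y \<otimes> s"
proof -
  have "x \<le>\<^sub>B y \<otimes> s" using assms ble_mult_S ble_carrier ble_trans by blast
  then show ?thesis using lifting_left[of x "y \<otimes> s" s] assms ble_carrier by auto
qed

lemma ble_descent_cases:
  assumes "x \<le>\<^sub>B w" "s \<in> S" "len (w \<otimes> s) < len w"
  shows "x \<le>\<^sub>B w \<otimes> s \<or> x \<otimes> s \<le>\<^sub>B w \<otimes> s"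
  using assms ble_shift_right by blast

lemma ble_descent_iff:
  assumes "x \<in> carrier W" "w \<in> carrier W" "s \<in> S" "len (w \<otimes> s) < len w"
  shows "x \<otimes> s \<le>\<^sub>B w \<longleftrightarrow> x \<le>\<^sub>B w"
  using lifting_left[of x w s] lifting_left[of "x \<otimes> s" w s] assms by auto

text \<open>Edges may raise the length by more than one, whereas Chevalley's formula sums over
  covers only. For a descent \<open>s\<close> of \<open>w\<close>, either \<open>w s\<close> serves,
  or a cover found below \<open>w s\<close> is lifted by \<open>s\<close>.\<close>

lemma ex_lower_cover:
  assumes "v \<le>\<^sub>B w" "v \<noteq> w"
  shows "\<exists>u. v \<le>\<^sub>B u \<and> u \<rightarrow>\<^sub>B w \<and> len w = Suc (len u)"
  using assms
proof (induction "len w" arbitrary: v w rule: less_induct)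
  case less
  have c: "v \<in> carrier W" "w \<in> carrier W" using less.prems ble_carrier by auto
  have "w \<noteq> \<one>" using less.prems ble_one_iff by auto
  then obtain s where s: "s \<in> S" "len w = Suc (len (w \<otimes> s))" using ex_right_descent[OF c(2)] by blast
  have ws: "w \<otimes> s \<rightarrow>\<^sub>B w" using edge_S_down_iff c s by simp
  show ?case
  proof (cases "v \<le>\<^sub>B w \<otimes> s")
    case True
    then show ?thesis using ws s by auto
  next
    case False
    then have vs: "v \<otimes> s \<le>\<^sub>B w \<otimes> s" using ble_descent_cases[OF less.prems(1) s(1)] s by auto
    have "v \<otimes> s \<noteq> w \<otimes> s" using less.prems c s by (metis S_cancel_right)
    with less.hyps[OF _ vs] s obtain u 
      where u: "v \<otimes> s \<le>\<^sub>B u" "u \<rightarrow>\<^sub>B w \<otimes> s" "len (w \<otimes> s) = Suc (len u)" by auto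
    have uc: "u \<in> carrier W" using u ble_carrier by blast
    \<comment> \<open>Otherwise lifting puts \<open>v\<close> below \<open>u\<close>, hence below
      \<open>w s\<close>.\<close>
    have up: "len u < len (u \<otimes> s)"
    proof (rule ccontr)
      assume "\<not> ?thesis"
      then have "len (u \<otimes> s) < len u" using len_S_neq uc s by (meson linorder_neqE_nat)
      then have "v \<le>\<^sub>B u" using u(1) lifting_left[of "v \<otimes> s" u s] c s by simp
      with False u(2) show False using edge_ble ble_trans by blast
    qed
    have "v \<le>\<^sub>B u \<otimes> s" using lifting_up[OF u(1) s(1) up] c s by simp
    moreover have "w \<otimes> s \<noteq> u \<otimes> s"
      using calculation False by auto
    then have "u \<otimes> s \<rightarrow>\<^sub>B w" using edge_shift[OF u(2) s(1)] c s uc by simp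
    moreover have "len (u \<otimes> s) = Suc (len u)" 
      using up by (cases rule: len_mult_S_cases[OF uc s(1)]) auto
    ultimately show ?thesis using u s by auto
  qed
qed

lemma finite_ble: "finite {v. v \<le>\<^sub>B w}"
proof (cases "w \<in> carrier W")
  case True
  then show ?thesis
  proof (induction "len w" arbitrary: w rule: less_induct)
    case less
    show ?case
    proof (cases "w = \<one>")
      case True
      then show ?thesis by (simp add: ble_one_iff)
    next
      case False
      then obtain s where s: "s \<in> S" "len w = Suc (len (w \<otimes> s))" 
        using ex_right_descent[OF less.prems] by blast
      have "{v. v \<le>\<^sub>B w} \<subseteq> {v. v \<le>\<^sub>B w \<otimes> s} \<union> (\<lambda>v. v \<otimes> s) ` {v. v \<le>\<^sub>B w \<otimes> s}"
      proof
        fix v assume v: "v \<in> {v. v \<le>\<^sub>B w}"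
        then have "v = v \<otimes> s \<otimes> s" using ble_carrier s by auto
        then show "v \<in> {v. v \<le>\<^sub>B w \<otimes> s} \<union> (\<lambda>v. v \<otimes> s) ` {v. v \<le>\<^sub>B w \<otimes> s}"
          using ble_descent_cases[of v w s] v s by auto
      qed
      then show ?thesis using less s by (elim finite_subset) auto
    qed
  qed
qed (use ble_carrier in \<open>auto intro: finite_subset[of _ "{}"]\<close>)

text \<open>The recursion for inversion sets, with an inversion recorded by the element it leads to.
  It yields the number of inversions, the value of \<open>h_word\<close> at the top and the covers
  of \<open>w s\<close>.\<close>

lemma edge_into_mult_S:
  assumes "w \<in> carrier W" "s \<in> S" "len w < len (w \<otimes> s)"
  shows "{v. v \<rightarrow>\<^sub>B w \<otimes> s} = insert w ((\<lambda>v. v \<otimes> s) ` {v. v \<rightarrow>\<^sub>B w})"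
proof (intro equalityI subsetI)
  fix v assume v: "v \<in> {v. v \<rightarrow>\<^sub>B w \<otimes> s}"
  then have vc: "v \<in> carrier W" using edge_carrier by blast
  show "v \<in> insert w ((\<lambda>v. v \<otimes> s) ` {v. v \<rightarrow>\<^sub>B w})"
  proof (cases "v = w")
    case False
    then have "v \<otimes> s \<rightarrow>\<^sub>B w" using v edge_shift_iff[of "v \<otimes> s" w s] vc assms by auto
    moreover have "v = v \<otimes> s \<otimes> s" using vc assms by simp
    ultimately show ?thesis by blast
  qed simp
next
  fix v assume "v \<in> insert w ((\<lambda>v. v \<otimes> s) ` {v. v \<rightarrow>\<^sub>B w})"
  then consider "v = w" | y where "y \<rightarrow>\<^sub>B w" "v = y \<otimes> s" by blast
  then show "v \<in> {v. v \<rightarrow>\<^sub>B w \<otimes> s}"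
  proof cases
    case 1 then show ?thesis using assms edge_S_iff by simp
  next
    case 2
    then have "w \<noteq> y \<otimes> s" using assms edge_carrier edge_len by fastforce
    with 2 show ?thesis using edge_shift assms by auto
  qed
qed

lemma finite_edge_into: "finite {v. v \<rightarrow>\<^sub>B w}"
  by (rule finite_subset[OF _ finite_ble[of w]]) (auto intro: edge_ble)

lemma card_edge_into: "w \<in> carrier W \<Longrightarrow> card {v. v \<rightarrow>\<^sub>B w} = len w"
proof (induction "len w" arbitrary: w rule: less_induct)
  case less
  show ?case
  proof (cases "w = \<one>")
    case True
    then have "{v. v \<rightarrow>\<^sub>B w} = {}" using edge_len by fastforce
    then show ?thesis using True by simp
  next
    case False
    then obtain s where s: "s \<in> S" "len w = Suc (len (w \<otimes> s))" 
      using ex_right_descent[OF less.prems] by blast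
    have inj: "inj_on (\<lambda>v. v \<otimes> s) {v. v \<rightarrow>\<^sub>B w \<otimes> s}"
      using s edge_carrier by (intro inj_onI) (auto dest: edge_carrier)
    have "w \<otimes> s \<notin> (\<lambda>v. v \<otimes> s) ` {v. v \<rightarrow>\<^sub>B w \<otimes> s}"
    proof
      assume "w \<otimes> s \<in> (\<lambda>v. v \<otimes> s) ` {v. v \<rightarrow>\<^sub>B w \<otimes> s}"
      then obtain v where v: "w \<otimes> s = v \<otimes> s" "v \<rightarrow>\<^sub>B w \<otimes> s" by auto
      then have "w = v" using less.prems s edge_carrier(1)[OF v(2)] by simp
      with v(2) s edge_len[OF v(2)] show False by simp
    qed
    moreover have "{v. v \<rightarrow>\<^sub>B w} = insert (w \<otimes> s) ((\<lambda>v. v \<otimes> s) ` {v. v \<rightarrow>\<^sub>B w \<otimes> s})"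
      using edge_into_mult_S[of "w \<otimes> s" s] less.prems s by simp
    ultimately show ?thesis 
      using less.hyps[of "w \<otimes> s"] less.prems s finite_edge_into card_image[OF inj] by simp
  qed
qed

section \<open>R-polynomials near q = 1\<close>

abbreviation (input) q :: "int poly" where "q \<equiv> [:0, 1:]"

text \<open>Up to the factor \<open>q\<close>, \<open>R_op s\<close> and \<open>T_op s\<close> are inverse to each other: \<open>T_op s\<close> and
  \<open>T_op' s\<close> are right and left multiplication by a Hecke algebra generator, written on coefficient 
  functions. That left and right multiplications commute gives independence of reduced words.\<close>

definition R_op :: "'a \<Rightarrow> ('a \<Rightarrow> int poly) \<Rightarrow> 'a \<Rightarrow> int poly" where
  "R_op s f x = (if x \<notin> carrier W then 0 
     else if len (x \<otimes> s) < len x then f (x \<otimes> s) else q * f (x \<otimes> s) + (q - 1) * f x)"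

definition T_op :: "'a \<Rightarrow> ('a \<Rightarrow> int poly) \<Rightarrow> 'a \<Rightarrow> int poly" where
  "T_op s f x = (if x \<notin> carrier W then 0 
     else if len x < len (x \<otimes> s) then q * f (x \<otimes> s) else f (x \<otimes> s) - (q - 1) * f x)"

definition T_op' :: "'a \<Rightarrow> ('a \<Rightarrow> int poly) \<Rightarrow> 'a \<Rightarrow> int poly" where
  "T_op' t f x = (if x \<notin> carrier W then 0 
     else if len x < len (t \<otimes> x) then q * f (t \<otimes> x) else f (t \<otimes> x) - (q - 1) * f x)"

definition delta :: "'a \<Rightarrow> 'a \<Rightarrow> int poly" where
  "delta y x = (if x = y then 1 else 0)"

text \<open>Such a function is a finite combination of \<open>delta\<close> functions, on which
  \<open>T_word_cong\<close> is checked.\<close>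

definition finsupp :: "('a \<Rightarrow> int poly) \<Rightarrow> bool" where
  "finsupp f \<longleftrightarrow> finite {x. f x \<noteq> 0} \<and> {x. f x \<noteq> 0} \<subseteq> carrier W"

lemma mult_S_less_iff: "\<lbrakk>x \<in> carrier W; s \<in> S\<rbrakk> \<Longrightarrow> \<not> len (x \<otimes> s) < len x \<longleftrightarrow> len x < len (x \<otimes> s)"
  using len_S_neq by (metis linorder_neqE_nat less_asym)

text \<open>\<open>R_op s\<close> is \<open>T_op s\<close> plus \<open>q - 1\<close>, and the
  generator satisfies \<open>T^2 = q - (q - 1) T\<close>.\<close>

lemma T_op_R_op: 
  assumes "s \<in> S" "x \<in> carrier W" shows "T_op s (R_op s f) x = q * f x"
  using mult_S_less_iff[of x s] assms by (auto simp: T_op_def R_op_def algebra_simps)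

lemma R_op_T_op:
  assumes "s \<in> S" "x \<in> carrier W" shows "R_op s (T_op s f) x = q * f x"
  using mult_S_less_iff[of x s] assms by (auto simp: T_op_def R_op_def algebra_simps)

lemma op_cmult: 
  "T_op s (\<lambda>x. c * f x) = (\<lambda>x. c * T_op s f x)" "R_op s (\<lambda>x. c * f x) = (\<lambda>x. c * R_op s f x)"
  by (auto simp: T_op_def R_op_def algebra_simps fun_eq_iff)

lemma T_op_add: "T_op s (\<lambda>x. f x + g x) = (\<lambda>x. T_op s f x + T_op s g x)"
  by (auto simp: T_op_def algebra_simps fun_eq_iff)

lemma finsupp_op:
  assumes "s \<in> S" "finsupp f" shows finsupp_R_op: "finsupp (R_op s f)" and finsupp_T_op: "finsupp (T_op s f)"
proof -
  let ?A = "{x. f x \<noteq> 0}"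
  have A: "finite (?A \<union> (\<lambda>x. x \<otimes> s) ` ?A)" using assms by (simp add: finsupp_def)
  have "x \<in> ?A \<union> (\<lambda>x. x \<otimes> s) ` ?A" if "x \<in> carrier W" "f x \<noteq> 0 \<or> f (x \<otimes> s) \<noteq> 0" for x
  proof (cases "f x = 0")
    case True
    have "x = x \<otimes> s \<otimes> s" using that assms by simp
    then show ?thesis using that True by blast
  qed simp
  then have "{x. R_op s f x \<noteq> 0} \<subseteq> ?A \<union> (\<lambda>x. x \<otimes> s) ` ?A" "{x. T_op s f x \<noteq> 0} \<subseteq> ?A \<union> (\<lambda>x. x \<otimes> s) ` ?A"
    by (fastforce simp: R_op_def T_op_def split: if_splits)+
  with A have "finite {x. R_op s f x \<noteq> 0}" "finite {x. T_op s f x \<noteq> 0}" using finite_subset by blast+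
  then show "finsupp (R_op s f)" "finsupp (T_op s f)"
    unfolding finsupp_def by (auto simp: R_op_def T_op_def split: if_splits)
qed

text \<open>If \<open>x s = t x\<close>, the two operators coincide at \<open>x\<close> and at
  \<open>t x\<close>. Otherwise whether \<open>s\<close> is a right ascent is the same for
  \<open>x\<close> and \<open>t x\<close>, and whether \<open>t\<close> is a left ascent is the same
  for \<open>x\<close> and \<open>x s\<close>.\<close>

lemma T_op_commute:
  assumes "s \<in> S" "t \<in> S" shows "T_op s (T_op' t f) = T_op' t (T_op s f)"
proof
  fix x
  show "T_op s (T_op' t f) x = T_op' t (T_op s f) x"
  proof (cases "x \<in> carrier W")
    case x: True
    have a: "t \<otimes> (x \<otimes> s) = t \<otimes> x \<otimes> s" using x assms by (simp add: m_assoc)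
    show ?thesis
    proof (cases "x \<otimes> s = t \<otimes> x")
      case True
      then have "t \<otimes> x \<otimes> s = x" using x assms S_cancel_right[of x s] by simp
      then have "T_op s g x = T_op' t g x" "T_op s g (t \<otimes> x) = T_op' t g (t \<otimes> x)" for g
        using True x assms by (auto simp: T_op_def T_op'_def)
      moreover have "T_op s g x = T_op s h x \<and> T_op' t g x = T_op' t h x" 
        if "g x = h x" "g (t \<otimes> x) = h (t \<otimes> x)" for g h
        using that True by (auto simp: T_op_def T_op'_def)
      ultimately show ?thesis by metis
    next
      case False
      have c: "len (t \<otimes> x) < len (t \<otimes> x \<otimes> s) \<longleftrightarrow> len x < len (x \<otimes> s)"
        using len_shift_left_iff False x assms by blast
      have "inv x \<otimes> t \<noteq> s \<otimes> inv x"
      proof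
        assume "inv x \<otimes> t = s \<otimes> inv x"
        then have "inv (inv x \<otimes> t) = inv (s \<otimes> inv x)" by simp
        with False x assms show False by (simp add: inv_mult_group)
      qed
      then have "len (s \<otimes> inv x) < len (s \<otimes> inv x \<otimes> t) \<longleftrightarrow> len (inv x) < len (inv x \<otimes> t)"
        using len_shift_left_iff[of "inv x" t s] x assms by simp
      moreover have "s \<otimes> inv x = inv (x \<otimes> s)" "s \<otimes> inv x \<otimes> t = inv (t \<otimes> x \<otimes> s)" "inv x \<otimes> t = inv (t \<otimes> x)"
        using x assms by (simp_all add: inv_mult_group m_assoc)
      ultimately have d: "len (x \<otimes> s) < len (t \<otimes> x \<otimes> s) \<longleftrightarrow> len x < len (t \<otimes> x)"
        using x assms by simp
      show ?thesis using x assms by (simp add: T_op_def T_op'_def a c d algebra_simps)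
    qed
  qed (simp add: T_op_def T_op'_def)
qed

lemma T_op_delta:
  assumes "s \<in> S" "y \<in> carrier W" "len y < len (y \<otimes> s)" shows "T_op s (delta y) = delta (y \<otimes> s)"
  using assms by (auto simp: T_op_def delta_def fun_eq_iff)

lemma T_op'_delta:
  assumes "t \<in> S" "y \<in> carrier W" "len y < len (t \<otimes> y)" shows "T_op' t (delta y) = delta (t \<otimes> y)"
  using assms by (auto simp: T_op'_def delta_def fun_eq_iff)

section \<open>Operators along reduced words\<close>

definition reduced :: "'a list \<Rightarrow> bool" where
  "reduced ss \<longleftrightarrow> set ss \<subseteq> S \<and> len (word_prod W ss) = length ss"

lemma reduced_Cons:
  assumes "reduced (s # ss)"
  shows "reduced ss" "s \<in> S" "len (word_prod W ss) < len (s \<otimes> word_prod W ss)"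
    "len (inv (word_prod W ss)) < len (inv (word_prod W ss) \<otimes> s)"
proof -
  show "reduced ss" "s \<in> S" using assms reduced_suffix[of "[s]" ss] by (auto simp: reduced_def)
  then show 1: "len (word_prod W ss) < len (s \<otimes> word_prod W ss)" using assms by (simp add: reduced_def)
  have "word_prod W ss \<in> carrier W" using \<open>reduced ss\<close> by (auto simp: reduced_def)
  moreover from this have "inv (word_prod W ss) \<otimes> s = inv (s \<otimes> word_prod W ss)"
    using \<open>s \<in> S\<close> by (simp add: inv_mult_group)
  ultimately show "len (inv (word_prod W ss)) < len (inv (word_prod W ss) \<otimes> s)"
    using 1 \<open>s \<in> S\<close> by simp
qed

lemma reduced_snoc:
  assumes "reduced ss" "s \<in> S" "len (word_prod W ss) < len (word_prod W ss \<otimes> s)"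
  shows "reduced (ss @ [s])"
  using assms len_mult_S_cases[of "word_prod W ss" s] by (force simp: reduced_def)

definition T_word :: "'a list \<Rightarrow> ('a \<Rightarrow> int poly) \<Rightarrow> 'a \<Rightarrow> int poly" where
  "T_word = foldr T_op"

text \<open>The order is opposite to that of \<open>T_word\<close>: thus \<open>T_word\<close>
  undoes it up to a power of \<open>q\<close>, and appending a letter to the word applies one more
  \<open>R_op\<close>, as the recursion for \<open>R\<close> requires.\<close>

definition R_word :: "'a list \<Rightarrow> ('a \<Rightarrow> int poly) \<Rightarrow> 'a \<Rightarrow> int poly" where
  "R_word = fold R_op"

lemma T_word_simps [simp]: "T_word [] f = f" "T_word (s # ss) f = T_op s (T_word ss f)"
  by (simp_all add: T_word_def)

lemma R_word_simps [simp]: "R_word [] f = f" "R_word (s # ss) f = R_word ss (R_op s f)"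
  by (simp_all add: R_word_def)

lemma T_word_linear:
  "T_word ss (\<lambda>x. c * f x) = (\<lambda>x. c * T_word ss f x)" 
  "T_word ss (\<lambda>x. f x + g x) = (\<lambda>x. T_word ss f x + T_word ss g x)"
  by (induction ss) (simp_all add: op_cmult T_op_add)

lemma R_word_cmult: "R_word ss (\<lambda>x. c * f x) = (\<lambda>x. c * R_word ss f x)"
  by (induction ss arbitrary: f) (simp_all add: op_cmult)

lemma finsupp_word: 
  assumes "set ss \<subseteq> S" "finsupp f" shows "finsupp (R_word ss f)" "finsupp (T_word ss f)"
proof -
  show "finsupp (R_word ss f)" using assms by (induction ss arbitrary: f) (auto simp: finsupp_R_op)
  show "finsupp (T_word ss f)" using assms by (induction ss arbitrary: f) (auto simp: finsupp_T_op)
qed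

lemma finsupp_delta [simp]: "y \<in> carrier W \<Longrightarrow> finsupp (delta y)"
  by (simp add: finsupp_def delta_def)

lemma T_R_word: 
  assumes "set ss \<subseteq> S" "finsupp f" shows "T_word ss (R_word ss f) = (\<lambda>x. q ^ length ss * f x)"
  using assms
proof (induction ss arbitrary: f)
  case (Cons s ss)
  have "T_word (s # ss) (R_word (s # ss) f) = T_op s (\<lambda>x. q ^ length ss * R_op s f x)"
    using Cons by (simp add: finsupp_R_op)
  also have "\<dots> = (\<lambda>x. q ^ length (s # ss) * f x)"
  proof
    fix x
    show "T_op s (\<lambda>x. q ^ length ss * R_op s f x) x = q ^ length (s # ss) * f x"
    proof (cases "x \<in> carrier W")
      case True
      then have "T_op s (R_op s f) x = q * f x" using Cons.prems T_op_R_op by simp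
      then have "T_op s (\<lambda>x. q ^ length ss * R_op s f x) x = q ^ length ss * (q * f x)" 
        by (simp only: op_cmult)
      then show ?thesis by (simp only: list.size power_Suc mult_ac add_Suc_right add_0_right)
    next
      case False
      then have "f x = 0" using Cons.prems unfolding finsupp_def by blast
      with False show ?thesis by (simp add: T_op_def)
    qed
  qed
  finally show ?case .
qed simp

lemma R_T_word: 
  assumes "set ss \<subseteq> S" "finsupp f" shows "R_word ss (T_word ss f) = (\<lambda>x. q ^ length ss * f x)"
  using assms
proof (induction ss)
  case (Cons s ss)
  have "R_op s (T_op s (T_word ss f)) = (\<lambda>x. q * T_word ss f x)"
  proof
    fix x
    show "R_op s (T_op s (T_word ss f)) x = q * T_word ss f x"
    proof (cases "x \<in> carrier W")
      case True
      then show ?thesis using Cons.prems by (simp add: R_op_T_op)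
    next
      case False
      then have "T_word ss f x = 0" using Cons.prems finsupp_word[of ss f] unfolding finsupp_def by auto
      with False show ?thesis by (simp add: R_op_def)
    qed
  qed
  then have "R_word (s # ss) (T_word (s # ss) f) = (\<lambda>x. q * R_word ss (T_word ss f) x)"
    by (simp only: T_word_simps R_word_simps R_word_cmult)
  also have "R_word ss (T_word ss f) = (\<lambda>x. q ^ length ss * f x)" using Cons by simp
  finally show ?case by (simp only: list.size power_Suc mult_ac add_Suc_right add_0_right)
qed simp

text \<open>The last letter acts before the others, each by multiplication on the right, which
  produces the inverse of the product.\<close>

lemma T_word_delta: "reduced ss \<Longrightarrow> T_word ss (delta \<one>) = delta (inv (word_prod W ss))"
proof (induction ss)
  case (Cons s ss)
  note red = reduced_Cons[OF Cons.prems]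
  have "T_op s (delta (inv (word_prod W ss))) = delta (inv (word_prod W ss) \<otimes> s)"
    using red by (intro T_op_delta) (auto simp: reduced_def)
  with Cons red show ?case by (simp add: inv_mult_group reduced_def)
qed simp

text \<open>Left operators build \<open>delta y\<close> from \<open>delta\<close> at the identity
  and commute with \<open>T_word\<close>. This reduces to the identity, where
  \<open>T_word_delta\<close> shows that only the product matters.\<close>

lemma T_word_cong_delta:
  assumes "reduced xs" "reduced ys" "word_prod W xs = word_prod W ys" "y \<in> carrier W"
  shows "T_word xs (delta y) = T_word ys (delta y)"
proof -
  have comm: "T_word as (foldr T_op' bs f) = foldr T_op' bs (T_word as f)" 
    if "set as \<subseteq> S" "set bs \<subseteq> S" for as bs f
    using that
  proof (induction bs)
    case (Cons b bs)
    have "T_word as (T_op' b g) = T_op' b (T_word as g)" for g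
      using Cons.prems by (induction as) (auto simp: T_op_commute)
    then show ?case using Cons by simp
  qed simp
  obtain bs where bs: "set bs \<subseteq> S" "word_prod W bs = y" "length bs = len y"
    using ex_reduced_word[OF assms(4)] .
  have "reduced bs \<Longrightarrow> foldr T_op' bs (delta \<one>) = delta (word_prod W bs)" for bs
  proof (induction bs)
    case (Cons b bs)
    note red = reduced_Cons[OF Cons.prems]
    have "T_op' b (delta (word_prod W bs)) = delta (b \<otimes> word_prod W bs)"
      using red by (intro T_op'_delta) (auto simp: reduced_def)
    with Cons red show ?case by simp
  qed simp
  then have "delta y = foldr T_op' bs (delta \<one>)" using bs by (simp add: reduced_def)
  then show ?thesis using assms comm bs T_word_delta by (simp add: reduced_def)
qed

lemma T_word_cong:
  assumes "reduced xs" "reduced ys" "word_prod W xs = word_prod W ys" "finsupp f"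
  shows "T_word xs f = T_word ys f"
proof -
  have "T_word xs f = T_word ys f" if "finite A" "A \<subseteq> carrier W" "{x. f x \<noteq> 0} \<subseteq> A" for A f
    using that
  proof (induction A arbitrary: f rule: finite_induct)
    case empty
    then have "f = (\<lambda>x. 0)" by auto
    moreover have "T_word ss (\<lambda>x. 0) = (\<lambda>x. 0)" for ss
      using T_word_linear(1)[of ss 0 f] by simp
    ultimately show ?case by simp
  next
    case (insert y A)
    let ?g = "\<lambda>x. if x = y then 0 else f x"
    have "f = (\<lambda>x. ?g x + f y * delta y x)" by (auto simp: delta_def fun_eq_iff)
    then have "T_word ss f = T_word ss (\<lambda>x. ?g x + f y * delta y x)" for ss by (rule arg_cong)
    then have f: "T_word ss f = (\<lambda>x. T_word ss ?g x + f y * T_word ss (delta y) x)" for ss 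
      by (simp only: T_word_linear)
    have "T_word xs ?g = T_word ys ?g" using insert by (intro insert.IH) auto
    moreover have "T_word xs (delta y) = T_word ys (delta y)" 
      using insert by (intro T_word_cong_delta assms) auto
    ultimately show ?case unfolding f by simp
  qed
  then show ?thesis using assms(4) unfolding finsupp_def by blast
qed

text \<open>Up to a power of \<open>q\<close>, which can be cancelled, \<open>R_word\<close> inverts
  \<open>T_word\<close>, so it inherits independence of the word.\<close>

lemma R_word_cong:
  assumes "reduced xs" "reduced ys" "word_prod W xs = word_prod W ys"
  shows "R_word xs (delta \<one>) = R_word ys (delta \<one>)"
proof -
  let ?r = "\<lambda>ss. R_word ss (delta \<one>)" and ?n = "length xs"
  have S: "set xs \<subseteq> S" "set ys \<subseteq> S" and n: "length ys = ?n" using assms by (auto simp: reduced_def)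
  have fs: "finsupp (delta \<one>)" "finsupp (?r ys)" using finsupp_word S by simp_all
  have "(\<lambda>x. q ^ ?n * ?r ys x) = R_word xs (T_word xs (?r ys))"
    by (rule R_T_word[OF S(1) fs(2), symmetric])
  also have "T_word xs (?r ys) = T_word ys (?r ys)"
    by (rule T_word_cong[OF assms fs(2)])
  also have "\<dots> = (\<lambda>x. q ^ ?n * delta \<one> x)" 
    by (rule T_R_word[OF S(2) fs(1), unfolded n])
  also have "R_word xs \<dots> = (\<lambda>x. q ^ ?n * ?r xs x)" by (rule R_word_cmult)
  finally have "q ^ ?n * ?r ys x = q ^ ?n * ?r xs x" for x by (rule fun_cong)
  moreover have "q ^ ?n \<noteq> 0" by simp
  ultimately have "?r xs x = ?r ys x" for x by (metis mult_left_cancel)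
  then show ?thesis by blast
qed

text \<open>The existence witness for the definite description \<open>R_poly\<close>; the chosen
  reduced word is immaterial by \<open>R_word_cong\<close>.\<close>

definition R_fun :: "'a \<Rightarrow> 'a \<Rightarrow> int poly" where
  "R_fun x w = (if w \<in> carrier W 
     then R_word (SOME ss. reduced ss \<and> word_prod W ss = w) (delta \<one>) x else 0)"

lemma R_fun_word:
  assumes "reduced ss" shows "R_fun x (word_prod W ss) = R_word ss (delta \<one>) x"
proof -
  let ?t = "SOME xs. reduced xs \<and> word_prod W xs = word_prod W ss"
  have "reduced ?t \<and> word_prod W ?t = word_prod W ss" 
    by (rule someI[of "\<lambda>xs. reduced xs \<and> word_prod W xs = word_prod W ss" ss]) (simp add: assms)
  then have "R_word ?t (delta \<one>) = R_word ss (delta \<one>)" by (intro R_word_cong assms) auto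
  then show ?thesis using assms by (auto simp: R_fun_def reduced_def)
qed

lemma R_fun_one: "R_fun x \<one> = delta \<one> x"
  using R_fun_word[of "[]"] by (simp add: reduced_def)

lemma R_fun_step:
  assumes "w \<in> carrier W" "s \<in> S" "len (w \<otimes> s) < len w"
  shows "R_fun x w = R_op s (\<lambda>y. R_fun y (w \<otimes> s)) x"
proof -
  obtain ss where "set ss \<subseteq> S" "word_prod W ss = w \<otimes> s" "length ss = len (w \<otimes> s)"
    using ex_reduced_word[of "w \<otimes> s"] assms by auto
  then have ss: "reduced ss" "word_prod W ss = w \<otimes> s" by (auto simp: reduced_def)
  moreover have "reduced (ss @ [s])" using ss assms by (intro reduced_snoc) auto
  moreover have "word_prod W (ss @ [s]) = w" using ss assms by (simp add: reduced_def)
  ultimately show ?thesis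
    using R_fun_word[of "ss @ [s]" x] R_fun_word[of ss] by (simp add: R_word_def)
qed

lemma R_fun_support: "w \<in> carrier W \<Longrightarrow> R_fun x w \<noteq> 0 \<Longrightarrow> x \<le>\<^sub>B w"
proof (induction "len w" arbitrary: x w rule: less_induct)
  case less
  show ?case
  proof (cases "w = \<one>")
    case True
    then show ?thesis using less.prems by (simp add: R_fun_one delta_def split: if_splits)
  next
    case False
    then obtain s where s: "s \<in> S" "len w = Suc (len (w \<otimes> s))" 
      using ex_right_descent[OF less.prems(1)] by blast
    then have x: "x \<in> carrier W" and "R_fun (x \<otimes> s) (w \<otimes> s) \<noteq> 0 \<or> R_fun x (w \<otimes> s) \<noteq> 0"
      using less.prems R_fun_step[of w s x] by (auto simp: R_op_def split: if_splits)
    then have "x \<otimes> s \<le>\<^sub>B w \<otimes> s \<or> x \<le>\<^sub>B w \<otimes> s" using less.hyps[of "w \<otimes> s"] less.prems s by auto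
    moreover have "w \<otimes> s \<le>\<^sub>B w" using ble_mult_S[of "w \<otimes> s" s] less.prems s by simp
    ultimately have "x \<otimes> s \<le>\<^sub>B w \<or> x \<le>\<^sub>B w" using ble_trans by blast
    then show ?thesis using ble_descent_iff[of x w s] x less.prems s by auto
  qed
qed

lemma R_fun_self: "w \<in> carrier W \<Longrightarrow> R_fun w w = 1"
proof (induction "len w" arbitrary: w rule: less_induct)
  case less
  show ?case
  proof (cases "w = \<one>")
    case False
    then obtain s where s: "s \<in> S" "len w = Suc (len (w \<otimes> s))" 
      using ex_right_descent[OF less.prems(1)] by blast
    then show ?thesis using less R_fun_step[of w s w] by (simp add: R_op_def)
  qed (simp add: R_fun_one delta_def)
qed

lemma bruhat_less_mult_S_iff:
  assumes "x \<in> carrier W" "s \<in> S"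
  shows "bruhat_less W S (x \<otimes> s) x \<longleftrightarrow> len (x \<otimes> s) < len x" 
    and "bruhat_less W S x (x \<otimes> s) \<longleftrightarrow> len x < len (x \<otimes> s)"
  using ble_mult_S[of x s] ble_mult_S[of "x \<otimes> s" s] ble_len[of x "x \<otimes> s"] ble_len[of "x \<otimes> s" x]
    assms unfolding bruhat_less_def by auto

lemma is_R_family_R_fun: "is_R_family W S R_fun"
  unfolding is_R_family_def
proof (intro conjI allI ballI impI)
  fix u w assume "\<not> u \<le>\<^sub>B w"
  then show "R_fun u w = 0" using R_fun_support by (cases "w \<in> carrier W") (auto simp: R_fun_def)
qed (use mult_S_less_iff in \<open>auto simp: R_fun_self bruhat_less_mult_S_iff R_fun_step R_op_def\<close>)

lemma is_R_family_step:
  assumes "is_R_family W S R" "w \<in> carrier W" "s \<in> S" "len (w \<otimes> s) < len w" "x \<in> carrier W"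
  shows "R x w = R_op s (\<lambda>y. R y (w \<otimes> s)) x"
  using assms bruhat_less_mult_S_iff[of w s] bruhat_less_mult_S_iff[of x s] mult_S_less_iff[of x s] 
  unfolding is_R_family_def R_op_def by auto

lemma is_R_family_unique:
  assumes "is_R_family W S R" shows "R = R_fun"
proof (intro ext)
  fix x w
  have *: "x \<in> carrier W \<Longrightarrow> w \<in> carrier W \<Longrightarrow> R x w = R_fun x w"
  proof (induction "len w" arbitrary: x w rule: less_induct)
    case less
    show ?case
    proof (cases "w = \<one>")
      case True
      then show ?thesis using assms ble_one_iff[of x] unfolding is_R_family_def
        by (cases "x = \<one>") (simp_all add: R_fun_one delta_def)
    next
      case False
      then obtain s where s: "s \<in> S" "len w = Suc (len (w \<otimes> s))" 
        using ex_right_descent[OF less.prems(2)] by blast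
      then show ?thesis
        using less is_R_family_step[OF assms, of w s x] R_fun_step[of w s x] by (simp add: R_op_def)
    qed
  qed
  show "R x w = R_fun x w"
  proof (cases "x \<in> carrier W \<and> w \<in> carrier W")
    case False
    then have "\<not> x \<le>\<^sub>B w" using ble_carrier by blast
    then show ?thesis using assms is_R_family_R_fun unfolding is_R_family_def by simp
  qed (use * in blast)
qed

lemma is_R_family_R_poly: "is_R_family W S (R_poly W S)"
  unfolding R_poly_def
  by (rule theI[of "is_R_family W S" R_fun, OF is_R_family_R_fun is_R_family_unique])

lemma R_poly_step:
  assumes "w \<in> carrier W" "s \<in> S" "len (w \<otimes> s) < len w" "x \<in> carrier W"
  shows "len (x \<otimes> s) < len x \<Longrightarrow> R_poly W S x w = R_poly W S (x \<otimes> s) (w \<otimes> s)"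
    and "len x < len (x \<otimes> s) \<Longrightarrow> R_poly W S x w = 
      q * R_poly W S (x \<otimes> s) (w \<otimes> s) + (q - 1) * R_poly W S x (w \<otimes> s)"
  using is_R_family_step[OF is_R_family_R_poly assms] assms by (auto simp: R_op_def)

lemma R_poly_one: "x \<in> carrier W \<Longrightarrow> R_poly W S x \<one> = (if x = \<one> then 1 else 0)"
  using is_R_family_R_poly ble_one_iff[of x] unfolding is_R_family_def by auto

section \<open>Taylor coefficients at q = 1 and paths with two edges\<close>

definition between :: "'a \<Rightarrow> 'a \<Rightarrow> 'a set" where
  "between x w = {y. x \<rightarrow>\<^sub>B y \<and> y \<rightarrow>\<^sub>B w}"

lemma finite_between: "finite (between x w)"
  unfolding between_def by (rule finite_subset[OF _ finite_edge_into[of w]]) auto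

lemma card_between_split:
  assumes "a \<noteq> b"
  shows "card (between x w) = card (between x w - {a, b}) 
    + of_bool (x \<rightarrow>\<^sub>B a \<and> a \<rightarrow>\<^sub>B w) + of_bool (x \<rightarrow>\<^sub>B b \<and> b \<rightarrow>\<^sub>B w)"
proof -
  have "card (between x w) = card (between x w \<inter> {a, b}) + card (between x w - {a, b})"
    by (rule card_Int_Diff[OF finite_between])
  moreover have "between x w \<inter> {a, b} = (if a \<in> between x w then {a} else {}) \<union> (if b \<in> between x w then {b} else {})"
    by auto
  then have "card (between x w \<inter> {a, b}) = of_bool (a \<in> between x w) + of_bool (b \<in> between x w)"
    using assms by auto
  ultimately show ?thesis by (simp add: between_def)
qed

text \<open>Shifting the whole path by \<open>s\<close> preserves both edges unless one of them is
  labelled \<open>s\<close>. The removed midpoints are exactly those incident with such an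
  edge.\<close>

lemma between_shift:
  assumes "x \<in> carrier W" "w \<in> carrier W" "s \<in> S"
  shows "between (x \<otimes> s) (w \<otimes> s) - {x, w} = (\<lambda>y. y \<otimes> s) ` (between x w - {x \<otimes> s, w \<otimes> s})"
proof -
  have sub: "(\<lambda>y. y \<otimes> s) ` (between x w - {x \<otimes> s, w \<otimes> s}) \<subseteq> between (x \<otimes> s) (w \<otimes> s) - {x, w}"
    if "x \<in> carrier W" "w \<in> carrier W" for x w
  proof (intro subsetI, elim imageE)
    fix z y assume z: "z = y \<otimes> s" and y: "y \<in> between x w - {x \<otimes> s, w \<otimes> s}"
    then have e: "x \<rightarrow>\<^sub>B y" "y \<rightarrow>\<^sub>B w" "y \<noteq> x \<otimes> s" "y \<noteq> w \<otimes> s" by (auto simp: between_def)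
    then have yc: "y \<in> carrier W" using edge_carrier by blast
    have "w \<noteq> y \<otimes> s" "x \<noteq> y \<otimes> s" using e(3,4) yc assms that by auto
    with e z show "z \<in> between (x \<otimes> s) (w \<otimes> s) - {x, w}"
      using edge_shift[OF e(1) assms(3)] edge_shift[OF e(2) assms(3)] by (simp add: between_def)
  qed
  have "y \<otimes> s \<otimes> s = y" if "y \<in> between (x \<otimes> s) (w \<otimes> s)" for y
    using that assms edge_carrier(2)[of "x \<otimes> s" y] by (simp add: between_def)
  then have "between (x \<otimes> s) (w \<otimes> s) - {x, w} = (\<lambda>y. y \<otimes> s) ` (\<lambda>y. y \<otimes> s) ` (between (x \<otimes> s) (w \<otimes> s) - {x, w})"
    by (simp add: image_image cong: image_cong_simp)
  also have "\<dots> \<subseteq> (\<lambda>y. y \<otimes> s) ` (between x w - {x \<otimes> s, w \<otimes> s})"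
    using sub[of "x \<otimes> s" "w \<otimes> s"] assms by (intro image_mono) simp
  finally show ?thesis using sub[OF assms(1,2)] by blast
qed

lemma card_between_shift:
  assumes "x \<in> carrier W" "w \<in> carrier W" "s \<in> S"
  shows "card (between (x \<otimes> s) (w \<otimes> s) - {x, w}) = card (between x w - {x \<otimes> s, w \<otimes> s})"
proof -
  have "inj_on (\<lambda>y. y \<otimes> s) (between x w - {x \<otimes> s, w \<otimes> s})"
    using assms edge_carrier(1) by (intro inj_onI) (auto simp: between_def)
  then show ?thesis unfolding between_shift[OF assms] by (rule card_image)
qed

text \<open>Both sides obey the same recursion, because \<open>y \<mapsto> ys\<close> preserves all Bruhat edges other than those 
  labelled \<open>s\<close>.\<close>

lemma R_poly_Taylor:
  assumes "x \<in> carrier W" "w \<in> carrier W"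
  shows "poly (R_poly W S x w) 1 = of_bool (x = w) \<and>
    poly (pderiv (R_poly W S x w)) 1 = of_bool (x \<rightarrow>\<^sub>B w) \<and>
    poly (pderiv (pderiv (R_poly W S x w))) 1 =
      (int (len w) - int (len x) - 1) * of_bool (x \<rightarrow>\<^sub>B w) + int (card (between x w))"
  using assms
proof (induction "len w" arbitrary: x w rule: less_induct)
  case less
  note c = less.prems
  show ?case
  proof (cases "w = \<one>")
    case True
    have "\<not> y \<rightarrow>\<^sub>B \<one>" for y using edge_len by fastforce
    then show ?thesis using True R_poly_one[OF c(1)] by (simp add: between_def)
  next
    case False
    then obtain s where s: "s \<in> S" "len w = Suc (len (w \<otimes> s))" 
      using ex_right_descent[OF c(2)] by blast
    have lt: "len (w \<otimes> s) < len w" using s by simp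
    have wc: "w \<otimes> s \<in> carrier W" "x \<otimes> s \<in> carrier W" using c s by auto
    note IH = less.hyps[OF lt wc(2,1)] and IH' = less.hyps[OF lt c(1) wc(1)]
    have ws: "w \<otimes> s \<rightarrow>\<^sub>B w" "\<not> w \<rightarrow>\<^sub>B w \<otimes> s" 
      using edge_S_down_iff[OF c(2) s(1)] edge_S_iff[OF c(2) s(1)] s by auto
    have eq_iff: "x \<otimes> s = w \<otimes> s \<longleftrightarrow> x = w" using c s by auto
    \<comment> \<open>The exceptional midpoints are distinct only for \<open>x \<noteq> w\<close>.
      The edge from \<open>w s\<close> to \<open>w\<close> is always present and its reverse never,
      which simplifies the corrections.\<close>
    have split: 
      "card (between x w) = card (between x w - {x \<otimes> s, w \<otimes> s}) 
         + of_bool (x \<rightarrow>\<^sub>B x \<otimes> s \<and> x \<otimes> s \<rightarrow>\<^sub>B w) + of_bool (x \<rightarrow>\<^sub>B w \<otimes> s)"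
      "card (between (x \<otimes> s) (w \<otimes> s)) = card (between x w - {x \<otimes> s, w \<otimes> s}) 
         + of_bool (x \<otimes> s \<rightarrow>\<^sub>B x \<and> x \<rightarrow>\<^sub>B w \<otimes> s)" if "x \<noteq> w"
      using card_between_split[of "x \<otimes> s" "w \<otimes> s" x w] card_between_split[of x w "x \<otimes> s" "w \<otimes> s"]
        that eq_iff card_between_shift[OF c s(1)] ws by auto
    from c(1) s(1) show ?thesis
    proof (cases rule: len_mult_S_cases)
      case 2
      have x: "x \<otimes> s \<rightarrow>\<^sub>B x" "\<not> x \<rightarrow>\<^sub>B x \<otimes> s" 
        using edge_S_down_iff[OF c(1) s(1)] edge_S_iff[OF c(1) s(1)] 2 by auto
      have "w \<noteq> x \<otimes> s" using 2 s c by auto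
      then have e: "x \<otimes> s \<rightarrow>\<^sub>B w \<otimes> s \<longleftrightarrow> x \<rightarrow>\<^sub>B w" using edge_shift_iff[OF c s(1)] by simp
      have "y \<rightarrow>\<^sub>B z \<Longrightarrow> \<not> z \<rightarrow>\<^sub>B y" for y z by (rule edge_asym)
      then have "between y y = {}" for y by (auto simp: between_def)
      then have "card (between x w) = card (between (x \<otimes> s) (w \<otimes> s))"
        using split x by (cases "x = w") auto
      moreover have "R_poly W S x w = R_poly W S (x \<otimes> s) (w \<otimes> s)"
        using R_poly_step(1)[OF c(2) s(1) lt c(1)] 2 by simp
      ultimately show ?thesis using IH e eq_iff 2 s by simp
    next
      case 1
      have x: "x \<rightarrow>\<^sub>B x \<otimes> s" "\<not> x \<otimes> s \<rightarrow>\<^sub>B x" 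
        using edge_S_down_iff[OF c(1) s(1)] edge_S_iff[OF c(1) s(1)] 1 by auto
      have "x \<noteq> w" using 1 s by auto
      then have e: "x \<otimes> s \<rightarrow>\<^sub>B w \<longleftrightarrow> x \<rightarrow>\<^sub>B w \<otimes> s" using edge_shift_down_iff c s by blast
      let ?A = "R_poly W S (x \<otimes> s) (w \<otimes> s)" and ?B = "R_poly W S x (w \<otimes> s)"
      have R: "R_poly W S x w = q * ?A + (q - 1) * ?B"
        using R_poly_step(2)[OF c(2) s(1) lt c(1)] 1 by simp
      have d: "pderiv (R_poly W S x w) = ?A + q * pderiv ?A + ?B + (q - 1) * pderiv ?B"
        unfolding R by (simp add: pderiv_mult pderiv_add pderiv_diff pderiv_pCons algebra_simps)
      have dd: "pderiv (pderiv (R_poly W S x w)) = 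
        2 * pderiv ?A + q * pderiv (pderiv ?A) + 2 * pderiv ?B + (q - 1) * pderiv (pderiv ?B)"
        unfolding d by (simp add: pderiv_mult pderiv_add pderiv_diff pderiv_pCons algebra_simps)
      have v: "poly (R_poly W S x w) 1 = poly ?A 1"
        "poly (pderiv (R_poly W S x w)) 1 = poly ?A 1 + poly (pderiv ?A) 1 + poly ?B 1"
        "poly (pderiv (pderiv (R_poly W S x w))) 1 = 
           2 * poly (pderiv ?A) 1 + poly (pderiv (pderiv ?A)) 1 + 2 * poly (pderiv ?B) 1"
        by (simp add: R, simp add: d, simp add: dd)
      have irr: "\<not> x \<rightarrow>\<^sub>B x" using edge_neq by blast
      show ?thesis
      proof (cases "w = x \<otimes> s")
        \<comment> \<open>Now \<open>w s = x\<close>, so the recursion meets the diagonal value of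
          \<open>R\<close>, and this is where the edge from \<open>x\<close> to \<open>w\<close> is
          created.\<close>
        case True
        then have "w \<otimes> s = x" using c s by simp
        then show ?thesis unfolding v
          using True IH IH' split[OF \<open>x \<noteq> w\<close>] x e \<open>x \<noteq> w\<close> 1 s irr by simp
      next
        case False
        then have "x \<noteq> w \<otimes> s" using c s by (auto simp: mult_S_eq_iff)
        moreover have "x \<otimes> s \<rightarrow>\<^sub>B w \<otimes> s \<longleftrightarrow> x \<rightarrow>\<^sub>B w" using edge_shift_iff[OF c s(1) False] .
        ultimately show ?thesis unfolding v
          using IH IH' split[OF \<open>x \<noteq> w\<close>] x e \<open>x \<noteq> w\<close> 1 s eq_iff by (simp add: algebra_simps)
      qed
    qed
  qed
qed

section \<open>Coefficients of the nil Hecke basis\<close>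

text \<open>Roots are evaluated in the ordered field \<open>\<real>(z)\<close>, in which \<open>z\<close> is infinitely large: the \<open>z\<close>-coefficient 
  is the height, so positive roots have positive values, while the choice of the constant coefficients 
  \<open>a\<close> is free.\<close>

definition evp :: "('a option \<Rightarrow> real) \<Rightarrow> 'a option vec \<Rightarrow> real poly" where
  "evp a x = [:lin a x, form rho x:]"

definition ev :: "('a option \<Rightarrow> real) \<Rightarrow> 'a option vec \<Rightarrow> real poly fract" where
  "ev a x = Fract (evp a x) 1"

definition const :: "real \<Rightarrow> real poly fract" where
  "const c = Fract [:c:] 1"

lemma ev_linear [simp]:
  "ev a (x + y) = ev a x + ev a y" "ev a (x - y) = ev a x - ev a y" "ev a (- x) = - ev a x"
  "ev a (c \<cdot> x) = const c * ev a x"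
  by (simp_all add: ev_def evp_def const_def mult.commute)

lemma const_pos: "0 < c \<Longrightarrow> 0 < const c"
  by (simp add: const_def zero_less_Fract_iff less_poly_def pos_poly_def)

text \<open>Pairing a root with \<rho> adds up its simple-root coordinates, which gives its
  height.\<close>

lemma form_rho_root_pos:
  assumes "t \<in> refls" shows "0 < form rho (root_of t)"
proof -
  let ?b = "root_of t"
  have eq: "form rho ?b = (\<Sum>i\<in>Poly_Mapping.keys ?b. gram None i * Poly_Mapping.lookup ?b i)"
    by (simp add: form_def rho_def) (simp add: lin_def)
  have "gram None i * Poly_Mapping.lookup ?b i > 0" if "i \<in> Poly_Mapping.keys ?b" for i
  proof -
    have "Poly_Mapping.lookup ?b i \<noteq> 0" using that by (simp add: in_keys_iff)
    moreover from this have "i \<noteq> None" using assms by (metis lookup_root_of_None)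
    moreover have "0 \<le> Poly_Mapping.lookup ?b i" using root_of_nonneg[OF assms] by (simp add: nonneg_def)
    ultimately show ?thesis by (auto simp: gram_def)
  qed
  moreover have "Poly_Mapping.keys ?b \<noteq> {}" using root_of_neq_0[OF assms] by simp
  ultimately show ?thesis unfolding eq by (intro sum_pos) auto
qed

text \<open>The order on the fractions is decided by leading coefficients, and here the leading
  coefficient is the height.\<close>

lemma ev_root_pos: "t \<in> refls \<Longrightarrow> 0 < ev a (root_of t)"
  using form_rho_root_pos[of t]
  by (simp add: ev_def evp_def zero_less_Fract_iff less_poly_def pos_poly_def)

lemma act_simple_root_cases:
  assumes "v \<in> carrier W" "s \<in> S"
  obtains "act v (simple_root s) = root_of (v \<otimes> s \<otimes> inv v)"
    | "act v (simple_root s) = - root_of (v \<otimes> s \<otimes> inv v)"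
proof -
  have "act v (root_of s) = root_of (v \<otimes> s \<otimes> inv v) \<or> act v (root_of s) = - root_of (v \<otimes> s \<otimes> inv v)"
    using act_root_of_nonneg[OF S_refls[OF assms(2)] assms(1)]
      act_root_of_nonpos[OF S_refls[OF assms(2)] assms(1)]
      act_root_of_sign[OF S_refls[OF assms(2)] assms(1)] by argo
  then show ?thesis unfolding root_of_S[OF assms(2)] using that by argo
qed

lemma ev_simple_root_neq_0:
  assumes "v \<in> carrier W" "s \<in> S" shows "ev a (act v (simple_root s)) \<noteq> 0"
proof -
  have "0 < ev a (root_of (v \<otimes> s \<otimes> inv v))" using assms by (intro ev_root_pos reflsI)
  then show ?thesis by (cases rule: act_simple_root_cases[OF assms]) auto
qed

lemma act_mult_S_simple_root:
  assumes "v \<in> carrier W" "s \<in> S" 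
  shows "act (v \<otimes> s) (simple_root s) = - act v (simple_root s)"
  using assms by (simp add: act_mult act_S reflect_self)

lemma reduced_prefix:
  assumes "reduced (xs @ ys)" shows "reduced xs"
proof -
  have "len (word_prod W (xs @ ys)) \<le> len (word_prod W xs) + len (word_prod W ys)"
    using assms len_mult_le[of "word_prod W xs" "word_prod W ys"] by (auto simp: reduced_def)
  then show ?thesis using assms len_le_length[of xs] len_le_length[of ys] by (auto simp: reduced_def)
qed

text \<open>The words are read from right to left; up to signs \<open>h_word\<close> lists the coefficients of a basis 
  element \<open>x\<^sub>w\<close> of the nil Hecke ring with respect to the group elements.\<close>

fun h_word :: "('a option \<Rightarrow> real) \<Rightarrow> 'a list \<Rightarrow> 'a \<Rightarrow> real poly fract" where
  "h_word a [] v = (if v = \<one> then 1 else 0)"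
| "h_word a (s # ss) v = (h_word a ss v - h_word a ss (v \<otimes> s)) / ev a (act v (simple_root s))"

definition rword :: "'a list \<Rightarrow> 'a" where
  "rword ss = word_prod W (rev ss)"

definition rreduced :: "'a list \<Rightarrow> bool" where
  "rreduced ss \<longleftrightarrow> reduced (rev ss)"

lemma rword_Nil [simp]: "rword [] = \<one>"
  by (simp add: rword_def)

lemma rreduced_ConsD:
  assumes "rreduced (s # ss)"
  shows "s \<in> S" "rreduced ss" "rword ss \<in> carrier W" "rword (s # ss) = rword ss \<otimes> s" 
    "len (rword (s # ss)) = Suc (len (rword ss))"
proof -
  have r: "reduced (rev ss @ [s])" using assms by (simp add: rreduced_def)
  then show S: "s \<in> S" by (simp add: reduced_def)
  show r': "rreduced ss" using reduced_prefix[OF r] by (simp add: rreduced_def)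
  then show c: "rword ss \<in> carrier W" by (auto simp: rreduced_def reduced_def rword_def)
  show e: "rword (s # ss) = rword ss \<otimes> s" using r by (auto simp: reduced_def rword_def)
  show "len (rword (s # ss)) = Suc (len (rword ss))" 
    using assms r' by (simp only: rreduced_def reduced_def rword_def length_rev list.size)
qed

lemma rreduced_ConsI:
  assumes "rreduced ss" "s \<in> S" "rword ss = w \<otimes> s" "w \<in> carrier W" "len (w \<otimes> s) < len w"
  shows "rreduced (s # ss)" "rword (s # ss) = w"
  using reduced_snoc[of "rev ss" s] assms by (auto simp: rreduced_def reduced_def rword_def)

lemma rword_closed: "rreduced ss \<Longrightarrow> rword ss \<in> carrier W"
  by (auto simp: rreduced_def reduced_def rword_def)

lemma ex_rreduced:
  assumes "w \<in> carrier W" obtains ss where "rreduced ss" "rword ss = w"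
proof -
  obtain ss where "set ss \<subseteq> S" "word_prod W ss = w" "length ss = len w" 
    using ex_reduced_word[OF assms] .
  then show ?thesis using that[of "rev ss"] by (simp add: rreduced_def rword_def reduced_def)
qed

lemma h_word_support:
  "\<lbrakk>rreduced ss; v \<in> carrier W; h_word a ss v \<noteq> 0\<rbrakk> \<Longrightarrow> v \<le>\<^sub>B rword ss"
proof (induction ss arbitrary: v)
  case (Cons s ss)
  note r = rreduced_ConsD[OF Cons.prems(1)]
  let ?w = "rword (s # ss)"
  have wc: "?w \<in> carrier W" using Cons.prems rword_closed by blast
  have vs: "v \<otimes> s \<in> carrier W" using Cons.prems(2) r(1) by simp
  have "h_word a ss v \<noteq> 0 \<or> h_word a ss (v \<otimes> s) \<noteq> 0" using Cons.prems(3) by auto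
  then have "v \<le>\<^sub>B rword ss \<or> v \<otimes> s \<le>\<^sub>B rword ss" 
    using Cons.IH[OF r(2) Cons.prems(2)] Cons.IH[OF r(2) vs] by argo
  moreover have "rword ss \<le>\<^sub>B ?w" using ble_mult_S[OF r(3,1)] r(4,5) by simp
  ultimately have "v \<le>\<^sub>B ?w \<or> v \<otimes> s \<le>\<^sub>B ?w" using ble_trans by blast
  moreover have "len (?w \<otimes> s) < len ?w" using r by simp
  ultimately show ?case using ble_descent_iff[OF Cons.prems(2) wc r(1)] by argo
qed (simp split: if_splits)

text \<open>At the top only one of the two terms of the recursion survives, and its sign cancels
  that of the root. The product depends on the group element alone, which is the diagonal case of
  independence of the word.\<close>

lemma h_word_self:
  "rreduced ss \<Longrightarrow> 
   h_word a ss (rword ss) = (\<Prod>v\<in>{v. v \<rightarrow>\<^sub>B rword ss}. 1 / ev a (root_of (v \<otimes> inv (rword ss))))"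
proof (induction ss)
  case Nil
  have "{v. v \<rightarrow>\<^sub>B \<one>} = {}" using edge_len by fastforce
  then show ?case by simp
next
  case (Cons s ss)
  note r = rreduced_ConsD[OF Cons.prems]
  let ?w = "rword (s # ss)" and ?w' = "rword ss"
  let ?f = "\<lambda>w v. 1 / ev a (root_of (v \<otimes> inv w))"
  have "\<not> ?w \<le>\<^sub>B ?w'" using ble_len_le r(5) by fastforce
  then have "h_word a ss ?w = 0" using h_word_support[OF r(2), of ?w] rword_closed[OF Cons.prems] by blast
  moreover have wc: "?w \<in> carrier W" using Cons.prems by (rule rword_closed)
  moreover have "act ?w' (simple_root s) = root_of (?w' \<otimes> s \<otimes> inv ?w')"
    using root_nonneg[of ?w' s] r act_root_of_nonneg[of s ?w'] by simp
  moreover have inv: "inv ?w = s \<otimes> inv ?w'" using r by (simp add: inv_mult_group)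
  ultimately have "h_word a (s # ss) ?w = h_word a ss ?w' * ?f ?w ?w'"
    using r(1,3) act_mult_S_simple_root[of ?w' s] by (simp add: r(4) m_assoc)
  moreover have "{v. v \<rightarrow>\<^sub>B ?w} = insert ?w' ((\<lambda>v. v \<otimes> s) ` {v. v \<rightarrow>\<^sub>B ?w'})"
    using edge_into_mult_S[OF r(3,1)] r(4,5) by simp
  moreover have "?w' \<notin> (\<lambda>v. v \<otimes> s) ` {v. v \<rightarrow>\<^sub>B ?w'}"
  proof
    assume "?w' \<in> (\<lambda>v. v \<otimes> s) ` {v. v \<rightarrow>\<^sub>B ?w'}"
    then obtain v where v: "?w' = v \<otimes> s" "v \<rightarrow>\<^sub>B ?w'" by auto
    then have "?w = v" using r edge_carrier(1)[OF v(2)] by simp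
    then show False using edge_len[OF v(2)] r(5) by simp
  qed
  moreover have "(\<Prod>v\<in>(\<lambda>v. v \<otimes> s) ` {v. v \<rightarrow>\<^sub>B ?w'}. ?f ?w v) = (\<Prod>v\<in>{v. v \<rightarrow>\<^sub>B ?w'}. ?f ?w' v)"
  proof (rule prod.reindex_cong)
    show "inj_on (\<lambda>v. v \<otimes> s) {v. v \<rightarrow>\<^sub>B ?w'}"
      using r(1) edge_carrier(1) by (intro inj_onI) auto
    fix v assume "v \<in> {v. v \<rightarrow>\<^sub>B ?w'}"
    then have "v \<in> carrier W" using edge_carrier by blast
    then have "v \<otimes> s \<otimes> inv ?w = v \<otimes> inv ?w'" using r inv by (simp add: m_assoc)
    then show "?f ?w (v \<otimes> s) = ?f ?w' v" by simp
  qed simp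
  ultimately show ?case using Cons.IH[OF r(2)] finite_edge_into[of ?w'] by simp
qed

text \<open>The choice of the reduced word is shown to be immaterial in
  \<open>chevalley_h\<close>.\<close>

definition h :: "('a option \<Rightarrow> real) \<Rightarrow> 'a \<Rightarrow> 'a \<Rightarrow> real poly fract" where
  "h a w v = h_word a (SOME ss. rreduced ss \<and> rword ss = w) v"

lemma h_word_SOME:
  assumes "w \<in> carrier W" 
  obtains ss where "rreduced ss" "rword ss = w" "h a w = h_word a ss"
proof -
  obtain ss where "rreduced ss \<and> rword ss = w" using ex_rreduced[OF assms] by blast
  then have "rreduced (SOME ss. rreduced ss \<and> rword ss = w) \<and> rword (SOME ss. rreduced ss \<and> rword ss = w) = w"
    by (rule someI)
  then show ?thesis by (intro that) (auto simp: h_def)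
qed

section \<open>Chevalley's formula and positivity\<close>

definition covers :: "'a \<Rightarrow> 'a set" where
  "covers w = {u. u \<rightarrow>\<^sub>B w \<and> len w = Suc (len u)}"

lemma finite_covers: "finite (covers w)"
  unfolding covers_def by (rule finite_subset[OF _ finite_edge_into[of w]]) auto

text \<open>Among the edges into \<open>w s\<close>, those of length difference one come from covers
  of \<open>w\<close> at which \<open>s\<close> is an ascent, besides the edge from \<open>w\<close>
  itself.\<close>

lemma covers_mult_S:
  assumes "w \<in> carrier W" "s \<in> S" "len w < len (w \<otimes> s)"
  shows "covers (w \<otimes> s) = insert w ((\<lambda>u. u \<otimes> s) ` {u \<in> covers w. len u < len (u \<otimes> s)})"
proof -
  have ws: "len (w \<otimes> s) = Suc (len w)" using assms by (cases rule: len_mult_S_cases[of w s]) auto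
  have "len (u \<otimes> s) = len w \<longleftrightarrow> len w = Suc (len u) \<and> len u < len (u \<otimes> s)" if "u \<rightarrow>\<^sub>B w" for u
    using edge_len[OF that] by (cases rule: len_mult_S_cases[OF edge_carrier(1)[OF that] assms(2)]) auto
  then have iff: "{u. u \<rightarrow>\<^sub>B w \<and> len (u \<otimes> s) = len w} = {u \<in> covers w. len u < len (u \<otimes> s)}"
    unfolding covers_def by blast
  have "covers (w \<otimes> s) = {x \<in> {x. x \<rightarrow>\<^sub>B w \<otimes> s}. len x = len w}"
    using ws unfolding covers_def by auto
  also have "\<dots> = insert w ((\<lambda>u. u \<otimes> s) ` {u. u \<rightarrow>\<^sub>B w \<and> len (u \<otimes> s) = len w})"
    unfolding edge_into_mult_S[OF assms] by auto
  finally show ?thesis unfolding iff .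
qed

text \<open>This is the commutation relation between \<open>x\<^sub>w\<close> and the linear form \<open>\<lambda>\<close> in the nil Hecke ring (Chevalley's
  formula). For \<open>\<lambda> = \<rho>\<close> it determines \<open>h w v\<close> (\<open>v \<noteq> w\<close>) from smaller \<open>w\<close>, which gives independence of the 
  reduced word and positivity. The general \<open>\<lambda>\<close> is needed for the induction, as the step for \<open>\<lambda>\<close> 
  uses \<open>s\<lambda>\<close>.\<close>

definition chevalley :: "('a option \<Rightarrow> real) \<Rightarrow> 'a \<Rightarrow> ('a \<Rightarrow> real poly fract) \<Rightarrow> bool" where
  "chevalley a w f \<longleftrightarrow> (\<forall>l. \<forall>v\<in>carrier W. ev a (act v l - act w l) * f v = 
     (\<Sum>u\<in>covers w. const (form l (root_of (inv u \<otimes> w))) * h a u v))"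

lemma edge_refl_inv: 
  assumes "u \<rightarrow>\<^sub>B w" shows "inv u \<otimes> w \<in> refls"
  using assms by (elim edgeE) (simp flip: m_assoc)

text \<open>An edge from \<open>v\<close> to \<open>v t\<close> contributes the height of the root
  of \<open>t\<close> times a positive root, and contributions add along a chain. So the factor on
  the left of Chevalley's formula for \<rho> can be cancelled.\<close>

lemma ev_rho_pos:
  assumes "v \<le>\<^sub>B w" "v \<noteq> w" shows "0 < ev a (act v rho - act w rho)"
proof -
  have step: "0 < ev a (act v rho - act w rho)" if e: "v \<rightarrow>\<^sub>B w" for v w
  proof -
    from e obtain t where t: "v \<in> carrier W" "t \<in> refls" "w = v \<otimes> t" "len v < len (v \<otimes> t)"
      by (rule edgeE)
    have "act v (root_of t) = root_of (v \<otimes> t \<otimes> inv v)"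
      using t len_refl_less_iff act_root_of_nonneg by blast
    then have "0 < ev a (act v (root_of t))" using ev_root_pos refls_conj t by metis
    moreover have "act v rho - act w rho = form rho (root_of t) \<cdot> act v (root_of t)"
      using t by (simp add: act_mult act_refls reflect_def)
    ultimately show ?thesis using const_pos form_rho_root_pos[OF t(2)] by (simp del: ev_linear(2))
  qed
  from assms(1) have "v = w \<or> 0 < ev a (act v rho - act w rho)"
  proof (induction rule: ble_induct)
    case (step y z)
    then show ?case using \<open>\<And>v w. v \<rightarrow>\<^sub>B w \<Longrightarrow> 0 < ev a (act v rho - act w rho)\<close>[of y z] by auto
  qed simp
  with assms(2) show ?thesis by simp
qed

text \<open>Once the value is independent of the word, a reduced word of \<open>u\<close> whose
  product ends in \<open>s\<close> may be used.\<close>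

lemma h_descent:
  assumes indep: "\<And>ss. rreduced ss \<Longrightarrow> rword ss = u \<Longrightarrow> \<forall>v\<in>carrier W. h_word a ss v = h a u v"
    and u: "u \<in> carrier W" "s \<in> S" "len (u \<otimes> s) < len u" and v: "v \<in> carrier W"
  shows "h a u v = (h a (u \<otimes> s) v - h a (u \<otimes> s) (v \<otimes> s)) / ev a (act v (simple_root s))"
proof -
  have "u \<otimes> s \<in> carrier W" using u by simp
  then obtain ss where ss: "rreduced ss" "rword ss = u \<otimes> s" "h a (u \<otimes> s) = h_word a ss"
    by (rule h_word_SOME)
  have "h_word a (s # ss) v = h a u v"
    using indep[OF rreduced_ConsI[OF ss(1) u(2) ss(2) u(1,3)]] v by simp
  then show ?thesis using ss(3) by simp
qed

text \<open>With \<open>w = w' s\<close>, the formula for \<open>w'\<close> and the vector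
  \<open>s l\<close> is used at both \<open>v\<close> and \<open>v s\<close>. The discrepancy
  between the two left factors produces the cover \<open>w'\<close> of \<open>w\<close>; a cover
  \<open>u\<close> of \<open>w'\<close> contributes the cover \<open>u s\<close> if \<open>s\<close>
  is an ascent of \<open>u\<close>, and nothing otherwise.\<close>

lemma chevalley_step:
  assumes IH: "\<And>u. \<lbrakk>u \<in> carrier W; len u \<le> len w'\<rbrakk> \<Longrightarrow> chevalley a u (h a u) \<and> 
      (\<forall>ss. rreduced ss \<longrightarrow> rword ss = u \<longrightarrow> (\<forall>v\<in>carrier W. h_word a ss v = h a u v))"
    and red: "rreduced (s # ss)" and w': "w' = rword ss" and w: "w = rword (s # ss)"
  shows "chevalley a w (h_word a (s # ss))"
  unfolding chevalley_def
proof (intro allI ballI)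
  fix l v assume v: "v \<in> carrier W"
  note r = rreduced_ConsD[OF red, folded w w']
  let ?e = "ev a (act v (simple_root s))" and ?X = "ev a (act v l - act w l)"
  let ?l = "act s l" and ?c = "const (form l (simple_root s))"
  let ?k = "\<lambda>u. const (form ?l (root_of (inv u \<otimes> w')))"
  have e: "?e \<noteq> 0" using v r by (intro ev_simple_root_neq_0)
  have vs: "v \<otimes> s \<in> carrier W" using v r by simp
  have chev: "chevalley a w' (h a w')" and hw': "\<forall>v\<in>carrier W. h_word a ss v = h a w' v"
    using IH[OF r(3) order_refl] r(2) w' by auto
  have l: "act w' ?l = act w l" "act (v \<otimes> s) ?l = act v l" 
    "act v ?l = act v l - form l (simple_root s) \<cdot> act v (simple_root s)"
  proof -
    show "act w' ?l = act w l" unfolding r(4) using r by (simp add: act_mult)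
    show "act (v \<otimes> s) ?l = act v l" using r v by (simp add: act_mult act_S reflect_reflect)
    show "act v ?l = act v l - form l (simple_root s) \<cdot> act v (simple_root s)"
      using r by (simp add: act_S reflect_def)
  qed
  have 1: "(?X - ?c * ?e) * h a w' v = (\<Sum>u\<in>covers w'. ?k u * h a u v)"
    using chev[unfolded chevalley_def, rule_format, OF v, of ?l] unfolding l by (simp add: algebra_simps)
  have 2: "?X * h a w' (v \<otimes> s) = (\<Sum>u\<in>covers w'. ?k u * h a u (v \<otimes> s))"
    using chev[unfolded chevalley_def, rule_format, OF vs, of ?l] unfolding l by simp
  have "?X * (h a w' v - h a w' (v \<otimes> s)) = 
     ?c * ?e * h a w' v + (\<Sum>u\<in>covers w'. ?k u * (h a u v - h a u (v \<otimes> s)))"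
    using 1 2 by (simp add: algebra_simps sum_subtractf)
  then have "?X * h_word a (s # ss) v = 
     (?c * ?e * h a w' v + (\<Sum>u\<in>covers w'. ?k u * (h a u v - h a u (v \<otimes> s)))) / ?e"
    using hw' v vs by (simp del: ev_linear)
  also have "\<dots> = ?c * h a w' v + (\<Sum>u\<in>covers w'. ?k u * ((h a u v - h a u (v \<otimes> s)) / ?e))"
    using e by (simp add: add_divide_distrib sum_divide_distrib)
  also have "(\<Sum>u\<in>covers w'. ?k u * ((h a u v - h a u (v \<otimes> s)) / ?e)) =
     (\<Sum>u\<in>{u \<in> covers w'. len u < len (u \<otimes> s)}. ?k u * h a (u \<otimes> s) v)"
  proof (rule sum.mono_neutral_cong_right)
    show "finite (covers w')" by (rule finite_covers)
    show "{u \<in> covers w'. len u < len (u \<otimes> s)} \<subseteq> covers w'" by blast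
    show "\<forall>u\<in>covers w' - {u \<in> covers w'. len u < len (u \<otimes> s)}. ?k u * ((h a u v - h a u (v \<otimes> s)) / ?e) = 0"
    proof
      fix u assume u: "u \<in> covers w' - {u \<in> covers w'. len u < len (u \<otimes> s)}"
      then have uc: "u \<in> carrier W" "len u \<le> len w'" using edge_carrier by (auto simp: covers_def)
      have us: "len (u \<otimes> s) < len u" using u mult_S_less_iff[OF uc(1) r(1)] by auto
      have desc: "h a u x = (h a (u \<otimes> s) x - h a (u \<otimes> s) (x \<otimes> s)) / ev a (act x (simple_root s))" 
        if "x \<in> carrier W" for x
        by (rule h_descent[OF _ uc(1) r(1) us that]) (simp add: IH[OF uc])
      \<comment> \<open>Passing from \<open>v\<close> to \<open>v s\<close> changes the sign of both
        numerator and denominator, so \<open>h a u\<close> takes equal values there and the term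
        drops out.\<close>
      have "h a u (v \<otimes> s) = (h a (u \<otimes> s) (v \<otimes> s) - h a (u \<otimes> s) v) / (- ?e)"
        using desc[OF vs] unfolding act_mult_S_simple_root[OF v r(1)] S_cancel_right[OF v r(1)] by simp
      also have "\<dots> = h a u v"
        unfolding desc[OF v] by (metis minus_diff_eq minus_divide_divide)
      finally have "h a u v = h a u (v \<otimes> s)" by (rule sym)
      then show "?k u * ((h a u v - h a u (v \<otimes> s)) / ?e) = 0" by simp
    qed
    fix u assume u: "u \<in> {u \<in> covers w'. len u < len (u \<otimes> s)}"
    then have uc: "u \<in> carrier W" using edge_carrier by (auto simp: covers_def)
    \<comment> \<open>A cover of \<open>w'\<close> is shorter by one, so \<open>u s\<close> is still
      within reach of the hypothesis.\<close>
    have us: "len (u \<otimes> s) \<le> len w'" 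
      using u by (cases rule: len_mult_S_cases[OF uc r(1)]) (auto simp: covers_def)
    have "h a (u \<otimes> s) v = (h a (u \<otimes> s \<otimes> s) v - h a (u \<otimes> s \<otimes> s) (v \<otimes> s)) / ?e"
      by (rule h_descent[OF _ _ r(1) _ v]) (use IH[of "u \<otimes> s"] us u uc r in simp_all)
    then show "?k u * ((h a u v - h a u (v \<otimes> s)) / ?e) = ?k u * h a (u \<otimes> s) v" using uc r by simp
  qed
  also have "\<dots> = (\<Sum>u\<in>{u \<in> covers w'. len u < len (u \<otimes> s)}. 
      const (form l (root_of (inv (u \<otimes> s) \<otimes> w))) * h a (u \<otimes> s) v)"
  proof (intro sum.cong refl)
    fix u assume u: "u \<in> {u \<in> covers w'. len u < len (u \<otimes> s)}"
    then have uw: "u \<rightarrow>\<^sub>B w'" by (simp add: covers_def)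
    note uc = edge_carrier(1)[OF uw]
    have ne: "inv u \<otimes> w' \<noteq> s"
    proof
      assume "inv u \<otimes> w' = s"
      then have "u \<otimes> (inv u \<otimes> w') = u \<otimes> s" by simp
      then have "w' = u \<otimes> s" using uc r by (simp flip: m_assoc)
      then have "w = u" using r uc by simp
      then show False using u r(5) by (simp add: covers_def)
    qed
    have "inv (u \<otimes> s) \<otimes> w = s \<otimes> (inv u \<otimes> w') \<otimes> s"
      using uc r by (simp add: inv_mult_group m_assoc)
    then have "root_of (inv (u \<otimes> s) \<otimes> w) = act s (root_of (inv u \<otimes> w'))"
      using act_S_root_of[OF r(1) edge_refl_inv[OF uw] ne] by simp
    then have "form l (root_of (inv (u \<otimes> s) \<otimes> w)) = form (act s l) (act s (act s (root_of (inv u \<otimes> w'))))"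
      by simp
    also have "act s (act s (root_of (inv u \<otimes> w'))) = root_of (inv u \<otimes> w')"
      using r by (simp add: act_S reflect_reflect)
    finally show "?k u * h a (u \<otimes> s) v = const (form l (root_of (inv (u \<otimes> s) \<otimes> w))) * h a (u \<otimes> s) v" 
      by simp
  qed
  also have "\<dots> = (\<Sum>u\<in>(\<lambda>u. u \<otimes> s) ` {u \<in> covers w'. len u < len (u \<otimes> s)}. 
      const (form l (root_of (inv u \<otimes> w))) * h a u v)"
  proof (subst sum.reindex)
    show "inj_on (\<lambda>u. u \<otimes> s) {u \<in> covers w'. len u < len (u \<otimes> s)}"
      using r(1) edge_carrier(1) by (intro inj_onI) (auto simp: covers_def)
  qed simp
  also have "?c * h a w' v + \<dots> = (\<Sum>u\<in>covers w. const (form l (root_of (inv u \<otimes> w))) * h a u v)"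
  proof -
    have "inv w' \<otimes> w = s" using r by (simp flip: m_assoc)
    then have "?c = const (form l (root_of (inv w' \<otimes> w)))" using r by simp
    moreover have "w' \<notin> (\<lambda>u. u \<otimes> s) ` {u \<in> covers w'. len u < len (u \<otimes> s)}"
    proof
      assume "w' \<in> (\<lambda>u. u \<otimes> s) ` {u \<in> covers w'. len u < len (u \<otimes> s)}"
      then obtain u where u: "w' = u \<otimes> s" "u \<in> covers w'" by auto
      then have uc: "u \<in> carrier W" using edge_carrier by (auto simp: covers_def)
      have "w = u" using u(1) r uc by simp
      with u(2) r(5) show False by (simp add: covers_def)
    qed
    moreover have "covers w = insert w' ((\<lambda>u. u \<otimes> s) ` {u \<in> covers w'. len u < len (u \<otimes> s)})"
      using covers_mult_S[OF r(3,1)] r(4,5) by simp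
    ultimately show ?thesis using finite_covers[of w'] by simp
  qed
  finally show "?X * h_word a (s # ss) v = (\<Sum>u\<in>covers w. const (form l (root_of (inv u \<otimes> w))) * h a u v)" .
qed

text \<open>The two claims need a common induction: the formula for \<open>w\<close> uses
  independence for shorter elements, and independence for \<open>w\<close> uses the formula for each
  of its reduced words.\<close>

lemma chevalley_h:
  assumes "w \<in> carrier W"
  shows "chevalley a w (h a w) \<and> 
    (\<forall>ss. rreduced ss \<longrightarrow> rword ss = w \<longrightarrow> (\<forall>v\<in>carrier W. h_word a ss v = h a w v))"
  using assms
proof (induction "len w" arbitrary: w rule: less_induct)
  case less
  have chev: "chevalley a w (h_word a ss)" if ss: "rreduced ss" "rword ss = w" for ss
  proof (cases ss)
    case Nil
    then have w: "w = \<one>" using ss by simp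
    then have "covers w = {}" by (auto simp: covers_def)
    then show ?thesis unfolding chevalley_def using Nil w by simp
  next
    case (Cons s ss')
    show ?thesis unfolding Cons
    proof (rule chevalley_step)
      show "rreduced (s # ss')" "w = rword (s # ss')" using ss Cons by simp_all
      fix u assume "u \<in> carrier W" "len u \<le> len (rword ss')"
      moreover have "len (rword ss') < len w" using rreduced_ConsD[of s ss'] ss Cons by simp
      ultimately show "chevalley a u (h a u) \<and> 
        (\<forall>ss. rreduced ss \<longrightarrow> rword ss = u \<longrightarrow> (\<forall>v\<in>carrier W. h_word a ss v = h a u v))"
        using less.hyps[of u] by simp
    qed simp
  qed
  obtain ss0 where ss0: "rreduced ss0" "rword ss0 = w" "h a w = h_word a ss0"
    using h_word_SOME[OF less.prems] .
  have "h_word a ss v = h_word a ss0 v" if ss: "rreduced ss" "rword ss = w" and v: "v \<in> carrier W" for ss v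
  proof -
    consider "v = w" | "\<not> v \<le>\<^sub>B w" | "v \<le>\<^sub>B w" "v \<noteq> w" by blast
    then show ?thesis
    proof cases
      case 1
      then show ?thesis using h_word_self[of ss a] h_word_self[of ss0 a] ss ss0 by simp
    next
      case 2
      then show ?thesis using h_word_support ss ss0 v by metis
    next
      case 3
      \<comment> \<open>Both sides equal the same sum over covers, which involves \<open>h\<close>
        and not the words for \<open>w\<close>.\<close>
      have "ev a (act v rho - act w rho) * h_word a ss v = ev a (act v rho - act w rho) * h_word a ss0 v"
        using chev[OF ss] chev[OF ss0(1,2)] v unfolding chevalley_def by simp
      moreover have "ev a (act v rho - act w rho) \<noteq> 0" using ev_rho_pos[OF 3, of a] by simp
      ultimately show ?thesis by (metis mult_left_cancel)
    qed
  qed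
  then show ?case using chev[OF ss0(1,2)] ss0(3) by simp
qed

text \<open>In Chevalley's formula for \<rho> all terms are nonnegative, and a cover of
  \<open>w\<close> lying above \<open>v\<close> contributes a positive one.\<close>

lemma h_pos: "v \<le>\<^sub>B w \<Longrightarrow> 0 < h a w v"
proof (induction "len w" arbitrary: w rule: less_induct)
  case less
  have c: "v \<in> carrier W" "w \<in> carrier W" using less.prems ble_carrier by auto
  obtain ss where ss: "rreduced ss" "rword ss = w" "h a w = h_word a ss"
    using h_word_SOME[OF c(2)] .
  show ?case
  proof (cases "v = w")
    case True
    have "0 < 1 / ev a (root_of (u \<otimes> inv w))" if "u \<rightarrow>\<^sub>B w" for u
    proof -
      from that obtain t where t: "u \<in> carrier W" "t \<in> refls" "w = u \<otimes> t" by (rule edgeE)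
      then have "u \<otimes> inv w = u \<otimes> t \<otimes> inv u" by (simp add: inv_mult_group m_assoc)
      then show ?thesis using ev_root_pos[of "u \<otimes> inv w" a] refls_conj[OF t(2,1)] by simp
    qed
    then show ?thesis unfolding True ss(3) using h_word_self[OF ss(1), of a] ss(2) 
      by (auto intro!: prod_pos)
  next
    case False
    have sum: "ev a (act v rho - act w rho) * h a w v = 
      (\<Sum>u\<in>covers w. const (form rho (root_of (inv u \<otimes> w))) * h a u v)"
      using chevalley_h[OF c(2)] c(1) unfolding chevalley_def by blast
    have k: "0 < const (form rho (root_of (inv u \<otimes> w)))" if "u \<in> covers w" for u
      using that by (intro const_pos form_rho_root_pos edge_refl_inv) (simp add: covers_def)
    have hu: "0 < h a u v" if "u \<in> covers w" "v \<le>\<^sub>B u" for u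
      using that by (intro less.hyps) (auto simp: covers_def)
    have hu': "0 \<le> h a u v" if "u \<in> covers w" for u
    proof (cases "v \<le>\<^sub>B u")
      case True then show ?thesis using hu that by (simp add: less_imp_le)
    next
      case False
      have "u \<in> carrier W" using that edge_carrier by (auto simp: covers_def)
      then obtain us where "rreduced us" "rword us = u" "h a u = h_word a us" by (rule h_word_SOME)
      then have "h a u v = 0" using h_word_support[of us v a] c(1) False by auto
      then show ?thesis by simp
    qed
    obtain u where u: "v \<le>\<^sub>B u" "u \<in> covers w"
      using ex_lower_cover[OF less.prems False] by (auto simp: covers_def)
    have "0 < (\<Sum>u\<in>covers w. const (form rho (root_of (inv u \<otimes> w))) * h a u v)"
    proof (rule sum_pos2[OF finite_covers u(2)])
      show "0 < const (form rho (root_of (inv u \<otimes> w))) * h a u v"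
        using k[OF u(2)] hu[OF u(2,1)] by simp
      show "0 \<le> const (form rho (root_of (inv i \<otimes> w))) * h a i v" if "i \<in> covers w" for i
        using k[OF that] hu'[OF that] by simp
    qed
    then show ?thesis using sum ev_rho_pos[OF less.prems False, of a] by (metis zero_less_mult_pos)
  qed
qed

end

section \<open>Poles and Deodhar's inequality\<close>

definition regular_at :: "'a::field \<Rightarrow> 'a poly fract \<Rightarrow> bool" where
  "regular_at r f \<longleftrightarrow> (\<exists>p q. poly q r \<noteq> 0 \<and> f = Fract p q)"

lemma regular_at_Fract: "poly q r \<noteq> 0 \<Longrightarrow> regular_at r (Fract p q)"
  unfolding regular_at_def by blast

lemma regular_at_0 [simp]: "regular_at r 0"
  unfolding Zero_fract_def by (rule regular_at_Fract) simp

lemma regular_at_mult: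
  assumes "regular_at r f" "regular_at r g" shows "regular_at r (f * g)"
proof -
  obtain p q p' q' where "poly q r \<noteq> 0" "f = Fract p q" "poly q' r \<noteq> 0" "g = Fract p' q'"
    using assms unfolding regular_at_def by auto
  then show ?thesis by (simp add: regular_at_Fract)
qed

lemma regular_at_diff:
  assumes "regular_at r f" "regular_at r g" shows "regular_at r (f - g)"
proof -
  obtain p q p' q' where "poly q r \<noteq> 0" "f = Fract p q" "poly q' r \<noteq> 0" "g = Fract p' q'"
    using assms unfolding regular_at_def by auto
  moreover from this have "q \<noteq> 0" "q' \<noteq> 0" by auto
  ultimately show ?thesis by (simp add: regular_at_Fract)
qed

lemma regular_at_uminus: "regular_at r f \<Longrightarrow> regular_at r (- f)"
  using regular_at_diff[of r 0 f] by simp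

lemma regular_at_divide:
  assumes "regular_at r f" "poly p r \<noteq> 0" shows "regular_at r (f / Fract p 1)"
proof -
  have "regular_at r (Fract 1 p)" using assms by (intro regular_at_Fract)
  then show ?thesis using regular_at_mult[OF assms(1)] by (simp add: divide_inverse)
qed

text \<open>Regularity refers to some representation; cross multiplication carries the conclusion
  over to the given one.\<close>

lemma regular_at_FractD:
  assumes "regular_at r (Fract p q)" "q \<noteq> 0" "poly q r = 0" shows "poly p r = 0"
proof -
  obtain p' q' where q': "poly q' r \<noteq> 0" and "Fract p q = Fract p' q'"
    using assms unfolding regular_at_def by auto
  moreover from q' have "q' \<noteq> 0" by auto
  ultimately have "p * q' = p' * q" using assms(2) by (simp add: eq_fract(1))
  then have "poly p r * poly q' r = poly p' r * poly q r" by (metis poly_mult)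
  then have "poly p r * poly q' r = 0" using assms(3) by simp
  with q' show ?thesis by simp
qed

section \<open>Degree bounds and the number of simple poles\<close>

abbreviation linprod :: "real list \<Rightarrow> real poly" where
  "linprod xs \<equiv> (\<Prod>r\<leftarrow>xs. [:- r, 1:])"

lemma linprod_neq_0: "linprod xs \<noteq> 0"
  by (auto simp: prod_list_zero_iff)

lemma poly_linprod_eq_0_iff: "poly (linprod xs) r = 0 \<longleftrightarrow> r \<in> set xs"
  by (induction xs) auto

lemma degree_linprod: "degree (linprod xs) = length xs"
proof (induction xs)
  case (Cons r xs)
  then show ?case using linprod_neq_0[of xs] by (simp add: degree_mult_eq del: mult_pCons_left)
qed simp

definition poles_degree :: "real set \<Rightarrow> nat \<Rightarrow> real poly fract \<Rightarrow> bool" where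
  "poles_degree Z n f \<longleftrightarrow> f = 0 \<or> (\<exists>p xs. f = Fract p (linprod xs) \<and> set xs \<subseteq> Z \<and> degree p + n \<le> length xs)"

lemma poles_degree_uminus: "poles_degree Z n f \<Longrightarrow> poles_degree Z n (- f)"
  unfolding poles_degree_def by (metis degree_minus minus_fract neg_equal_0_iff_equal)

lemma poles_degree_diff:
  assumes "poles_degree Z n f" "poles_degree Z n g" shows "poles_degree Z n (f - g)"
proof -
  consider "f = 0" | "g = 0" | p xs p' ys where "f = Fract p (linprod xs)" "set xs \<subseteq> Z" "degree p + n \<le> length xs"
     "g = Fract p' (linprod ys)" "set ys \<subseteq> Z" "degree p' + n \<le> length ys"
    using assms unfolding poles_degree_def by auto
  then show ?thesis
  proof cases
    case 1 then show ?thesis using assms poles_degree_uminus by simp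
  next
    case 2 then show ?thesis using assms by simp
  next
    case 3
    let ?p = "p * linprod ys - p' * linprod xs"
    have "degree (p * linprod ys) \<le> degree p + length ys" "degree (p' * linprod xs) \<le> degree p' + length xs"
      using degree_mult_le[of p "linprod ys"] degree_mult_le[of p' "linprod xs"] by (simp_all add: degree_linprod)
    then have "degree ?p + n \<le> length (xs @ ys)"
      using 3(3,6) degree_diff_le_max[of "p * linprod ys" "p' * linprod xs"] by simp
    moreover have "f - g = Fract ?p (linprod (xs @ ys))"
      using 3(1,4) linprod_neq_0[of xs] linprod_neq_0[of ys] by simp
    ultimately show ?thesis unfolding poles_degree_def using 3(2,5) by (metis Un_least set_append)
  qed
qed

lemma poles_degree_divide:
  assumes "poles_degree Z n f" "b \<noteq> 0" "- a / b \<in> Z"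
  shows "poles_degree Z (Suc n) (f / Fract [:a, b:] 1)"
proof (cases "f = 0")
  case True then show ?thesis by (simp add: poles_degree_def)
next
  case False
  then obtain p xs where f: "f = Fract p (linprod xs)" "set xs \<subseteq> Z" "degree p + n \<le> length xs"
    using assms(1) unfolding poles_degree_def by blast
  define L where "L = [:- (- a / b), 1:]"
  have eq: "[:a, b:] = smult b L" using assms(2) by (simp add: L_def)
  have L: "linprod ((- a / b) # xs) = L * linprod xs" "L \<noteq> 0" by (simp_all add: L_def)
  have "Fract p (linprod xs * [:a, b:]) = Fract (smult (1 / b) p) (linprod ((- a / b) # xs))"
    unfolding eq L(1) using linprod_neq_0[of xs] L(2) assms(2)
    by (subst eq_fract(1)) (simp_all add: mult_ac)
  then have "f / Fract [:a, b:] 1 = Fract (smult (1 / b) p) (linprod ((- a / b) # xs))"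
    using f(1) by simp
  moreover have "degree (smult (1 / b) p) + Suc n \<le> length ((- a / b) # xs)"
    using f(3) by simp
  moreover have "set ((- a / b) # xs) \<subseteq> Z" using f(2) assms(3) by simp
  ultimately show ?thesis unfolding poles_degree_def by blast
qed

text \<open>In a shortest representation \<open>p / \<Prod>(z - r)\<close> the \<open>r\<close> are exactly the poles with multiplicity.\<close>

lemma card_poles:
  assumes "f \<noteq> 0" "poles_degree Z n f" "finite A"
    and reg: "\<And>r. r \<in> Z - A \<Longrightarrow> regular_at r f"
    and simple: "\<And>r. r \<in> Z \<Longrightarrow> regular_at r (Fract [:- r, 1:] 1 * f)"
  shows "n \<le> card A"
proof -
  let ?P = "\<lambda>xs. \<exists>p. f = Fract p (linprod xs) \<and> set xs \<subseteq> Z \<and> degree p + n \<le> length xs"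
  have "\<exists>xs. ?P xs" using assms(1,2) unfolding poles_degree_def by blast
  then obtain xs where xs: "?P xs" and min: "\<And>ys. ?P ys \<Longrightarrow> length xs \<le> length ys"
    using ex_has_least_nat[of ?P _ length] by blast
  then obtain p where p: "f = Fract p (linprod xs)" "set xs \<subseteq> Z" "degree p + n \<le> length xs" by blast
  have split: "linprod xs = [:- r, 1:] * linprod (remove1 r xs)" if "r \<in> set xs" for r
    using that by (induction xs) (auto simp: mult_ac simp del: mult_pCons_left mult_pCons_right)
  have pr: "poly p r \<noteq> 0" if r: "r \<in> set xs" for r
  proof
    assume "poly p r = 0"
    then obtain p' where p': "p = [:- r, 1:] * p'" using poly_eq_0_iff_dvd by blast
    have "f = Fract p' (linprod (remove1 r xs))"
      unfolding p(1) split[OF r] p' by (rule mult_fract_cancel) simp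
    moreover have "p' \<noteq> 0" using assms(1) p(1) p' by (auto simp: fract_collapse)
    then have "degree p = Suc (degree p')" unfolding p' by (simp add: degree_mult_eq del: mult_pCons_left)
    then have "degree p' + n \<le> length (remove1 r xs)" using p(3) r by (simp add: length_remove1)
    moreover have "set (remove1 r xs) \<subseteq> Z" using p(2) set_remove1_subset[of r xs] by blast
    ultimately have "length xs \<le> length (remove1 r xs)" using min by blast
    moreover have "length (remove1 r xs) < length xs" 
      using r length_pos_if_in_set[OF r] by (simp only: length_remove1 if_True diff_less)
    ultimately show False by simp
  qed
  have "set xs \<subseteq> A"
  proof
    fix r assume r: "r \<in> set xs"
    have "\<not> regular_at r f" 
      using regular_at_FractD[of r p "linprod xs"] p(1) pr[OF r] r linprod_neq_0 poly_linprod_eq_0_iff by blast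
    then show "r \<in> A" using reg r p(2) by blast
  qed
  \<comment> \<open>A repeated entry would leave a pole after multiplication by its linear
    factor.\<close>
  moreover have "distinct xs"
  proof -
    have "r \<notin> set (remove1 r xs)" if r: "r \<in> set xs" for r
    proof
      assume r2: "r \<in> set (remove1 r xs)"
      have "Fract [:- r, 1:] 1 * f = Fract ([:- r, 1:] * p) ([:- r, 1:] * linprod (remove1 r xs))"
        unfolding p(1) split[OF r] by simp
      also have "\<dots> = Fract p (linprod (remove1 r xs))" by (rule mult_fract_cancel) simp
      finally have "regular_at r (Fract p (linprod (remove1 r xs)))" using simple[of r] r p(2) by auto
      then show False
        using regular_at_FractD[of r p "linprod (remove1 r xs)"] pr[OF r] r2 linprod_neq_0 poly_linprod_eq_0_iff by blast
    qed
    moreover have "distinct ys" if "\<And>r. r \<in> set ys \<Longrightarrow> r \<notin> set (remove1 r ys)" for ys :: "real list"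
      using that
    proof (induction ys)
      case (Cons y ys)
      have "y \<notin> set ys" using Cons.prems[of y] by simp
      moreover have "r \<notin> set (remove1 r ys)" if "r \<in> set ys" for r
        using Cons.prems[of r] that calculation by (auto split: if_splits)
      then have "distinct ys" by (rule Cons.IH)
      ultimately show ?case by simp
    qed simp
    ultimately show ?thesis by blast
  qed
  ultimately have "length xs \<le> card A" using distinct_card[of xs] card_mono[OF assms(3)] by metis
  with p(3) show ?thesis by simp
qed

text \<open>Take the powers of a number \<open>c\<close>, with distinct exponents, as coefficients
  of the functional. Each vector becomes a nonzero polynomial in \<open>c\<close>, and finitely many
  such polynomials have finitely many roots.\<close>

lemma ex_lin_neq_0:
  assumes "finite X" "0 \<notin> X" shows "\<exists>a. \<forall>x\<in>X. lin a (x :: 'i vec) \<noteq> 0"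
proof -
  define U where "U = (\<Union>x\<in>X. Poly_Mapping.keys x)"
  have "finite U" using assms by (simp add: U_def)
  then obtain f :: "'i \<Rightarrow> nat" where f: "inj_on f U" using finite_imp_inj_to_nat_seg by blast
  define P where "P x = (\<Sum>i\<in>Poly_Mapping.keys x. monom (Poly_Mapping.lookup x i) (f i))" for x :: "'i vec"
  have "P x \<noteq> 0" if "x \<in> X" for x
  proof -
    have "Poly_Mapping.keys x \<noteq> {}" using that assms by auto
    then obtain i where i: "i \<in> Poly_Mapping.keys x" by blast
    have inj: "inj_on f (Poly_Mapping.keys x)" using f that by (auto simp: U_def inj_on_def)
    have "coeff (P x) (f i) = (\<Sum>j\<in>Poly_Mapping.keys x. if j = i then Poly_Mapping.lookup x j else 0)"
      unfolding P_def coeff_sum using inj i by (intro sum.cong) (auto simp: inj_on_def)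
    also have "\<dots> = Poly_Mapping.lookup x i" using i by simp
    finally show ?thesis using i by (auto simp: in_keys_iff)
  qed
  then have "finite (\<Union>x\<in>X. {c. poly (P x) c = 0})" using assms(1) poly_roots_finite by blast
  then obtain c where c: "c \<notin> (\<Union>x\<in>X. {c. poly (P x) c = 0})" 
    using ex_new_if_finite[OF infinite_UNIV_char_0] by blast
  have "lin (\<lambda>i. c ^ f i) x = poly (P x) c" for x
    by (simp add: lin_def P_def poly_sum poly_monom mult.commute)
  with c show ?thesis by (intro exI[of _ "\<lambda>i. c ^ f i"]) auto
qed

section \<open>Poles of the nil Hecke coefficients on a generic line\<close>

context coxeter_system
begin

text \<open>The zero of the linear polynomial \<open>evp a (root_of t)\<close>: the point where the
  line meets the hyperplane of \<open>t\<close>.\<close>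

definition zero_of :: "('a option \<Rightarrow> real) \<Rightarrow> 'a \<Rightarrow> real" where
  "zero_of a t = - lin a (root_of t) / form rho (root_of t)"

text \<open>Two zeros coincide only if \<open>lin a\<close> vanishes on a combination of the two
  roots, and this combination is nonzero because roots of distinct reflections are not
  proportional.\<close>

lemma ex_generic:
  assumes "finite F" "F \<subseteq> refls" shows "\<exists>a. inj_on (zero_of a) F"
proof -
  let ?d = "\<lambda>(t, t'). form rho (root_of t') \<cdot> root_of t - form rho (root_of t) \<cdot> root_of t'"
  let ?X = "?d ` {(t, t') \<in> F \<times> F. t \<noteq> t'}"
  have "0 \<notin> ?X"
  proof
    assume "0 \<in> ?X"
    then obtain t t' where t: "t \<in> F" "t' \<in> F" "t \<noteq> t'"
      and eq: "form rho (root_of t') \<cdot> root_of t = form rho (root_of t) \<cdot> root_of t'" by auto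
    then have pos: "0 < form rho (root_of t')" using form_rho_root_pos assms by blast
    have "root_of t = (1 / form rho (root_of t')) \<cdot> form rho (root_of t') \<cdot> root_of t"
      using pos by simp
    also have "\<dots> = (form rho (root_of t) / form rho (root_of t')) \<cdot> root_of t'"
      unfolding eq by simp
    finally show False using root_of_inject t assms by blast
  qed
  moreover have "finite ?X" 
    by (rule finite_imageI, rule finite_subset[of _ "F \<times> F"]) (use assms in auto)
  ultimately obtain a where a: "\<forall>x\<in>?X. lin a x \<noteq> 0" using ex_lin_neq_0 by blast
  have "inj_on (zero_of a) F"
  proof (rule inj_onI, rule ccontr)
    fix t t' assume t: "t \<in> F" "t' \<in> F" "zero_of a t = zero_of a t'" "t \<noteq> t'"
    have "form rho (root_of t) \<noteq> 0" "form rho (root_of t') \<noteq> 0"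
      using form_rho_root_pos[of t] form_rho_root_pos[of t'] t assms by auto
    then have "lin a (?d (t, t')) = 0" using t(3) by (simp add: zero_of_def field_simps)
    then show False using a t by blast
  qed
  then show ?thesis by (rule exI[of _ a])
qed

lemma evp_zero_of:
  assumes "t \<in> refls" "t' \<in> refls" 
  shows "poly (evp a (root_of t)) (zero_of a t') = 0 \<longleftrightarrow> zero_of a t = zero_of a t'"
  using form_rho_root_pos[OF assms(1)] form_rho_root_pos[OF assms(2)]
  by (simp add: evp_def zero_of_def field_simps)

lemma regular_at_divide_root:
  assumes "inj_on (zero_of a) F" "F \<subseteq> refls" "t \<in> F" "v \<in> carrier W" "s \<in> S" 
    "v \<otimes> s \<otimes> inv v \<in> F" "v \<otimes> s \<otimes> inv v \<noteq> t" "regular_at (zero_of a t) f"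
  shows "regular_at (zero_of a t) (f / ev a (act v (simple_root s)))"
proof -
  let ?t = "v \<otimes> s \<otimes> inv v"
  have "poly (evp a (root_of ?t)) (zero_of a t) \<noteq> 0"
    using evp_zero_of[of ?t t a] assms(1,2,3,6,7) unfolding inj_on_def by blast
  then have "regular_at (zero_of a t) (f / ev a (root_of ?t))" 
    unfolding ev_def by (intro regular_at_divide assms)
  then show ?thesis
    by (cases rule: act_simple_root_cases[OF assms(4,5)]) (auto dest: regular_at_uminus)
qed

lemma conj_refl: "\<lbrakk>t \<in> refls; v \<in> carrier W; s \<in> S\<rbrakk> \<Longrightarrow>
   t \<otimes> v \<otimes> s \<otimes> inv (t \<otimes> v) = t \<otimes> (v \<otimes> s \<otimes> inv v) \<otimes> t"
  by (simp add: inv_mult_group m_assoc)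

text \<open>That poles are at most simple is not inductive by itself, since the recursion may divide
  by the root of \<open>t\<close>. The second claim, that the polar parts at \<open>v\<close> and
  \<open>t v\<close> agree, makes the numerator regular in that case.\<close>

lemma h_word_poles:
  assumes F: "inj_on (zero_of a) F" "F \<subseteq> refls" "t \<in> F"
    and red: "rreduced ss" "rword ss \<le>\<^sub>B w"
    and Fw: "\<And>v s. \<lbrakk>v \<le>\<^sub>B w; s \<in> set ss\<rbrakk> \<Longrightarrow> v \<otimes> s \<otimes> inv v \<in> F \<and> t \<otimes> (v \<otimes> s \<otimes> inv v) \<otimes> t \<in> F"
    and v: "v \<in> carrier W"
  shows "regular_at (zero_of a t) (ev a (root_of t) * h_word a ss v) \<and>
    regular_at (zero_of a t) (h_word a ss v - h_word a ss (t \<otimes> v))"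
  using red Fw v
proof (induction ss arbitrary: v)
  case Nil
  have "regular_at r (1 :: real poly fract)" for r
    unfolding One_fract_def by (rule regular_at_Fract) simp
  moreover have "regular_at r (ev a x)" for r x
    unfolding ev_def by (rule regular_at_Fract) simp
  ultimately show ?case by (auto intro!: regular_at_mult regular_at_diff regular_at_uminus)
next
  case (Cons s ss)
  note r = rreduced_ConsD[OF Cons.prems(1)]
  let ?r = "zero_of a t" and ?E = "ev a (root_of t)" and ?w = "rword (s # ss)"
  have t: "t \<in> refls" "t \<in> carrier W" using F by auto
  have tt [simp]: "t \<otimes> (t \<otimes> x) = x" if "x \<in> carrier W" for x
    using that t by (simp flip: m_assoc)
  have "rword ss \<le>\<^sub>B ?w" using ble_mult_S[OF r(3,1)] r(4,5) by simp
  then have "rword ss \<le>\<^sub>B w" using Cons.prems(2) ble_trans by blast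
  then have IH: "regular_at ?r (?E * h_word a ss x)" "regular_at ?r (h_word a ss x - h_word a ss (t \<otimes> x))"
    if "x \<in> carrier W" for x
    using Cons.IH[OF r(2) _ _ that] Cons.prems(3) by auto
  \<comment> \<open>\<open>F\<close> controls the denominators only below \<open>w\<close>. Other
    elements are treated by the support of \<open>h_word\<close> and the symmetry between
    \<open>v\<close> and \<open>t v\<close>.\<close>
  have main: "regular_at ?r (?E * h_word a (s # ss) v) \<and>
    regular_at ?r (h_word a (s # ss) v - h_word a (s # ss) (t \<otimes> v))" if vw: "v \<le>\<^sub>B ?w" for v
  proof -
    have v: "v \<in> carrier W" using vw ble_carrier by blast
    then have vs: "v \<otimes> s \<in> carrier W" "t \<otimes> v \<in> carrier W" using r t by auto
    let ?t = "v \<otimes> s \<otimes> inv v"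
    let ?e = "ev a (act v (simple_root s))" and ?e' = "ev a (act (t \<otimes> v) (simple_root s))"
    have inF: "?t \<in> F" "t \<otimes> ?t \<otimes> t \<in> F" 
      using Cons.prems(3)[of v s] vw Cons.prems(2) ble_trans by auto
    have h: "h_word a (s # ss) v = (h_word a ss v - h_word a ss (v \<otimes> s)) / ?e"
      "h_word a (s # ss) (t \<otimes> v) = (h_word a ss (t \<otimes> v) - h_word a ss (t \<otimes> v \<otimes> s)) / ?e'"
      by simp_all
    show ?thesis
    proof (cases "?t = t")
      \<comment> \<open>The recursion divides by the root of \<open>t\<close>, up to sign, and its
        numerator is the regular difference at \<open>v\<close> and \<open>t v\<close>. The new
        values at these two elements are equal.\<close>
      case True
      then have "?t \<otimes> v = t \<otimes> v" by simp
      then have tv: "t \<otimes> v = v \<otimes> s" using v r by (simp add: m_assoc)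
      have E: "?e = ?E \<or> ?e = - ?E"
        by (cases rule: act_simple_root_cases[OF v r(1)]) (auto simp: True)
      have E0: "?E \<noteq> 0" using ev_root_pos[OF t(1), of a] by simp
      have "?E * h_word a (s # ss) v = h_word a ss v - h_word a ss (t \<otimes> v) \<or>
         ?E * h_word a (s # ss) v = - (h_word a ss v - h_word a ss (t \<otimes> v))"
      proof -
        have "E * (X / e) = X \<or> E * (X / e) = - X" if "e = E \<or> e = - E" "E \<noteq> 0" 
          for e E X :: "real poly fract"
          using that by auto
        from this[OF E E0] show ?thesis unfolding h tv .
      qed
      then have "regular_at ?r (?E * h_word a (s # ss) v)" using IH(2)[OF v] regular_at_uminus by metis
      moreover have "h_word a (s # ss) (t \<otimes> v) = h_word a (s # ss) v"
      proof -
        have "(B - A) / (- e) = (A - B) / e" for A B e :: "real poly fract"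
          by (metis minus_diff_eq minus_divide_divide)
        then show ?thesis
          unfolding tv h_word.simps(2) act_mult_S_simple_root[OF v r(1)] S_cancel_right[OF v r(1)] ev_linear(3) .
      qed
      ultimately show ?thesis by simp
    next
      case False
      have t'_ne: "t \<otimes> ?t \<otimes> t \<noteq> t"
      proof
        assume "t \<otimes> ?t \<otimes> t = t"
        then have "t \<otimes> (t \<otimes> ?t \<otimes> t) \<otimes> t = t \<otimes> t \<otimes> t" by simp
        then show False using False v r t by (simp add: m_assoc)
      qed
      have div: "regular_at ?r (f / ?e)" "regular_at ?r (f / ?e')" if "regular_at ?r f" for f
      proof -
        show "regular_at ?r (f / ?e)"
          by (rule regular_at_divide_root[OF F v r(1) inF(1) False that])
        show "regular_at ?r (f / ?e')"
          by (rule regular_at_divide_root[OF F vs(2) r(1)])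
            (use inF(2) t'_ne that conj_refl[OF t(1) v r(1)] in simp_all)
      qed
      have assoc: "t \<otimes> v \<otimes> s = t \<otimes> (v \<otimes> s)" using t v r by (simp add: m_assoc)
      have "regular_at ?r (?E * h_word a (s # ss) v)"
        using div(1)[OF regular_at_diff[OF IH(1)[OF v] IH(1)[OF vs(1)]]] unfolding h
        by (simp add: right_diff_distrib)
      moreover have "regular_at ?r (h_word a (s # ss) v - h_word a (s # ss) (t \<otimes> v))"
      proof -
        define A B C D where "A = h_word a ss v" and "B = h_word a ss (v \<otimes> s)" 
          and "C = h_word a ss (t \<otimes> v)" and "D = h_word a ss (t \<otimes> (v \<otimes> s))"
        define k where "k = const (form (act v (simple_root s)) (root_of t))"
        \<comment> \<open>The denominators at \<open>v\<close> and \<open>t v\<close> differ by a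
          multiple of \<open>?E\<close>, which absorbs the simple poles of \<open>C\<close> and
          \<open>D\<close>.\<close>
        have e': "?e' = ?e - k * ?E"
          using t v r by (simp add: act_mult act_refls reflect_def k_def)
        have 0: "?e \<noteq> 0" "?e' \<noteq> 0" using v vs r by (simp_all only: ev_simple_root_neq_0 simp_thms)
        have "(A - B) / ?e - (C - D) / ?e' = ((A - C) - (B - D)) / ?e - k * (?E * C - ?E * D) / ?e / ?e'"
          using 0 by (simp add: field_simps del: ev_linear) (simp add: e' algebra_simps)
        moreover have k: "regular_at ?r k" unfolding k_def const_def by (rule regular_at_Fract) simp
        have reg: "regular_at ?r (A - C)" "regular_at ?r (B - D)" "regular_at ?r (?E * C)" "regular_at ?r (?E * D)"
          using IH(2)[OF v] IH(2)[OF vs(1)] IH(1)[OF vs(2)] IH(1)[of "t \<otimes> (v \<otimes> s)"] t vs(1)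
          unfolding A_def B_def C_def D_def by simp_all
        have "regular_at ?r (((A - C) - (B - D)) / ?e - k * (?E * C - ?E * D) / ?e / ?e')"
          by (rule regular_at_diff[OF div(1)[OF regular_at_diff[OF reg(1,2)]] 
            div(2)[OF div(1)[OF regular_at_mult[OF k regular_at_diff[OF reg(3,4)]]]]])
        ultimately show ?thesis unfolding h assoc A_def B_def C_def D_def by simp
      qed
      ultimately show ?thesis by blast
    qed
  qed
  show ?case
  proof (cases "v \<le>\<^sub>B ?w")
    case True
    then show ?thesis by (rule main)
  next
    case False
    have v: "v \<in> carrier W" "t \<otimes> v \<in> carrier W" using Cons.prems(4) t by auto
    have 0: "h_word a (s # ss) v = 0" using h_word_support[OF Cons.prems(1) v(1), of a] False by blast
    show ?thesis
    proof (cases "t \<otimes> v \<le>\<^sub>B ?w")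
      case True
      then show ?thesis using main[OF True] 0 v tt by (simp del: h_word.simps add: regular_at_uminus)
    next
      case False
      then have "h_word a (s # ss) (t \<otimes> v) = 0" using h_word_support[OF Cons.prems(1) v(2), of a] by blast
      then show ?thesis using 0 by (simp del: h_word.simps)
    qed
  qed
qed

text \<open>Each letter divides by one root, a linear polynomial with its zero in the allowed set;
  elsewhere the value is 0 by the support.\<close>

lemma h_word_degree:
  assumes "F \<subseteq> refls" and red: "rreduced ss" "rword ss \<le>\<^sub>B w"
    and Fw: "\<And>v s. \<lbrakk>v \<le>\<^sub>B w; s \<in> set ss\<rbrakk> \<Longrightarrow> v \<otimes> s \<otimes> inv v \<in> F"
    and v: "v \<in> carrier W"
  shows "poles_degree (zero_of a ` F) (length ss) (h_word a ss v)"
  using red Fw v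
proof (induction ss arbitrary: v)
  case Nil
  have "poles_degree Z 0 1" for Z
    unfolding poles_degree_def by (intro disjI2 exI[of _ 1] exI[of _ "[]"]) (simp add: One_fract_def)
  moreover have "poles_degree Z n 0" for Z n by (simp add: poles_degree_def)
  ultimately show ?case by simp
next
  case (Cons s ss)
  note r = rreduced_ConsD[OF Cons.prems(1)]
  let ?w = "rword (s # ss)" and ?t = "v \<otimes> s \<otimes> inv v"
  show ?case
  proof (cases "v \<le>\<^sub>B ?w")
    case True
    have "rword ss \<le>\<^sub>B ?w" using ble_mult_S[OF r(3,1)] r(4,5) by simp
    then have w: "rword ss \<le>\<^sub>B w" "v \<le>\<^sub>B w" using Cons.prems(2) True ble_trans by blast+
    have "poles_degree (zero_of a ` F) (length ss) (h_word a ss x)" if "x \<in> carrier W" for x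
      using Cons.IH[OF r(2) w(1) _ that] Cons.prems(3) by simp
    then have d: "poles_degree (zero_of a ` F) (length ss) (h_word a ss v - h_word a ss (v \<otimes> s))"
      using Cons.prems(4) r by (intro poles_degree_diff) auto
    have tF: "?t \<in> F" using Cons.prems(3) w(2) by simp
    then have "0 < form rho (root_of ?t)" using assms form_rho_root_pos by blast
    then have "poles_degree (zero_of a ` F) (Suc (length ss)) 
       ((h_word a ss v - h_word a ss (v \<otimes> s)) / ev a (root_of ?t))"
      unfolding ev_def evp_def using d tF by (intro poles_degree_divide) (auto simp: zero_of_def)
    then show ?thesis
      by (cases rule: act_simple_root_cases[OF Cons.prems(4) r(1)]) (auto dest: poles_degree_uminus)
  next
    case False
    then have "h_word a (s # ss) v = 0" 
      using h_word_support[OF Cons.prems(1,4), of a] by blast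
    then show ?thesis by (simp add: poles_degree_def del: h_word.simps)
  qed
qed

text \<open>The poles are counted by \<open>card_poles\<close>, and every zero at which one may
  occur is attained at some element \<open>t v \<le> w\<close>.\<close>

lemma deodhar_count:
  assumes "v \<le>\<^sub>B w"
  shows "len w \<le> card {y. y \<le>\<^sub>B w \<and> (\<exists>t\<in>refls. y = t \<otimes> v)}"
proof -
  have c: "v \<in> carrier W" "w \<in> carrier W" using ble_carrier[OF assms] by auto
  obtain ss where ss: "rreduced ss" "rword ss = w" using ex_rreduced[OF c(2)] .
  \<comment> \<open>\<open>T0\<close> contains the reflections of all denominators at elements below
    \<open>w\<close>. \<open>F\<close> adds conjugates, since the denominators at \<open>t v\<close>
    belong to reflections conjugated by \<open>t\<close>.\<close>
  define T0 where "T0 = (\<lambda>(x, s). x \<otimes> s \<otimes> inv x) ` ({x. x \<le>\<^sub>B w} \<times> set ss)"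
  define F where "F = T0 \<union> (\<lambda>(t, t'). t \<otimes> t' \<otimes> t) ` (T0 \<times> T0)"
  have S: "set ss \<subseteq> S" using ss by (auto simp: rreduced_def reduced_def)
  have T0: "finite T0" "T0 \<subseteq> refls" 
    using finite_ble[of w] S reflsI ble_carrier by (auto simp: T0_def)
  have "t \<otimes> t' \<otimes> t \<in> refls" if "t \<in> refls" "t' \<in> refls" for t t'
    using refls_conj[of t' t] that by simp
  then have F: "finite F" "F \<subseteq> refls" using T0 by (auto simp: F_def)
  obtain a where a: "inj_on (zero_of a) F" using ex_generic[OF F] by blast
  have T0I: "x \<otimes> s \<otimes> inv x \<in> T0" if "x \<le>\<^sub>B w" "s \<in> set ss" for x s
    using that by (force simp: T0_def)
  have poles: "regular_at (zero_of a t) (ev a (root_of t) * h_word a ss v)" 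
      "regular_at (zero_of a t) (h_word a ss v - h_word a ss (t \<otimes> v))" if t: "t \<in> T0" for t
  proof -
    have "t \<in> F" using t by (simp add: F_def)
    have conj: "x \<otimes> s \<otimes> inv x \<in> F \<and> t \<otimes> (x \<otimes> s \<otimes> inv x) \<otimes> t \<in> F" if "x \<le>\<^sub>B w" "s \<in> set ss" for x s
      using T0I[OF that] t by (force simp: F_def)
    have "rword ss \<le>\<^sub>B w" using ss(2) c by simp
    from h_word_poles[OF a F(2) \<open>t \<in> F\<close> ss(1) this conj c(1)]
    show "regular_at (zero_of a t) (ev a (root_of t) * h_word a ss v)" 
      "regular_at (zero_of a t) (h_word a ss v - h_word a ss (t \<otimes> v))" by auto
  qed
  let ?A = "zero_of a ` {t \<in> T0. t \<otimes> v \<le>\<^sub>B w}"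
  let ?N = "{y. y \<le>\<^sub>B w \<and> (\<exists>t\<in>refls. y = t \<otimes> v)}"
  have "length ss \<le> card ?A"
  proof (rule card_poles)
    have "h_word a ss v = h a w v" using chevalley_h[OF c(2), of a] ss c by blast
    then show "h_word a ss v \<noteq> 0" using h_pos[OF assms, of a] by simp
    show "poles_degree (zero_of a ` T0) (length ss) (h_word a ss v)"
      by (rule h_word_degree[OF T0(2) ss(1), of w]) (use ss(2) c T0I in simp_all)
    show "finite ?A" using T0 by simp
  next
    fix r assume "r \<in> zero_of a ` T0 - ?A"
    then obtain t where t: "t \<in> T0" "r = zero_of a t" "\<not> t \<otimes> v \<le>\<^sub>B w" by blast
    moreover have "t \<otimes> v \<in> carrier W" using t T0 c by auto
    \<comment> \<open>With the value at \<open>t v\<close> equal to 0, regularity of the difference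
      says that there is no pole at \<open>r\<close>.\<close>
    ultimately have "h_word a ss (t \<otimes> v) = 0" using h_word_support[OF ss(1), of "t \<otimes> v" a] ss(2) by blast
    then show "regular_at r (h_word a ss v)" using poles(2)[OF t(1)] t(2) by simp
  next
    fix r assume "r \<in> zero_of a ` T0"
    then obtain t where t: "t \<in> T0" "r = zero_of a t" by blast
    let ?b = "form rho (root_of t)"
    have b: "?b \<noteq> 0" using form_rho_root_pos[of t] t T0 by auto
    have "Fract [:- r, 1:] 1 = const (1 / ?b) * ev a (root_of t)"
      using b by (simp add: const_def ev_def evp_def t(2) zero_of_def)
    then have "Fract [:- r, 1:] 1 * h_word a ss v = const (1 / ?b) * (ev a (root_of t) * h_word a ss v)"
      by (simp add: mult.assoc)
    moreover have "regular_at r (const (1 / ?b))" unfolding const_def by (rule regular_at_Fract) simp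
    ultimately show "regular_at r (Fract [:- r, 1:] 1 * h_word a ss v)"
      using regular_at_mult poles(1)[OF t(1)] t(2) by metis
  qed
  also have "?A \<subseteq> (\<lambda>y. zero_of a (y \<otimes> inv v)) ` ?N"
  proof
    fix r assume "r \<in> ?A"
    then obtain t where t: "t \<in> T0" "t \<otimes> v \<le>\<^sub>B w" "r = zero_of a t" by blast
    then have "t \<in> refls" using T0 by blast
    then have "t \<otimes> v \<otimes> inv v = t" using c by (simp add: m_assoc)
    then show "r \<in> (\<lambda>y. zero_of a (y \<otimes> inv v)) ` ?N" 
      using t \<open>t \<in> refls\<close> by (intro image_eqI[of _ _ "t \<otimes> v"]) auto
  qed
  then have "card ?A \<le> card ?N"
    using finite_ble[of w] by (intro surj_card_le[of ?N]) auto
  finally show ?thesis using ss by (simp add: rreduced_def reduced_def rword_def)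
qed

text \<open>The elements \<open>t v\<close> below \<open>v\<close> are the sources of edges into
  \<open>v\<close>, and there are \<ell>(v) such sources. Those above \<open>v\<close> are its upper
  neighbours.\<close>

theorem deodhar_inequality:
  assumes "v \<le>\<^sub>B w" shows "0 \<le> defect W S v w"
proof -
  have c: "v \<in> carrier W" "w \<in> carrier W" using ble_carrier[OF assms] by auto
  let ?N = "{y. y \<le>\<^sub>B w \<and> (\<exists>t\<in>refls. y = t \<otimes> v)}"
  have "?N \<subseteq> {y. y \<rightarrow>\<^sub>B v} \<union> upper_nbrs W S v w"
  proof
    fix y assume "y \<in> ?N"
    then obtain t where t: "y \<le>\<^sub>B w" "t \<in> refls" "y = t \<otimes> v" by blast
    define r where "r = inv v \<otimes> t \<otimes> v"
    have r: "r \<in> refls" using refls_conj[of t "inv v"] t c by (simp add: r_def)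
    have y: "y = v \<otimes> r" "v = y \<otimes> r" "y \<in> carrier W"
      using t c r by (simp_all add: r_def m_assoc) (simp_all flip: m_assoc)
    consider "len v < len y" | "len y < len v"
      using len_refl_neq[OF c(1) r, folded y(1)] by (meson linorder_neqE_nat)
    then show "y \<in> {y. y \<rightarrow>\<^sub>B v} \<union> upper_nbrs W S v w"
    proof cases
      case 1
      then have "v \<rightarrow>\<^sub>B y" using edgeI[OF c(1) r, folded y(1)] by blast
      then show ?thesis using y(3) t(1) by (simp add: upper_nbrs_def)
    next
      case 2
      then show ?thesis using edgeI[OF y(3) r, folded y(2)] by blast
    qed
  qed
  moreover have fin: "finite (upper_nbrs W S v w)"
    by (rule finite_subset[OF _ finite_ble[of w]]) (auto simp: upper_nbrs_def)
  ultimately have "card ?N \<le> card ({y. y \<rightarrow>\<^sub>B v} \<union> upper_nbrs W S v w)"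
    using finite_edge_into by (intro card_mono) auto
  also have "\<dots> \<le> card {y. y \<rightarrow>\<^sub>B v} + card (upper_nbrs W S v w)" by (rule card_Un_le)
  finally show ?thesis
    using deodhar_count[OF assms] card_edge_into[OF c(1)] by (simp add: defect_def length_diff_def)
qed

section \<open>Singular intervals\<close>

lemma upper_nbrs_eq: "upper_nbrs W S x w = {v. x \<rightarrow>\<^sub>B v \<and> v \<le>\<^sub>B w}"
  using edge_carrier by (auto simp: upper_nbrs_def)

lemma finite_upper_nbrs: "finite (upper_nbrs W S x w)"
  unfolding upper_nbrs_eq by (rule finite_subset[OF _ finite_ble[of w]]) auto

text \<open>The paths \<open>x \<rightarrow> y \<rightarrow> v \<le> w\<close> are counted by their midpoints, \<open>y\<close> having \<open>\<ell>(y,w) + df(y,w)\<close> upper neighbours.\<close>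

lemma second_coefficient_eq_defects:
  assumes "x \<le>\<^sub>B w"
  shows "2 * (coeff_q_minus_1 2 (\<Sum>v\<in>bruhat_interval W S x w. R_poly W S x v)
      - of_nat (length_diff W S x w choose 2)) =
    of_int (defect W S x w * (int (length_diff W S x w) - 1) + 
      (\<Sum>v\<in>upper_nbrs W S x w. defect W S v w))"
proof -
  let ?I = "bruhat_interval W S x w" and ?N = "upper_nbrs W S x w" and ?l = "length_diff W S x w"
  have c: "x \<in> carrier W" "w \<in> carrier W" using ble_carrier[OF assms] by auto
  have I: "finite ?I" by (rule finite_subset[OF _ finite_ble[of w]]) (auto simp: bruhat_interval_def)
  have NI: "?N \<subseteq> ?I" unfolding upper_nbrs_eq bruhat_interval_def using edge_ble by auto
  have pderiv_sum: "pderiv (sum f A) = (\<Sum>v\<in>A. pderiv (f v))" for f :: "'a \<Rightarrow> int poly" and A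
    by (induction A rule: infinite_finite_induct) (simp_all add: pderiv_add)
  have l: "int ?l = int (len w) - int (len x)" 
    using ble_len_le[OF assms] by (simp add: length_diff_def)
  have "poly (pderiv (pderiv (\<Sum>v\<in>?I. R_poly W S x v))) 1 = 
      (\<Sum>v\<in>?I. (int (len v) - int (len x) - 1) * of_bool (x \<rightarrow>\<^sub>B v) + int (card (between x v)))"
    unfolding pderiv_sum poly_sum using R_poly_Taylor[OF c(1)] ble_carrier(2)
    by (intro sum.cong) (auto simp: bruhat_interval_def)
  also have "\<dots> = (\<Sum>v\<in>?I. (int (len v) - int (len x) - 1) * of_bool (x \<rightarrow>\<^sub>B v)) 
      + (\<Sum>v\<in>?I. int (card (between x v)))"
    by (rule sum.distrib)
  also have "(\<Sum>v\<in>?I. (int (len v) - int (len x) - 1) * of_bool (x \<rightarrow>\<^sub>B v)) =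
      (\<Sum>v\<in>?N. int (len v) - int (len x) - 1)"
    using I NI by (intro sum.mono_neutral_cong_right) (auto simp: upper_nbrs_eq bruhat_interval_def)
  also have "(\<Sum>v\<in>?I. int (card (between x v))) = (\<Sum>y\<in>?N. int (card (upper_nbrs W S y w)))"
  proof -
    have "(\<Sum>v\<in>?I. card (between x v)) = card (SIGMA v:?I. between x v)"
      using I finite_between by (intro card_SigmaI[symmetric]) auto
    also have "\<dots> = card (SIGMA y:?N. upper_nbrs W S y w)"
    proof (rule bij_betw_same_card[of prod.swap], rule bij_betw_imageI)
      have "prod.swap ` (SIGMA v:?I. between x v) = {(y, v). x \<rightarrow>\<^sub>B y \<and> y \<rightarrow>\<^sub>B v \<and> x \<le>\<^sub>B v \<and> v \<le>\<^sub>B w}"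
        by (auto simp: bruhat_interval_def between_def image_iff)
      also have "\<dots> = (SIGMA y:?N. upper_nbrs W S y w)"
        using edge_ble ble_trans by (auto simp: upper_nbrs_eq) blast+
      finally show "prod.swap ` (SIGMA v:?I. between x v) = (SIGMA y:?N. upper_nbrs W S y w)" .
    qed simp
    also have "\<dots> = (\<Sum>y\<in>?N. card (upper_nbrs W S y w))"
      using finite_upper_nbrs by (intro card_SigmaI) auto
    finally show ?thesis by (simp flip: of_nat_sum)
  qed
  \<comment> \<open>The lengths \<ell>(x,v) - 1 and \<ell>(v,w) add up to \<ell>(x,w) - 1, which is
    the same for all \<open>v\<close>.\<close>
  also have "(\<Sum>v\<in>?N. int (len v) - int (len x) - 1) + (\<Sum>y\<in>?N. int (card (upper_nbrs W S y w))) =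
      (\<Sum>v\<in>?N. (int ?l - 1) + defect W S v w)"
    unfolding sum.distrib[symmetric]
  proof (intro sum.cong refl)
    fix v assume "v \<in> ?N"
    then have "len v \<le> len w" using ble_len_le by (auto simp: upper_nbrs_eq)
    then have "int (length_diff W S v w) = int (len w) - int (len v)" by (simp add: length_diff_def)
    then show "int (len v) - int (len x) - 1 + int (card (upper_nbrs W S v w)) = 
        (int ?l - 1) + defect W S v w"
      by (simp add: defect_def l)
  qed
  also have "\<dots> = int (card ?N) * (int ?l - 1) + (\<Sum>v\<in>?N. defect W S v w)"
    by (simp add: sum.distrib)
  also have "int (card ?N) = int ?l + defect W S x w" by (simp add: defect_def)
  finally have second: "poly (pderiv (pderiv (\<Sum>v\<in>?I. R_poly W S x v))) 1 = 
    (int ?l + defect W S x w) * (int ?l - 1) + (\<Sum>v\<in>?N. defect W S v w)" .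
  have "even (?l * (?l - 1))" by (cases ?l) simp_all
  then have "2 * (?l choose 2) = ?l * (?l - 1)" by (simp add: choose_two)
  then have "int (2 * (?l choose 2)) = int ?l * (int ?l - 1)" 
    by (cases ?l) (simp_all add: algebra_simps)
  then have choose: "2 * (of_nat (?l choose 2) :: rat) = of_int (int ?l * (int ?l - 1))"
    by (metis of_int_of_nat_eq of_nat_mult of_nat_numeral)
  have "2 * coeff_q_minus_1 2 (\<Sum>v\<in>?I. R_poly W S x v) = 
      of_int (poly (pderiv (pderiv (\<Sum>v\<in>?I. R_poly W S x v))) 1)"
    by (simp add: coeff_q_minus_1_def numeral_2_eq_2)
  then have "2 * (coeff_q_minus_1 2 (\<Sum>v\<in>?I. R_poly W S x v) - of_nat (?l choose 2)) = 
    of_int (poly (pderiv (pderiv (\<Sum>v\<in>?I. R_poly W S x v))) 1 - int ?l * (int ?l - 1))"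
    using choose by (simp add: right_diff_distrib)
  then show ?thesis unfolding second by (simp add: algebra_simps)
qed

text \<open>Covers the one length at which the factor \<ell>(x,w) - 1 would hide a positive
  defect.\<close>

lemma defect_eq_0_of_length_1:
  assumes "x \<le>\<^sub>B w" "length_diff W S x w = 1" shows "defect W S x w = 0"
proof -
  have l: "len w = Suc (len x)" using ble_len_le[OF assms(1)] assms(2) by (simp add: length_diff_def)
  then have "x \<noteq> w" by auto
  then obtain u where u: "x \<le>\<^sub>B u" "u \<rightarrow>\<^sub>B w" "len w = Suc (len u)" using ex_lower_cover[OF assms(1)] by blast
  then have "x = u" using ble_len[of x u] l by auto
  moreover have "v = w" if "x \<rightarrow>\<^sub>B v" "v \<le>\<^sub>B w" for v
    using edge_len[OF that(1)] ble_len[OF that(2)] l by auto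
  ultimately have "upper_nbrs W S x w = {w}" using u edge_carrier by (auto simp: upper_nbrs_eq)
  then show ?thesis using assms(2) by (simp add: defect_def)
qed

text \<open>The sum over upper neighbours may include \<open>w\<close>, whereas smoothness speaks
  only of elements strictly below \<open>w\<close>.\<close>

lemma defect_self: "defect W S w w = 0"
proof -
  have "\<not> (w \<rightarrow>\<^sub>B v \<and> v \<le>\<^sub>B w)" for v using edge_len ble_len_le by (meson leD)
  then have "upper_nbrs W S w w = {}" by (simp add: upper_nbrs_eq)
  then show ?thesis by (simp add: defect_def length_diff_def)
qed

end

theorem theorem2:
  fixes W :: "('a, 'b) monoid_scheme" and S :: "'a set" and u w :: 'a
  assumes "coxeter_system W S"
    and "crystallographic W S"
    and "u \<in> carrier W" and "w \<in> carrier W"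
    and "bruhat_le W S u w"
  shows "(\<forall>x. bruhat_le W S u x \<and> bruhat_less W S x w \<longrightarrow>
            coeff_q_minus_1 2 (\<Sum>v\<in>bruhat_interval W S x w. R_poly W S x v)
              - of_nat (length_diff W S x w choose 2) \<ge> 0) \<and>
         (singular_interval W S u w \<longleftrightarrow>
            (\<exists>x. bruhat_le W S u x \<and> bruhat_less W S x w \<and>
              coeff_q_minus_1 2 (\<Sum>v\<in>bruhat_interval W S x w. R_poly W S x v)
                - of_nat (length_diff W S x w choose 2) > 0))"
proof -
  interpret coxeter_system W S by (rule assms(1))
  let ?c = "\<lambda>x. coeff_q_minus_1 2 (\<Sum>v\<in>bruhat_interval W S x w. R_poly W S x v)
              - of_nat (length_diff W S x w choose 2)"
  let ?E = "\<lambda>x. defect W S x w * (int (length_diff W S x w) - 1)"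
    and ?D = "\<lambda>x. \<Sum>v\<in>upper_nbrs W S x w. defect W S v w"
  have c: "2 * ?c x = of_int (?E x + ?D x)" if "bruhat_less W S x w" for x
    using second_coefficient_eq_defects that by (simp add: bruhat_less_def)
  have D: "0 \<le> ?D x" for x
    using deodhar_inequality by (intro sum_nonneg) (simp add: upper_nbrs_eq)
  have l: "1 \<le> int (length_diff W S x w)" if "bruhat_less W S x w" for x
    using that ble_len[of x w] by (auto simp: bruhat_less_def length_diff_def)
  have E: "0 \<le> ?E x" if "bruhat_less W S x w" for x
    using deodhar_inequality l[OF that] that by (simp add: bruhat_less_def)
  have double: "0 \<le> 2 * r \<longleftrightarrow> 0 \<le> r" "0 < 2 * r \<longleftrightarrow> 0 < r" for r :: rat by simp_all
  have nonneg: "0 \<le> ?c x" if "bruhat_less W S x w" for x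
  proof -
    have "0 \<le> 2 * ?c x" 
      unfolding c[OF that] of_int_0_le_iff using D[of x] E[OF that] by (rule add_nonneg_nonneg[rotated])
    then show ?thesis by (simp only: double)
  qed
  have pos_iff: "0 < ?c x \<longleftrightarrow> 0 < ?E x + ?D x" if "bruhat_less W S x w" for x
  proof -
    have "0 < ?c x \<longleftrightarrow> 0 < 2 * ?c x" by (simp only: double)
    then show ?thesis unfolding c[OF that] of_int_0_less_iff .
  qed
  have "singular_interval W S u w \<longleftrightarrow> (\<exists>x. u \<le>\<^sub>B x \<and> bruhat_less W S x w \<and> 0 < ?E x + ?D x)"
  proof
    assume "singular_interval W S u w"
    then obtain x where x: "u \<le>\<^sub>B x" "bruhat_less W S x w" "defect W S x w \<noteq> 0"
      unfolding singular_interval_def rationally_smooth_def by blast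
    have xw: "x \<le>\<^sub>B w" using x(2) by (simp add: bruhat_less_def)
    have "0 < defect W S x w" using x(3) deodhar_inequality[OF xw] by simp
    moreover have "length_diff W S x w \<noteq> 1" using defect_eq_0_of_length_1[OF xw] x(3) by blast
    then have "1 < int (length_diff W S x w)" using l[OF x(2)] by linarith
    ultimately have "0 < ?E x" by simp
    then have "0 < ?E x + ?D x" using D[of x] by linarith
    with x show "\<exists>x. u \<le>\<^sub>B x \<and> bruhat_less W S x w \<and> 0 < ?E x + ?D x" by blast
  next
    assume "\<exists>x. u \<le>\<^sub>B x \<and> bruhat_less W S x w \<and> 0 < ?E x + ?D x"
    then obtain x where x: "u \<le>\<^sub>B x" "bruhat_less W S x w" "0 < ?E x + ?D x" by blast
    show "singular_interval W S u w"
    proof (rule ccontr)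
      assume "\<not> ?thesis"
      then have smooth: "defect W S y w = 0" if "u \<le>\<^sub>B y" "y \<le>\<^sub>B w" for y
        using that defect_self unfolding singular_interval_def rationally_smooth_def bruhat_less_def
        by (cases "y = w") auto
      have "defect W S x w = 0" using x(1,2) by (intro smooth) (auto simp: bruhat_less_def)
      \<comment> \<open>The upper neighbours of \<open>x\<close> below \<open>w\<close> again lie in
        the interval from \<open>u\<close> to \<open>w\<close>.\<close>
      moreover have "?D x = 0"
        using x(1) edge_ble ble_trans by (intro sum.neutral) (auto simp: upper_nbrs_eq intro!: smooth)
      ultimately show False using x(3) by simp
    qed
  qed
  then show ?thesis using nonneg pos_iff by blast
qed

end
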